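(* Let $X$ be an infinite-dimensional Banach space over $\mathbb{K}\in\{\mathbb{R},\mathbb{C}\}$. Then $X$ admits an equivalent norm $|||\cdot|||$ such that, for $Z=(X,|||\cdot|||)$, there exists a map \[ \Psi:\mathcal{P}([0,1])\to S_{Z\widehat{\otimes}_\pi Z} \] which is affine and a homeomorphism onto its image (with the weak-star topology on $\mathcal{P}([0,1])$ and the norm topology on $Z\widehat{\otimes}_\pi Z$), such that $\Psi(\mathcal{P}([0,1]))\subseteq \mathrm{INA}_\pi(Z\widehat{\otimes}_\pi Z)$ and, for every $\alpha\in\mathcal{P}([0,1])$, \[ \Psi(\alpha)\in \mathrm{NA}_\pi(Z\widehat{\otimes}_\pi Z)\iff \alpha \text{ is countably supported}. \]
   Context: For a Banach space $X$, $B_X$ and $S_X$ denote the closed unit ball and unit sphere. $X\widehat{\otimes}_\pi Y$ is the completed projective tensor product of Banach spaces $X,Y$ (over the same field), with projective norm $\|\cdot\|_\pi$. $\mathrm{NA}_\pi(X\widehat{\otimes}_\pi Y)$ is the set of $u\in X\widehat{\otimes}_\pi Y$ that can be written as $u=\sum_{n=1}^\infty \lambda_n x_n\otimes y_n$ with $(x_n,y_n)\in B_X\times B_Y$, $\lambda_n\ge 0$ and $\sum_{n=1}^\infty\lambda_n=\|u\|_\pi$. $\mathrm{INA}_\pi(X\widehat{\otimes}_\pi Y)$ is the set of $u\in X\widehat{\otimes}_\pi Y$ for which there is a finite positive Borel measure $\mu$ on $B_X\times B_Y$ (Borel $\sigma$-algebra of the product of the norm topologies) such that $\varphi:B_X\times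 B_Y\to X\widehat{\otimes}_\pi Y$, $\varphi(x,y)=x\otimes y$, is $\mu$-Bochner integrable, $u=\int_{B_X\times B_Y}\varphi\,d\mu$, and $\|u\|_\pi=\|\mu\|$, where $\|\mu\|=\mu(B_X\times B_Y)$. $\mathcal{P}([0,1])$ is the set of Borel probability measures on $[0,1]$ with the weak-star topology inherited from $C([0,1])^*$. A measure $\alpha\in\mathcal{P}([0,1])$ is countably supported if it is concentrated on a countable subset of $[0,1]$, equivalently $\alpha=\sum_{n=1}^\infty\lambda_n\delta_{t_n}$ with $t_n\in[0,1]$, $\lambda_n\ge0$, $\sum_n\lambda_n=1$. *)

theory Defs
  imports "HOL-Probability.Probability_Measure" "HOL-Library.Function_Algebras"
begin

section \<open>Scalars and normed spaces\<close>

(* Up to isometric isomorphism of fields, the types of this class are R and C.  The condition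
   h (of_real r) = of_real r is not imposed because it follows: h is additive and isometric. *)
class real_or_complex = real_normed_field +
  assumes real_or_complex: "\<exists>h :: 'a \<Rightarrow> complex.
    (\<forall>x y. h (x + y) = h x + h y) \<and> (\<forall>x y. h (x * y) = h x * h y) \<and>
    (\<forall>x. cmod (h x) = norm x) \<and> (range h = \<real> \<or> range h = UNIV)"

instance real :: real_or_complex
proof
  have "range complex_of_real = \<real>"
    by (simp add: Reals_def)
  then show "\<exists>h :: real \<Rightarrow> complex.
    (\<forall>x y. h (x + y) = h x + h y) \<and> (\<forall>x y. h (x * y) = h x * h y) \<and>
    (\<forall>x. cmod (h x) = norm x) \<and> (range h = \<real> \<or> range h = UNIV)"
    by (intro exI[of _ complex_of_real]) auto
qed

instance complex :: real_or_complex
  by standard (intro exI[of _ "\<lambda>x. x"], auto)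

(* A norm is a parameter, not a type class operation, because the renormed space shares its type
   with the original one.  The space is a subspace V of an ambient vector space; p is irrelevant
   outside V. *)
locale normed_space_on = vector_space scl
  for scl :: "'k::real_normed_field \<Rightarrow> 'v::ab_group_add \<Rightarrow> 'v" +
  fixes V :: "'v set" and p :: "'v \<Rightarrow> real"
  assumes subspace_V: "subspace V"
    and norm_eq_0_iff: "v \<in> V \<Longrightarrow> p v = 0 \<longleftrightarrow> v = 0"
    and norm_triangle: "u \<in> V \<Longrightarrow> v \<in> V \<Longrightarrow> p (u + v) \<le> p u + p v"
    and norm_scale: "v \<in> V \<Longrightarrow> p (scl c v) = norm c * p v"

(* The case distinction is there because the locale Metric_space wants a distance that is nonnegative
   and symmetric also outside the carrier. *)
definition norm_dist :: "'v::ab_group_add set \<Rightarrow> ('v \<Rightarrow> real) \<Rightarrow> 'v \<Rightarrow> 'v \<Rightarrow> real" where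
  "norm_dist V p u v = (if u \<in> V \<and> v \<in> V then p (u - v) else 0)"

definition norm_topology :: "'v::ab_group_add set \<Rightarrow> ('v \<Rightarrow> real) \<Rightarrow> 'v topology" where
  "norm_topology V p = Metric_space.mtopology V (norm_dist V p)"

locale banach_space_on = normed_space_on scl V p
  for scl :: "'k::real_normed_field \<Rightarrow> 'v::ab_group_add \<Rightarrow> 'v" and V p +
  assumes complete: "Metric_space.mcomplete V (norm_dist V p)"

definition infinite_dimensional :: "('k::field \<Rightarrow> 'v::ab_group_add \<Rightarrow> 'v) \<Rightarrow> bool" where
  "infinite_dimensional scl \<longleftrightarrow> \<not> (\<exists>B. finite B \<and> module.span scl B = UNIV)"

definition equivalent_norm ::
  "('k::real_normed_field \<Rightarrow> 'v::real_normed_vector \<Rightarrow> 'v) \<Rightarrow> ('v \<Rightarrow> real) \<Rightarrow> bool" where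
  "equivalent_norm scl N \<longleftrightarrow> normed_space_on scl UNIV N \<and>
     (\<exists>c>0. \<exists>C>0. \<forall>x. c * norm x \<le> N x \<and> N x \<le> C * norm x)"

definition unit_ball :: "('v \<Rightarrow> real) \<Rightarrow> 'v set" where
  "unit_ball p = {x. p x \<le> 1}"

section \<open>The completed projective tensor product\<close>

definition bilinear_form ::
  "('k::field \<Rightarrow> 'a::ab_group_add \<Rightarrow> 'a) \<Rightarrow> ('k \<Rightarrow> 'b::ab_group_add \<Rightarrow> 'b) \<Rightarrow> ('a \<Rightarrow> 'b \<Rightarrow> 'k) \<Rightarrow> bool"
where
  "bilinear_form sX sY B \<longleftrightarrow>
     (\<forall>y. Vector_Spaces.linear sX (*) (\<lambda>x. B x y)) \<and> (\<forall>x. Vector_Spaces.linear sY (*) (\<lambda>y. B x y))"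

(* The algebraic tensor product is realised in the usual way as a space of functionals on the space
   of all (not only the bounded) bilinear forms: the elementary tensor of x and y is evaluation at
   (x, y).  The value 0 off the bilinear forms is a dummy. *)
definition tensor ::
  "('k::field \<Rightarrow> 'a::ab_group_add \<Rightarrow> 'a) \<Rightarrow> ('k \<Rightarrow> 'b::ab_group_add \<Rightarrow> 'b) \<Rightarrow> 'a \<Rightarrow> 'b \<Rightarrow> ('a \<Rightarrow> 'b \<Rightarrow> 'k) \<Rightarrow> 'k"
where
  "tensor sX sY x y = (\<lambda>B. if bilinear_form sX sY B then B x y else 0)"

definition fun_scale :: "'k::times \<Rightarrow> ('i \<Rightarrow> 'k) \<Rightarrow> 'i \<Rightarrow> 'k" where
  "fun_scale c u = (\<lambda>i. c * u i)"

definition tensor_product ::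
  "('k::field \<Rightarrow> 'a::ab_group_add \<Rightarrow> 'a) \<Rightarrow> ('k \<Rightarrow> 'b::ab_group_add \<Rightarrow> 'b) \<Rightarrow> (('a \<Rightarrow> 'b \<Rightarrow> 'k) \<Rightarrow> 'k) set"
where
  "tensor_product sX sY = module.span fun_scale {tensor sX sY x y | x y. True}"

definition proj_norm ::
  "('k::field \<Rightarrow> 'a::ab_group_add \<Rightarrow> 'a) \<Rightarrow> ('a \<Rightarrow> real) \<Rightarrow> ('k \<Rightarrow> 'b::ab_group_add \<Rightarrow> 'b) \<Rightarrow> ('b \<Rightarrow> real)
    \<Rightarrow> (('a \<Rightarrow> 'b \<Rightarrow> 'k) \<Rightarrow> 'k) \<Rightarrow> real"
where
  "proj_norm sX N sY M u =
     Inf {(\<Sum>i<n. N (x i) * M (y i)) | (n::nat) x y. u = (\<Sum>i<n. tensor sX sY (x i) (y i))}"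

definition completion_map ::
  "('k::real_normed_field \<Rightarrow> 'v::ab_group_add \<Rightarrow> 'v) \<Rightarrow> 'v set \<Rightarrow> ('v \<Rightarrow> real) \<Rightarrow>
   ('k \<Rightarrow> 'w::ab_group_add \<Rightarrow> 'w) \<Rightarrow> 'w set \<Rightarrow> ('w \<Rightarrow> real) \<Rightarrow> ('v \<Rightarrow> 'w) \<Rightarrow> bool"
where
  "completion_map sV V p sW W q \<iota> \<longleftrightarrow> banach_space_on sW W q \<and> \<iota> ` V \<subseteq> W \<and>
     (\<forall>u\<in>V. \<forall>v\<in>V. \<iota> (u + v) = \<iota> u + \<iota> v) \<and> (\<forall>c. \<forall>v\<in>V. \<iota> (sV c v) = sW c (\<iota> v)) \<and>
     (\<forall>v\<in>V. q (\<iota> v) = p v) \<and> norm_topology W q closure_of (\<iota> ` V) = W"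

(* (W, q) is a realisation of the completed projective tensor product of the normed spaces given by
   N and M, and \<tau> x y is the elementary tensor of x and y in it.  The completion is only determined
   up to a unique isometric isomorphism, so all its realisations are admitted; that there is one is
   theorem completed_projective_tensor_exists below. *)
definition completed_projective_tensor ::
  "('k::real_normed_field \<Rightarrow> 'a::ab_group_add \<Rightarrow> 'a) \<Rightarrow> ('a \<Rightarrow> real) \<Rightarrow>
   ('k \<Rightarrow> 'b::ab_group_add \<Rightarrow> 'b) \<Rightarrow> ('b \<Rightarrow> real) \<Rightarrow>
   ('k \<Rightarrow> 'w::ab_group_add \<Rightarrow> 'w) \<Rightarrow> 'w set \<Rightarrow> ('w \<Rightarrow> real) \<Rightarrow> ('a \<Rightarrow> 'b \<Rightarrow> 'w) \<Rightarrow> bool"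
where
  "completed_projective_tensor sX N sY M sW W q \<tau> \<longleftrightarrow>
     (\<exists>\<iota>. completion_map fun_scale (tensor_product sX sY) (proj_norm sX N sY M) sW W q \<iota> \<and>
        (\<forall>x y. \<tau> x y = \<iota> (tensor sX sY x y)))"

section \<open>Norm attainment and integral norm attainment\<close>

definition NA_proj ::
  "('a \<Rightarrow> real) \<Rightarrow> ('b \<Rightarrow> real) \<Rightarrow> ('k::real_normed_field \<Rightarrow> 'w::ab_group_add \<Rightarrow> 'w) \<Rightarrow> 'w set \<Rightarrow> ('w \<Rightarrow> real)
    \<Rightarrow> ('a \<Rightarrow> 'b \<Rightarrow> 'w) \<Rightarrow> 'w set"
where
  "NA_proj N M sW W q \<tau> = {u \<in> W. \<exists>(l :: nat \<Rightarrow> real) x y.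
     (\<forall>n. x n \<in> unit_ball N \<and> y n \<in> unit_ball M \<and> 0 \<le> l n) \<and>
     limitin (norm_topology W q) (\<lambda>k. \<Sum>n<k. sW (of_real (l n)) (\<tau> (x n) (y n))) u sequentially \<and>
     l sums q u}"

(* Borel sets of the product topology, which for nonseparable spaces can be more than the product of
   the two Borel algebras. *)
definition ball_borel ::
  "('a::ab_group_add \<Rightarrow> real) \<Rightarrow> ('b::ab_group_add \<Rightarrow> real) \<Rightarrow> ('a \<times> 'b) measure"
where
  "ball_borel N M = (let D = unit_ball N \<times> unit_ball M in
     sigma D {U. openin (subtopology (prod_topology (norm_topology UNIV N) (norm_topology UNIV M)) D) U})"

definition simple_integral_on ::
  "('k::real_normed_field \<Rightarrow> 'w::ab_group_add \<Rightarrow> 'w) \<Rightarrow> 'm measure \<Rightarrow> ('m \<Rightarrow> 'w) \<Rightarrow> 'w"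
where
  "simple_integral_on sW \<mu> s = (\<Sum>w\<in>s ` space \<mu>. sW (of_real (measure \<mu> (s -` {w} \<inter> space \<mu>))) w)"

(* The Bochner integral for a finite measure \<mu>.  The library's has_bochner_integral does not apply:
   it is confined to second countable target types. *)
definition has_bochner_integral_on ::
  "('k::real_normed_field \<Rightarrow> 'w::ab_group_add \<Rightarrow> 'w) \<Rightarrow> 'w set \<Rightarrow> ('w \<Rightarrow> real) \<Rightarrow>
   'm measure \<Rightarrow> ('m \<Rightarrow> 'w) \<Rightarrow> 'w \<Rightarrow> bool"
where
  "has_bochner_integral_on sW W q \<mu> f u \<longleftrightarrow>
     (\<exists>s :: nat \<Rightarrow> 'm \<Rightarrow> 'w. (\<forall>n. simple_function \<mu> (s n) \<and> s n ` space \<mu> \<subseteq> W) \<and>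
        (AE z in \<mu>. limitin (norm_topology W q) (\<lambda>n. s n z) (f z) sequentially) \<and>
        (\<lambda>n. \<integral>\<^sup>+z. ennreal (q (f z - s n z)) \<partial>\<mu>) \<longlonglongrightarrow> 0 \<and>
        limitin (norm_topology W q) (\<lambda>n. simple_integral_on sW \<mu> (s n)) u sequentially)"

definition INA_proj ::
  "('a::ab_group_add \<Rightarrow> real) \<Rightarrow> ('b::ab_group_add \<Rightarrow> real) \<Rightarrow> ('k::real_normed_field \<Rightarrow> 'w::ab_group_add \<Rightarrow> 'w)
    \<Rightarrow> 'w set \<Rightarrow> ('w \<Rightarrow> real) \<Rightarrow> ('a \<Rightarrow> 'b \<Rightarrow> 'w) \<Rightarrow> 'w set"
where
  "INA_proj N M sW W q \<tau> = {u \<in> W. \<exists>\<mu>. sets \<mu> = sets (ball_borel N M) \<and> finite_measure \<mu> \<and>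
     has_bochner_integral_on sW W q \<mu> (\<lambda>(x, y). \<tau> x y) u \<and> q u = measure \<mu> (space \<mu>)}"

section \<open>Probability measures on the unit interval\<close>

definition prob01 :: "real measure set" where
  "prob01 = {\<alpha>. prob_space \<alpha> \<and> sets \<alpha> = sets (restrict_space borel {0..1})}"

(* Real-valued test functions also induce the weak-star topology of the complex space C([0,1]),
   by splitting into real and imaginary parts. *)
definition weak_star :: "real measure topology" where
  "weak_star = (let C = {f :: real \<Rightarrow> real. continuous_on {0..1} f} in
     pullback_topology prob01 (\<lambda>\<alpha>. \<lambda>f\<in>C. \<integral>t. f t \<partial>\<alpha>) (powertop_real C))"

definition countably_supported :: "real measure \<Rightarrow> bool" where
  "countably_supported \<alpha> \<longleftrightarrow> (\<exists>C\<subseteq>{0..1}. countable C \<and> emeasure \<alpha> ({0..1} - C) = 0)"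

definition affine_on_prob01 ::
  "('k::real_normed_field \<Rightarrow> 'w::ab_group_add \<Rightarrow> 'w) \<Rightarrow> (real measure \<Rightarrow> 'w) \<Rightarrow> bool"
where
  "affine_on_prob01 sW \<Psi> \<longleftrightarrow> (\<forall>\<alpha>\<in>prob01. \<forall>\<beta>\<in>prob01. \<forall>\<gamma>\<in>prob01. \<forall>t\<in>{0..1}.
     (\<forall>A\<in>sets \<gamma>. measure \<gamma> A = (1 - t) * measure \<alpha> A + t * measure \<beta> A) \<longrightarrow>
     \<Psi> \<gamma> = sW (of_real (1 - t)) (\<Psi> \<alpha>) + sW (of_real t) (\<Psi> \<beta>))"

section \<open>Existence of the completed projective tensor product\<close>

lemma rc_cases:
  obtains (real) "\<And>c :: 'k::real_or_complex. \<exists>r. c = of_real r"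
  | (complex) j :: "'k::real_or_complex" where "j * j = -1" "norm j = 1"
      "\<And>c. \<exists>a b. c = of_real a + j * of_real b"
proof -
  obtain h :: "'k \<Rightarrow> complex" where add: "\<And>x y. h (x + y) = h x + h y"
    and mult: "\<And>x y. h (x * y) = h x * h y" and nrm: "\<And>x. cmod (h x) = norm x"
    and rng: "range h = \<real> \<or> range h = UNIV"
    using real_or_complex by blast
  have h1: "h 1 = 1"
  proof -
    have "h 1 * h 1 = h 1 * 1" using mult[of 1 1] by simp
    moreover have "h 1 \<noteq> 0" using nrm[of 1] by auto
    ultimately show ?thesis using mult_left_cancel by blast
  qed
  have h0: "h 0 = 0" using nrm[of 0] by simp
  have hdiff: "h (x - y) = h x - h y" for x y
    using add[of "x - y" y] by simp
  have hm: "h (- x) = - h x" for x using hdiff[of 0 x] h0 by simp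
  have inj: "x = y" if "h x = h y" for x y
    using that hdiff[of x y] nrm[of "x - y"] by simp
  have hr: "h (of_real r) = of_real r" for r
  proof -
    let ?z = "h (of_real r)"
    have 1: "cmod ?z = \<bar>r\<bar>" using nrm[of "of_real r"] by simp
    have "of_real r + 1 = (of_real (r + 1) :: 'k)" by simp
    then have 2: "cmod (?z + 1) = \<bar>r + 1\<bar>"
      using nrm[of "of_real r + 1"] add[of "of_real r" 1] h1 by (metis norm_of_real)
    have a: "(Re ?z)\<^sup>2 + (Im ?z)\<^sup>2 = r\<^sup>2"
      using 1 cmod_power2[of ?z] by simp
    have b: "(Re ?z + 1)\<^sup>2 + (Im ?z)\<^sup>2 = (r + 1)\<^sup>2"
      using 2 cmod_power2[of "?z + 1"] by simp
    have re: "Re ?z = r" using a b by (simp add: power2_eq_square algebra_simps)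
    with a have "Im ?z = 0" by simp
    with re show ?thesis by (simp add: complex_eq_iff)
  qed
  from rng show thesis
  proof
    assume r: "range h = \<real>"
    have "\<exists>r. c = of_real r" for c :: 'k
    proof -
      have "h c \<in> \<real>" using r by blast
      then obtain r where "h c = of_real r" by (auto elim: Reals_cases)
      then have "c = of_real r" by (intro inj) (simp add: hr)
      then show ?thesis ..
    qed
    then show thesis by (rule real)
  next
    assume r: "range h = UNIV"
    then obtain j where j: "h j = \<i>" by (metis UNIV_I imageE)
    show thesis
    proof (rule complex)
      show "j * j = -1" by (intro inj) (simp add: mult j hm h1)
      show "norm j = 1" using nrm[of j] j by simp
      fix c
      have "c = of_real (Re (h c)) + j * of_real (Im (h c))"
        by (intro inj) (simp add: add mult j hr complex_eq_iff)
      then show "\<exists>a b. c = of_real a + j * of_real b" by blast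
    qed
  qed
qed

definition sublinear :: "(real \<Rightarrow> 'v::ab_group_add \<Rightarrow> 'v) \<Rightarrow> ('v \<Rightarrow> real) \<Rightarrow> bool" where
  "sublinear rs q \<longleftrightarrow> (\<forall>x y. q (x + y) \<le> q x + q y) \<and> (\<forall>t>0. \<forall>x. q (rs t x) \<le> t * q x)"

context
  fixes rs :: "real \<Rightarrow> 'v::ab_group_add \<Rightarrow> 'v"
  assumes vs: "vector_space rs"
begin

interpretation R: vector_space rs by (rule vs)

lemma sublinear_props:
  assumes "sublinear rs q"
  shows sublinear_0: "q 0 = 0" and sublinear_low: "- q (- x) \<le> q x"
    and sublinear_pos: "t \<ge> 0 \<Longrightarrow> q (rs t x) = t * q x"
proof -
  have add: "\<And>x y. q (x + y) \<le> q x + q y" and hom: "\<And>t x. t > 0 \<Longrightarrow> q (rs t x) \<le> t * q x"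
    using assms by (auto simp: sublinear_def)
  show 0: "q 0 = 0" using hom[of 2 0] hom[of "1/2" 0] by simp
  show "- q (- x) \<le> q x" using add[of x "- x"] 0 by simp
  show "q (rs t x) = t * q x" if t: "t \<ge> 0"
  proof (cases "t = 0")
    case True then show ?thesis by (simp add: 0)
  next
    case False
    then have t: "t > 0" using t by simp
    have "q x \<le> 1 / t * q (rs t x)" using hom[of "1/t" "rs t x"] t by simp
    then have "t * q x \<le> q (rs t x)" using t by (simp add: field_simps)
    with hom[OF t] show ?thesis by (meson antisym)
  qed
qed

lemma sublinear_reduce:
  assumes q: "sublinear rs q"
  shows "\<exists>r. sublinear rs r \<and> r \<le> q \<and> (\<forall>x. r x \<le> q (x + y) - q y)"
proof -
  have add: "\<And>x y. q (x + y) \<le> q x + q y" using q by (auto simp: sublinear_def)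
  note pos = sublinear_pos[OF q]
  define F where "F x t = q (x + rs t y) - t * q y" for x t
  define r where "r x = Inf (F x ` {0..})" for x
  have low: "- q (- x) \<le> F x t" if "t \<ge> 0" for x t
    using add[of "x + rs t y" "- x"] pos[OF that, of y] by (simp add: F_def)
  have bdd: "bdd_below (F x ` {0..})" for x
    using low by (intro bdd_belowI[of _ "- q (- x)"]) auto
  have le: "r x \<le> F x t" if "t \<ge> 0" for x t
    unfolding r_def using that bdd by (intro cINF_lower) auto
  have ge: "c \<le> r x" if "\<And>t. t \<ge> 0 \<Longrightarrow> c \<le> F x t" for c x
    unfolding r_def using that by (intro cINF_greatest) auto
  have "sublinear rs r"
    unfolding sublinear_def
  proof (intro conjI allI impI)
    fix x x'
    have 1: "r (x + x') \<le> F x t + F x' t'" if "t \<ge> 0" "t' \<ge> 0" for t t'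
    proof -
      have "r (x + x') \<le> F (x + x') (t + t')" using that by (intro le) auto
      also have "\<dots> \<le> F x t + F x' t'"
        using add[of "x + rs t y" "x' + rs t' y"]
        by (simp add: F_def algebra_simps)
      finally show ?thesis .
    qed
    have 2: "r (x + x') - F x' t' \<le> r x" if "t' \<ge> 0" for t'
      by (intro ge) (use 1 that in \<open>simp add: algebra_simps\<close>)
    have "r (x + x') - r x \<le> r x'"
      by (intro ge) (use 2 in \<open>simp add: algebra_simps\<close>)
    then show "r (x + x') \<le> r x + r x'" by simp
  next
    fix s :: real and x assume s: "s > 0"
    have "r (rs s x) / s \<le> r x"
    proof (intro ge)
      fix t :: real assume t: "t \<ge> 0"
      have "r (rs s x) \<le> F (rs s x) (s * t)" using s t by (intro le) auto
      also have "\<dots> = s * F x t"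
      proof -
        have "rs s x + rs (s * t) y = rs s (x + rs t y)" by (simp add: R.scale_right_distrib)
        then have "q (rs s x + rs (s * t) y) = s * q (x + rs t y)" using s pos by simp
        then show ?thesis by (simp add: F_def algebra_simps)
      qed
      finally show "r (rs s x) / s \<le> F x t" using s by (simp add: field_simps)
    qed
    then show "r (rs s x) \<le> s * r x" using s by (simp add: field_simps)
  qed
  moreover have "r x \<le> q x" for x using le[of 0 x] by (simp add: F_def)
  moreover have "r x \<le> q (x + y) - q y" for x using le[of 1 x] by (simp add: F_def)
  ultimately show ?thesis by (auto simp: le_fun_def)
qed

lemma sublinear_dominates_linear:
  assumes q0: "sublinear rs q0"
  shows "\<exists>g. (\<forall>x y. g (x + y) = g x + g y) \<and> (\<forall>t x. g (rs t x) = t * g x) \<and> g \<le> q0"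
proof -
  define A where "A = {q. sublinear rs q \<and> q \<le> q0}"
  have "\<exists>m\<in>A. \<forall>a\<in>A. m \<ge> a \<longrightarrow> a = m"
  proof (rule predicate_Zorn)
    show "partial_order_on A (relation_of (\<ge>) A)"
      by (rule partial_order_on_relation_ofI) auto
  next
    fix C assume C: "C \<in> Chains (relation_of (\<ge>) A)"
    have CA: "C \<subseteq> A" and chain: "\<And>a b. a \<in> C \<Longrightarrow> b \<in> C \<Longrightarrow> a \<le> b \<or> b \<le> a"
      using C by (auto simp: Chains_def relation_of_def)
    show "\<exists>u\<in>A. \<forall>a\<in>C. a \<ge> u"
    proof (cases "C = {}")
      case True
      then show ?thesis using q0 by (auto simp: A_def)
    next
      case False
      define u where "u x = (INF q\<in>C. q x)" for x
      have low: "- q0 (- x) \<le> q x" if "q \<in> C" for q x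
      proof -
        have "sublinear rs q" "q (- x) \<le> q0 (- x)" using that CA by (auto simp: A_def le_fun_def)
        then show ?thesis using sublinear_low[of q x] by linarith
      qed
      have bdd: "bdd_below ((\<lambda>q. q x) ` C)" for x
        using low by (intro bdd_belowI[of _ "- q0 (- x)"]) auto
      have le: "u x \<le> q x" if "q \<in> C" for q x
        unfolding u_def using that bdd by (intro cINF_lower) auto
      have ge: "c \<le> u x" if "\<And>q. q \<in> C \<Longrightarrow> c \<le> q x" for c x
        unfolding u_def using that False by (intro cINF_greatest) auto
      have sub: "sublinear rs q" if "q \<in> C" for q using that CA by (auto simp: A_def)
      have "sublinear rs u"
        unfolding sublinear_def
      proof (intro conjI allI impI)
        fix x y
        have 1: "u (x + y) \<le> q x + q' y" if q: "q \<in> C" "q' \<in> C" for q q'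
        proof -
          obtain r where r: "r \<in> C" "r \<le> q" "r \<le> q'" using chain[OF q] q by auto
          have "u (x + y) \<le> r (x + y)" using r le by blast
          also have "\<dots> \<le> r x + r y" using sub[OF r(1)] by (simp add: sublinear_def)
          also have "\<dots> \<le> q x + q' y" using r by (simp add: le_fun_def add_mono)
          finally show ?thesis .
        qed
        have 2: "u (x + y) - q' y \<le> u x" if "q' \<in> C" for q'
          by (intro ge) (use 1 that in \<open>simp add: algebra_simps\<close>)
        have "u (x + y) - u x \<le> u y"
          by (intro ge) (use 2 in \<open>simp add: algebra_simps\<close>)
        then show "u (x + y) \<le> u x + u y" by simp
      next
        fix t :: real and x assume t: "t > 0"
        have "u (rs t x) / t \<le> u x"
        proof (intro ge)
          fix q assume q: "q \<in> C"
          have "u (rs t x) \<le> q (rs t x)" by (rule le[OF q])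
          also have "\<dots> \<le> t * q x" using sub[OF q] t by (simp add: sublinear_def)
          finally show "u (rs t x) / t \<le> q x" using t by (simp add: field_simps)
        qed
        then show "u (rs t x) \<le> t * u x" using t by (simp add: field_simps)
      qed
      moreover have "u \<le> q0"
      proof -
        obtain q where "q \<in> C" using False by blast
        then have "u \<le> q" "q \<le> q0" using le CA by (auto simp: le_fun_def A_def)
        then show ?thesis by simp
      qed
      ultimately have "u \<in> A" by (simp add: A_def)
      then show ?thesis using le by (intro bexI[of _ u]) (auto simp: le_fun_def)
    qed
  qed
  then obtain g where gA: "g \<in> A" and min: "\<And>a. a \<in> A \<Longrightarrow> a \<le> g \<Longrightarrow> a = g" by blast
  have g: "sublinear rs g" "g \<le> q0" using gA by (auto simp: A_def)
  have add: "g (x + y) = g x + g y" for x y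
  proof -
    obtain r where r: "sublinear rs r" "r \<le> g" "\<And>x. r x \<le> g (x + y) - g y"
      using sublinear_reduce[OF g(1)] by blast
    have "r = g" using r g by (intro min) (auto simp: A_def)
    then have "g x + g y \<le> g (x + y)" using r(3)[of x] by simp
    moreover have "g (x + y) \<le> g x + g y" using g(1) by (simp add: sublinear_def)
    ultimately show ?thesis by simp
  qed
  have neg: "g (- x) = - g x" for x
    using add[of x "- x"] sublinear_0[OF g(1)] by simp
  have "g (rs t x) = t * g x" for t x
  proof (cases "t \<ge> 0")
    case True then show ?thesis by (rule sublinear_pos[OF g(1)])
  next
    case False
    then have "g (rs (- t) x) = - t * g x" by (intro sublinear_pos[OF g(1)]) simp
    then show ?thesis using neg[of "rs t x"] by simp
  qed
  then show ?thesis using add g(2) by blast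
qed

lemma real_norming_functional:
  assumes add: "\<And>x y. p (x + y) \<le> p x + p y" and hom: "\<And>t x. p (rs t x) = \<bar>t\<bar> * p x"
  shows "\<exists>g. (\<forall>x y. g (x + y) = g x + g y) \<and> (\<forall>t x. g (rs t x) = t * g x) \<and>
    (\<forall>x. \<bar>g x\<bar> \<le> p x) \<and> g a = p a"
proof -
  have p: "sublinear rs p" using add hom by (simp add: sublinear_def)
  obtain r where r: "sublinear rs r" "r \<le> p" "\<And>x. r x \<le> p (x + a) - p a"
    using sublinear_reduce[OF p] by blast
  obtain g where g: "\<And>x y. g (x + y) = g x + g y" "\<And>t x. g (rs t x) = t * g x" "g \<le> r"
    using sublinear_dominates_linear[OF r(1)] by blast
  have gp: "g x \<le> p x" for x using g(3) r(2) by (meson le_funD order_trans)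
  have neg: "g (- x) = - g x" "p (- x) = p x" for x using g(2)[of "-1" x] hom[of "-1" x] by simp_all
  have abs: "\<bar>g x\<bar> \<le> p x" for x using gp[of x] gp[of "- x"] neg[of x] by simp
  have "g (- a) \<le> p 0 - p a" using g(3) r(3)[of "- a"] by (metis le_funD order_trans add.left_inverse)
  then have "p a \<le> g a" using neg sublinear_0[OF p] by simp
  with gp[of a] have "g a = p a" by simp
  with g abs show ?thesis by blast
qed

end

lemma (in vector_space) real_vs:
  fixes r :: "real \<Rightarrow> 'a"
  assumes "\<And>a b. r (a + b) = r a + r b" "\<And>a b. r (a * b) = r a * r b" "r 1 = 1"
  shows "vector_space (\<lambda>t. scale (r t))"
  by standard (simp_all add: assms scale_left_distrib scale_right_distrib)

lemma seminorm_functional: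
  fixes scl :: "'k::real_or_complex \<Rightarrow> 'v::ab_group_add \<Rightarrow> 'v"
  assumes vs: "vector_space scl"
    and add: "\<And>x y. p (x + y) \<le> p x + p y" and hom: "\<And>c x. p (scl c x) = norm c * p x"
    and pa: "p a \<noteq> 0"
  shows "\<exists>f. Vector_Spaces.linear scl (*) f \<and> (\<exists>C. \<forall>x. norm (f x) \<le> C * p x) \<and> f a = 1"
proof -
  interpret vector_space scl by (rule vs)
  interpret kk: vector_space "(*) :: 'k \<Rightarrow> 'k \<Rightarrow> 'k"
    by standard (simp_all add: algebra_simps)
  have rvs: "vector_space (\<lambda>t :: real. scl (of_real t))"
    by (rule real_vs) simp_all
  obtain g where g: "\<And>x y. g (x + y) = g x + g y" "\<And>t x. g (scl (of_real t) x) = t * g x"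
      "\<And>x. \<bar>g x\<bar> \<le> p x" "g a = p a"
    using real_norming_functional[OF rvs, of p a] add hom by auto
  have "\<exists>f :: 'v \<Rightarrow> 'k. (\<forall>x y. f (x + y) = f x + f y) \<and> (\<forall>c x. f (scl c x) = c * f x) \<and>
      (\<forall>x. norm (f x) \<le> 2 * p x) \<and> f a \<noteq> 0"
  proof (cases rule: rc_cases[where 'k = 'k])
    case real
    have "(of_real (g (scl c x)) :: 'k) = c * of_real (g x)" for c x
      using real[of c] by (auto simp: g)
    moreover have "norm (of_real (g x) :: 'k) \<le> 2 * p x" for x
      using g(3)[of x] abs_ge_zero[of "g x"] by simp
    moreover have "(of_real (g a) :: 'k) \<noteq> 0" using g(4) pa by simp
    ultimately show ?thesis
      by (intro exI[of _ "\<lambda>x. of_real (g x)"]) (simp add: g(1))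
  next
    case (complex j)
    define f where "f x = of_real (g x) - j * of_real (g (scl j x))" for x
    have fadd: "f (x + y) = f x + f y" for x y
      by (simp add: f_def g(1) scale_right_distrib algebra_simps)
    have fr: "f (scl (of_real r) x) = of_real r * f x" for r x
    proof -
      have "scl j (scl (of_real r) x) = scl (of_real r) (scl j x)" by (simp add: mult.commute)
      then show ?thesis by (simp only: f_def g(2) of_real_mult algebra_simps)
    qed
    have gm: "g (- x) = - g x" for x using g(2)[of "-1" x] by simp
    have fj: "f (scl j x) = j * f x" for x
    proof -
      have "scl j (scl j x) = - x" by (simp add: complex(1))
      then have "f (scl j x) = of_real (g (scl j x)) + j * of_real (g x)" by (simp add: f_def gm)
      also have "\<dots> = j * f x"
      proof -
        have "j * (j * w) = - w" for w by (metis complex(1) mult.assoc mult_minus1)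
        then show ?thesis by (simp add: f_def right_diff_distrib)
      qed
      finally show ?thesis .
    qed
    have fs: "f (scl c x) = c * f x" for c x
    proof -
      obtain u v where c: "c = of_real u + j * of_real v" using complex(3)[of c] by blast
      have "scl c x = scl (of_real u) x + scl j (scl (of_real v) x)"
        by (simp add: c scale_left_distrib)
      then show ?thesis by (simp only: fadd fr fj c algebra_simps)
    qed
    have fb: "norm (f x) \<le> 2 * p x" for x
    proof -
      have "norm (f x) \<le> norm (of_real (g x) :: 'k) + norm (j * of_real (g (scl j x)))"
        unfolding f_def by (rule norm_triangle_ineq4)
      also have "\<dots> = \<bar>g x\<bar> + \<bar>g (scl j x)\<bar>" by (simp add: norm_mult complex(2))
      also have "\<dots> \<le> p x + p (scl j x)" using g(3) by (intro add_mono)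
      finally show ?thesis by (simp add: hom complex(2))
    qed
    have "f a \<noteq> 0"
    proof
      assume "f a = 0"
      then have 1: "of_real (g a) = j * of_real (g (scl j a))" by (simp add: f_def)
      then have "(of_real (g a) :: 'k) * of_real (g a) = (j * j) * of_real (g (scl j a) * g (scl j a))"
        by (simp add: algebra_simps)
      then have "(of_real (g a * g a) :: 'k) = of_real (- (g (scl j a) * g (scl j a)))"
        by (simp add: complex(1))
      then have "g a * g a = - (g (scl j a) * g (scl j a))" by (simp only: of_real_eq_iff)
      moreover have "g (scl j a) * g (scl j a) \<ge> 0" by simp
      moreover have "g a * g a > 0" using pa g(4) by (metis not_square_less_zero linorder_neqE_linordered_idom mult_eq_0_iff)
      ultimately show False by linarith
    qed
    with fadd fs fb show ?thesis by blast
  qed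
  then obtain f :: "'v \<Rightarrow> 'k" where f: "\<And>x y. f (x + y) = f x + f y" "\<And>c x. f (scl c x) = c * f x"
      "\<And>x. norm (f x) \<le> 2 * p x" "f a \<noteq> 0" by blast
  show ?thesis
  proof (intro exI conjI)
    show "Vector_Spaces.linear scl (*) (\<lambda>x. f x / f a)"
      by standard (simp_all add: f add_divide_distrib)
    show "\<forall>x. norm (f x / f a) \<le> (2 / norm (f a)) * p x"
      using f(3,4) by (simp add: norm_divide divide_right_mono)
    show "f a / f a = 1" using f(4) by simp
  qed
qed

lemma vector_space_mult: "vector_space ((*) :: 'k::field \<Rightarrow> 'k \<Rightarrow> 'k)"
  by standard (simp_all add: algebra_simps)

lemma vector_space_pointwise:
  assumes "vector_space s"
  shows "vector_space (\<lambda>c f i. s c (f i))"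
proof -
  interpret vector_space s by fact
  show ?thesis by standard (simp_all add: fun_eq_iff scale_left_distrib scale_right_distrib)
qed

lemma sum_fun_apply: "(\<Sum>i\<in>A. f i) x = (\<Sum>i\<in>A. f i x)"
  by (induction A rule: infinite_finite_induct) auto

lemma normed_space_on_facts:
  assumes "normed_space_on scl V p"
  shows norm_minus_on: "v \<in> V \<Longrightarrow> p (- v) = p v"
    and norm_nonneg_on: "v \<in> V \<Longrightarrow> 0 \<le> p v"
    and norm_diff_commute: "u \<in> V \<Longrightarrow> v \<in> V \<Longrightarrow> p (u - v) = p (v - u)"
    and norm_diff_triangle: "u \<in> V \<Longrightarrow> v \<in> V \<Longrightarrow> w \<in> V \<Longrightarrow> p (u - w) \<le> p (u - v) + p (v - w)"
    and Metric_space_norm_dist: "Metric_space V (norm_dist V p)"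
proof -
  interpret normed_space_on scl V p by fact
  note sub = subspace_neg[OF subspace_V] subspace_diff[OF subspace_V] subspace_0[OF subspace_V]
  have m: "p (- v) = p v" if "v \<in> V" for v
    using norm_scale[OF that, of "-1"] by simp
  have n: "0 \<le> p v" if "v \<in> V" for v
    using norm_triangle[of v "- v"] m[OF that] norm_eq_0_iff[of 0] sub that by simp
  have c: "p (u - v) = p (v - u)" if "u \<in> V" "v \<in> V" for u v
    using m[of "u - v"] sub that by simp
  have t: "p (u - w) \<le> p (u - v) + p (v - w)" if "u \<in> V" "v \<in> V" "w \<in> V" for u v w
    using norm_triangle[of "u - v" "v - w"] sub that by simp
  show "v \<in> V \<Longrightarrow> p (- v) = p v" "v \<in> V \<Longrightarrow> 0 \<le> p v"
    "u \<in> V \<Longrightarrow> v \<in> V \<Longrightarrow> p (u - v) = p (v - u)"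
    "u \<in> V \<Longrightarrow> v \<in> V \<Longrightarrow> w \<in> V \<Longrightarrow> p (u - w) \<le> p (u - v) + p (v - w)"
    by (fact m n c t)+
  show "Metric_space V (norm_dist V p)"
    by standard (use n c t sub in \<open>auto simp: norm_dist_def norm_eq_0_iff\<close>)
qed

lemma biorthogonal_functionals:
  fixes scl :: "'k::real_or_complex \<Rightarrow> 'v::ab_group_add \<Rightarrow> 'v"
  assumes N: "normed_space_on scl UNIV N"
    and "finite E" and "\<not> module.dependent scl E"
  shows "\<exists>f. \<forall>e\<in>E. Vector_Spaces.linear scl (*) (f e) \<and> (\<exists>C. \<forall>x. norm (f e x) \<le> C * N x) \<and>
    (\<forall>e'\<in>E. f e e' = (if e' = e then 1 else 0))"
proof -
  interpret normed_space_on scl UNIV N by (rule N)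
  note nn = norm_nonneg_on[OF N, simplified]
  from assms(2,3) show ?thesis
  proof (induction E rule: finite_induct)
    case empty then show ?case by simp
  next
    case (insert a E)
    have indE: "independent E" and aE: "a \<notin> span E"
      using insert.prems insert.hyps independent_insert by auto
    obtain f where lin: "\<And>e. e \<in> E \<Longrightarrow> Vector_Spaces.linear scl (*) (f e)"
      and bd: "\<And>e. e \<in> E \<Longrightarrow> \<exists>C. \<forall>x. norm (f e x) \<le> C * N x"
      and orth: "\<And>e e'. e \<in> E \<Longrightarrow> e' \<in> E \<Longrightarrow> f e e' = (if e' = e then 1 else 0)"
      using insert.IH[OF indE] by blast
    have fadd: "f e (x + y) = f e x + f e y" and fscl: "f e (scl c x) = c * f e x" if "e \<in> E" for e c x y
    proof -
      interpret fe: Vector_Spaces.linear scl "(*)" "f e" by (rule lin[OF that])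
      show "f e (x + y) = f e x + f e y" "f e (scl c x) = c * f e x"
        by (simp_all add: fe.add fe.scale)
    qed
    define P where "P x = (\<Sum>e\<in>E. scl (f e x) e)" for x
    have Padd: "P (x + y) = P x + P y" for x y
      by (simp add: P_def fadd scale_left_distrib sum.distrib)
    have Pscl: "P (scl c x) = scl c (P x)" for c x
      by (simp add: P_def fscl scale_sum_right)
    have PE: "P e = e" if "e \<in> E" for e
    proof -
      have "P e = (\<Sum>e'\<in>E. if e = e' then e' else 0)"
        unfolding P_def by (intro sum.cong refl) (simp add: orth that)
      then show ?thesis using insert.hyps that by simp
    qed
    have Pspan: "P x \<in> span E" for x
      unfolding P_def by (intro span_sum span_scale span_base)
    define p where "p x = N (x - P x)" for x
    have padd: "p (x + y) \<le> p x + p y" for x y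
      using norm_triangle[of "x - P x" "y - P y"] by (simp add: p_def Padd algebra_simps)
    have phom: "p (scl c x) = norm c * p x" for c x
      using norm_scale[of "x - P x" c] by (simp add: p_def Pscl scale_right_diff_distrib)
    have pa: "p a \<noteq> 0"
    proof
      assume "p a = 0"
      then have "a = P a" by (simp add: p_def norm_eq_0_iff)
      then show False using Pspan[of a] aE by simp
    qed
    have pbd: "\<exists>C\<ge>0. \<forall>x. p x \<le> C * N x"
    proof -
      obtain C where C: "\<And>e x. e \<in> E \<Longrightarrow> norm (f e x) \<le> C e * N x" using bd by metis
      have 1: "N (\<Sum>e\<in>F. scl (f e x) e) \<le> (\<Sum>e\<in>F. \<bar>C e\<bar> * N e) * N x" if "F \<subseteq> E" for F x
        using finite_subset[OF that insert.hyps(1)] that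
      proof (induction F rule: finite_induct)
        case empty then show ?case using norm_eq_0_iff[of 0] by simp
      next
        case (insert b F)
        have "norm (f b x) \<le> \<bar>C b\<bar> * N x"
          using C[of b x] insert.prems nn[of x] mult_right_mono[of "C b" "\<bar>C b\<bar>" "N x"] by fastforce
        then have "N (scl (f b x) b) \<le> \<bar>C b\<bar> * N x * N b"
          using nn[of b] by (simp add: norm_scale mult_right_mono)
        moreover have "N (\<Sum>e\<in>insert b F. scl (f e x) e) \<le> N (scl (f b x) b) + N (\<Sum>e\<in>F. scl (f e x) e)"
          using insert.hyps by (simp add: norm_triangle)
        ultimately show ?case using insert by (simp add: algebra_simps)
      qed
      let ?C = "\<Sum>e\<in>E. \<bar>C e\<bar> * N e"
      have "p x \<le> (1 + ?C) * N x" for x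
      proof -
        have "p x \<le> N x + N (P x)"
          using norm_triangle[of x "- P x"] norm_minus_on[OF N, of "P x"] by (simp add: p_def)
        also have "N (P x) \<le> ?C * N x" unfolding P_def by (rule 1) simp
        finally show ?thesis by (simp add: algebra_simps)
      qed
      moreover have "1 + ?C \<ge> 0" by (intro add_nonneg_nonneg sum_nonneg mult_nonneg_nonneg nn) simp_all
      ultimately show ?thesis by blast
    qed
    obtain g where g: "Vector_Spaces.linear scl (*) g" "\<exists>C. \<forall>x. norm (g x) \<le> C * p x" "g a = 1"
      using seminorm_functional[of scl p a] vector_space_axioms padd phom pa by blast
    interpret g: Vector_Spaces.linear scl "(*)" g by (rule g(1))
    have gE: "g e = 0" if "e \<in> E" for e
    proof -
      have "p e = 0" using PE[OF that] norm_eq_0_iff[of 0] by (simp add: p_def)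
      with g(2) have "norm (g e) \<le> 0" by (metis mult_zero_right)
      then show ?thesis by simp
    qed
    have gbd: "\<exists>C\<ge>0. \<forall>x. norm (g x) \<le> C * N x"
    proof -
      obtain C D where C: "\<And>x. norm (g x) \<le> C * p x" and D: "D \<ge> 0" "\<And>x. p x \<le> D * N x"
        using g(2) pbd by blast
      have "norm (g x) \<le> (\<bar>C\<bar> * D) * N x" for x
      proof -
        have "norm (g x) \<le> \<bar>C\<bar> * p x"
          using C[of x] nn[of "x - P x"] mult_right_mono[of C "\<bar>C\<bar>" "p x"] by (fastforce simp: p_def)
        also have "\<dots> \<le> \<bar>C\<bar> * (D * N x)" using D by (intro mult_left_mono) auto
        finally show ?thesis by (simp add: mult.assoc)
      qed
      then show ?thesis using D(1) by (intro exI[of _ "\<bar>C\<bar> * D"]) simp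
    qed
    define f' where "f' e x = (if e = a then g x else f e x - f e a * g x)" for e x
    have "Vector_Spaces.linear scl (*) (f' e)" if "e \<in> insert a E" for e
    proof (cases "e = a")
      case True then show ?thesis using g(1) by (simp add: f'_def[abs_def])
    next
      case False
      then have e: "e \<in> E" using that by simp
      show ?thesis
        using False by unfold_locales (simp_all add: f'_def fadd[OF e] fscl[OF e] g.add g.scale algebra_simps)
    qed
    moreover have "\<exists>C. \<forall>x. norm (f' e x) \<le> C * N x" if "e \<in> insert a E" for e
    proof (cases "e = a")
      case True then show ?thesis using gbd by (auto simp: f'_def)
    next
      case False
      then have "e \<in> E" using that by simp
      then obtain C where C: "\<And>x. norm (f e x) \<le> C * N x" using bd by blast
      obtain D where D: "\<And>x. norm (g x) \<le> D * N x" using gbd by blast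
      have "norm (f' e x) \<le> (C + norm (f e a) * D) * N x" for x
      proof -
        have "norm (f' e x) \<le> norm (f e x) + norm (f e a * g x)"
          using False norm_triangle_ineq4[of "f e x" "f e a * g x"] by (simp add: f'_def)
        also have "\<dots> \<le> C * N x + norm (f e a) * (D * N x)"
          using C D by (auto simp: norm_mult intro!: add_mono mult_left_mono)
        finally show ?thesis by (simp add: algebra_simps)
      qed
      then show ?thesis by blast
    qed
    moreover have "f' e e' = (if e' = e then 1 else 0)" if "e \<in> insert a E" "e' \<in> insert a E" for e e'
      using that insert.hyps g(3) gE orth by (auto simp: f'_def)
    ultimately show ?case by (intro exI[of _ f']) blast
  qed
qed

lemma biorthogonal_expansion:
  assumes vs: "vector_space scl" and "finite E"
    and lin: "\<And>e. e \<in> E \<Longrightarrow> Vector_Spaces.linear scl (*) (f e)"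
    and orth: "\<And>e e'. e \<in> E \<Longrightarrow> e' \<in> E \<Longrightarrow> f e e' = (if e' = e then 1 else 0)"
    and x: "x \<in> module.span scl E"
  shows "x = (\<Sum>e\<in>E. scl (f e x) e)"
proof -
  interpret vector_space scl by (rule vs)
  have fadd: "f e (x + y) = f e x + f e y" and fscl: "f e (scl c x) = c * f e x"
    and f0: "f e 0 = 0" if "e \<in> E" for e c x y
  proof -
    interpret fe: Vector_Spaces.linear scl "(*)" "f e" by (rule lin[OF that])
    show "f e (x + y) = f e x + f e y" "f e (scl c x) = c * f e x" "f e 0 = 0"
      by (simp_all add: fe.add fe.scale fe.zero)
  qed
  show ?thesis
    using x
  proof (induction rule: span_induct_alt)
    case base then show ?case by (simp add: f0)
  next
    case (step c e y)
    have "(\<Sum>e'\<in>E. scl (f e' e) e') = (\<Sum>e'\<in>E. if e = e' then e' else 0)"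
      by (intro sum.cong refl) (simp add: orth step.hyps)
    then have "(\<Sum>e'\<in>E. scl (f e' e) e') = e" using step.hyps assms(2) by simp
    moreover have "(\<Sum>e'\<in>E. scl (f e' (scl c e + y)) e')
        = scl c (\<Sum>e'\<in>E. scl (f e' e) e') + (\<Sum>e'\<in>E. scl (f e' y) e')"
      by (simp add: fadd fscl scale_left_distrib sum.distrib scale_sum_right)
    ultimately show ?case using step.IH by simp
  qed
qed

context
  fixes sX :: "'k::real_or_complex \<Rightarrow> 'a::ab_group_add \<Rightarrow> 'a" and N
    and sY :: "'k \<Rightarrow> 'b::ab_group_add \<Rightarrow> 'b" and M
  assumes X: "normed_space_on sX UNIV N" and Y: "normed_space_on sY UNIV M"
begin

interpretation X: normed_space_on sX UNIV N by (rule X)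
interpretation Y: normed_space_on sY UNIV M by (rule Y)
interpretation F: vector_space "fun_scale :: 'k \<Rightarrow> (('a \<Rightarrow> 'b \<Rightarrow> 'k) \<Rightarrow> 'k) \<Rightarrow> _"
  using vector_space_pointwise[OF vector_space_mult] by (simp add: fun_scale_def[abs_def])

lemma bilinear_formD:
  assumes "bilinear_form sX sY B"
  shows "B (sX c x) y = c * B x y" "B x (sY c y) = c * B x y"
    "B (\<Sum>i\<in>I. f i) y = (\<Sum>i\<in>I. B (f i) y)" "B x (\<Sum>i\<in>J. g i) = (\<Sum>i\<in>J. B x (g i))"
proof -
  interpret l: Vector_Spaces.linear sX "(*)" "\<lambda>x. B x y" using assms by (simp add: bilinear_form_def)
  interpret r: Vector_Spaces.linear sY "(*)" "B x" using assms by (simp add: bilinear_form_def)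
  show "B (sX c x) y = c * B x y" "B x (sY c y) = c * B x y"
    "B (\<Sum>i\<in>I. f i) y = (\<Sum>i\<in>I. B (f i) y)" "B x (\<Sum>i\<in>J. g i) = (\<Sum>i\<in>J. B x (g i))"
    by (simp_all add: l.scale r.scale l.sum r.sum)
qed

lemma fun_scale_tensor: "fun_scale c (tensor sX sY x y) = tensor sX sY (sX c x) y"
  by (auto simp: fun_scale_def tensor_def fun_eq_iff bilinear_formD)

lemma sum_lessThan_append: "(\<Sum>i<n + m. f i) = (\<Sum>i<n. f i) + (\<Sum>i<m. f (n + i))"
  for f :: "nat \<Rightarrow> 'c::comm_monoid_add"
  by (induction m) (simp_all add: add.assoc)

definition tensor_sum :: "nat \<Rightarrow> (nat \<Rightarrow> 'a) \<Rightarrow> (nat \<Rightarrow> 'b) \<Rightarrow> ('a \<Rightarrow> 'b \<Rightarrow> 'k) \<Rightarrow> 'k" where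
  "tensor_sum n x y = (\<Sum>i<n. tensor sX sY (x i) (y i))"

lemma tensor_sum_add: "\<exists>x'' y''. tensor_sum (n + m) x'' y'' = tensor_sum n x y + tensor_sum m x' y' \<and>
    (\<Sum>i<n + m. N (x'' i) * M (y'' i)) = (\<Sum>i<n. N (x i) * M (y i)) + (\<Sum>i<m. N (x' i) * M (y' i))"
proof -
  define x'' where "x'' i = (if i < n then x i else x' (i - n))" for i
  define y'' where "y'' i = (if i < n then y i else y' (i - n))" for i
  show ?thesis
    by (intro exI[of _ x''] exI[of _ y'']) (simp add: tensor_sum_def sum_lessThan_append x''_def y''_def)
qed

lemma tensor_sum_scale: "fun_scale c (tensor_sum n x y) = tensor_sum n (\<lambda>i. sX c (x i)) y"
  by (simp add: tensor_sum_def F.scale_sum_right fun_scale_tensor)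

lemma tensor_product_iff: "u \<in> tensor_product sX sY \<longleftrightarrow> (\<exists>n x y. u = tensor_sum n x y)"
proof
  assume "u \<in> tensor_product sX sY"
  then show "\<exists>n x y. u = tensor_sum n x y"
    unfolding tensor_product_def
  proof (induction rule: F.span_induct_alt)
    case base
    show ?case by (intro exI[of _ 0]) (simp add: tensor_sum_def)
  next
    case (step c t v)
    then obtain x y n x' y' where "t = tensor sX sY x y" "v = tensor_sum n x' y'" by blast
    then have "fun_scale c t + v = tensor_sum 1 (\<lambda>_. sX c x) (\<lambda>_. y) + tensor_sum n x' y'"
      by (simp add: tensor_sum_def fun_scale_tensor)
    then show ?case using tensor_sum_add by metis
  qed
next
  assume "\<exists>n x y. u = tensor_sum n x y"
  then show "u \<in> tensor_product sX sY"
    unfolding tensor_product_def tensor_sum_def by (auto intro!: F.span_sum intro: F.span_base)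
qed

lemma proj_norm_alt:
  "proj_norm sX N sY M u = Inf {(\<Sum>i<n. N (x i) * M (y i)) | n x y. u = tensor_sum n x y}"
  by (simp add: proj_norm_def tensor_sum_def)

lemma rep_nonneg: "0 \<le> (\<Sum>i<n. N (x i) * M (y i))"
  using norm_nonneg_on[OF X] norm_nonneg_on[OF Y] by (intro sum_nonneg mult_nonneg_nonneg) auto

lemma proj_norm_le: "u = tensor_sum n x y \<Longrightarrow> proj_norm sX N sY M u \<le> (\<Sum>i<n. N (x i) * M (y i))"
  unfolding proj_norm_alt by (rule cInf_lower) (auto intro!: bdd_belowI[of _ 0] rep_nonneg)

lemma proj_norm_ge:
  assumes "u \<in> tensor_product sX sY"
    and "\<And>n x y. u = tensor_sum n x y \<Longrightarrow> c \<le> (\<Sum>i<n. N (x i) * M (y i))"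
  shows "c \<le> proj_norm sX N sY M u"
  unfolding proj_norm_alt using assms by (intro cInf_greatest) (auto simp: tensor_product_iff)

lemma proj_norm_scale_le:
  assumes u: "u \<in> tensor_product sX sY" and c: "c \<noteq> 0"
  shows "proj_norm sX N sY M (fun_scale c u) \<le> norm c * proj_norm sX N sY M u"
proof -
  have "proj_norm sX N sY M (fun_scale c u) / norm c \<le> proj_norm sX N sY M u"
  proof (rule proj_norm_ge[OF u])
    fix n x y assume "u = tensor_sum n x y"
    then have "proj_norm sX N sY M (fun_scale c u) \<le> (\<Sum>i<n. N (sX c (x i)) * M (y i))"
      by (intro proj_norm_le) (simp add: tensor_sum_scale)
    also have "\<dots> = norm c * (\<Sum>i<n. N (x i) * M (y i))"
      by (simp add: X.norm_scale sum_distrib_left mult.assoc)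
    finally show "proj_norm sX N sY M (fun_scale c u) / norm c \<le> (\<Sum>i<n. N (x i) * M (y i))"
      using c by (simp add: field_simps)
  qed
  then show ?thesis using c by (simp add: field_simps)
qed

lemma proj_norm_bilinear:
  assumes u: "u \<in> tensor_product sX sY"
    and f: "Vector_Spaces.linear sX (*) f" "\<And>x. norm (f x) \<le> C * N x"
    and g: "Vector_Spaces.linear sY (*) g" "\<And>y. norm (g y) \<le> D * M y"
    and pu: "proj_norm sX N sY M u = 0"
  shows "u (\<lambda>x y. f x * g y) = 0"
proof -
  interpret f: Vector_Spaces.linear sX "(*)" f by (rule f(1))
  interpret g: Vector_Spaces.linear sY "(*)" g by (rule g(1))
  define C' D' where "C' = \<bar>C\<bar> + 1" and "D' = \<bar>D\<bar> + 1"
  have C': "C' > 0" "D' > 0" by (simp_all add: C'_def D'_def add_nonneg_pos)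
  have fb: "norm (f x) \<le> C' * N x" for x
    using f(2)[of x] norm_nonneg_on[OF X, of x] mult_right_mono[of C C' "N x"] by (fastforce simp: C'_def)
  have gb: "norm (g y) \<le> D' * M y" for y
    using g(2)[of y] norm_nonneg_on[OF Y, of y] mult_right_mono[of D D' "M y"] by (fastforce simp: D'_def)
  have bil: "bilinear_form sX sY (\<lambda>x y. f x * g y)"
    unfolding bilinear_form_def
    by (intro conjI allI; unfold_locales) (simp_all add: f.add f.scale g.add g.scale algebra_simps)
  have "norm (u (\<lambda>x y. f x * g y)) / (C' * D') \<le> proj_norm sX N sY M u"
  proof (rule proj_norm_ge[OF u])
    fix n x y assume "u = tensor_sum n x y"
    then have "norm (u (\<lambda>x y. f x * g y)) = norm (\<Sum>i<n. f (x i) * g (y i))"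
      by (simp add: tensor_sum_def sum_fun_apply tensor_def bil)
    also have "\<dots> \<le> (\<Sum>i<n. (C' * N (x i)) * (D' * M (y i)))"
    proof (rule order_trans[OF norm_sum sum_mono])
      fix i
      show "norm (f (x i) * g (y i)) \<le> (C' * N (x i)) * (D' * M (y i))"
        unfolding norm_mult using fb gb C' norm_nonneg_on[OF X] by (intro mult_mono) auto
    qed
    also have "\<dots> = (C' * D') * (\<Sum>i<n. N (x i) * M (y i))"
      by (simp add: sum_distrib_left algebra_simps)
    finally show "norm (u (\<lambda>x y. f x * g y)) / (C' * D') \<le> (\<Sum>i<n. N (x i) * M (y i))"
      using C' by (simp add: field_simps)
  qed
  then have "norm (u (\<lambda>x y. f x * g y)) \<le> 0"
    using pu mult_pos_pos[OF C'] by (simp add: divide_le_0_iff)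
  then show ?thesis by simp
qed

lemma proj_norm_definite:
  assumes u: "u \<in> tensor_product sX sY" and pu: "proj_norm sX N sY M u = 0"
  shows "u = 0"
proof -
  obtain n x y where rep: "u = tensor_sum n x y" using u tensor_product_iff by blast
  obtain E where E: "E \<subseteq> x ` {..<n}" "X.independent E" "x ` {..<n} \<subseteq> X.span E"
    using X.maximal_independent_subset by metis
  obtain G where G: "G \<subseteq> y ` {..<n}" "Y.independent G" "y ` {..<n} \<subseteq> Y.span G"
    using Y.maximal_independent_subset by metis
  have fin: "finite E" "finite G" using E(1) G(1) finite_subset by blast+
  obtain f where f: "\<And>e. e \<in> E \<Longrightarrow> Vector_Spaces.linear sX (*) (f e)"
    "\<And>e. e \<in> E \<Longrightarrow> \<exists>C. \<forall>x. norm (f e x) \<le> C * N x"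
    "\<And>e e'. e \<in> E \<Longrightarrow> e' \<in> E \<Longrightarrow> f e e' = (if e' = e then 1 else 0)"
    using biorthogonal_functionals[OF X fin(1) E(2)] by blast
  obtain g where g: "\<And>e. e \<in> G \<Longrightarrow> Vector_Spaces.linear sY (*) (g e)"
    "\<And>e. e \<in> G \<Longrightarrow> \<exists>C. \<forall>x. norm (g e x) \<le> C * M x"
    "\<And>e e'. e \<in> G \<Longrightarrow> e' \<in> G \<Longrightarrow> g e e' = (if e' = e then 1 else 0)"
    using biorthogonal_functionals[OF Y fin(2) G(2)] by blast
  have bil: "bilinear_form sX sY (\<lambda>x y. f e x * g e' y)" if "e \<in> E" "e' \<in> G" for e e'
  proof -
    interpret f: Vector_Spaces.linear sX "(*)" "f e" by (rule f(1)[OF that(1)])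
    interpret g: Vector_Spaces.linear sY "(*)" "g e'" by (rule g(1)[OF that(2)])
    show ?thesis
      unfolding bilinear_form_def
      by (intro conjI allI; unfold_locales) (simp_all add: f.add f.scale g.add g.scale algebra_simps)
  qed
  have z: "(\<Sum>i<n. f e (x i) * g e' (y i)) = 0" if "e \<in> E" "e' \<in> G" for e e'
  proof -
    obtain C D where "\<And>x. norm (f e x) \<le> C * N x" "\<And>y. norm (g e' y) \<le> D * M y"
      using f(2) g(2) \<open>e \<in> E\<close> \<open>e' \<in> G\<close> by metis
    then have "u (\<lambda>x y. f e x * g e' y) = 0"
      by (intro proj_norm_bilinear[OF u _ _ _ _ pu]) (use f(1) g(1) that in auto)
    then show ?thesis by (simp add: rep tensor_sum_def sum_fun_apply tensor_def bil[OF that])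
  qed
  have "u B = 0" for B
  proof (cases "bilinear_form sX sY B")
    case False
    then show ?thesis by (simp add: rep tensor_sum_def sum_fun_apply tensor_def)
  next
    case True
    have xe: "x i = (\<Sum>e\<in>E. sX (f e (x i)) e)" if "i < n" for i
      using that E(3) by (intro biorthogonal_expansion[OF X.vector_space_axioms fin(1) f(1,3)]) auto
    have ye: "y i = (\<Sum>e\<in>G. sY (g e (y i)) e)" if "i < n" for i
      using that G(3) by (intro biorthogonal_expansion[OF Y.vector_space_axioms fin(2) g(1,3)]) auto
    have "B (x i) (y i) = (\<Sum>e\<in>E. \<Sum>e'\<in>G. B e e' * (f e (x i) * g e' (y i)))" if "i < n" for i
    proof -
      have "B (x i) (y i) = B (\<Sum>e\<in>E. sX (f e (x i)) e) (\<Sum>e\<in>G. sY (g e (y i)) e)"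
        using xe[OF that] ye[OF that] by simp
      also have "\<dots> = (\<Sum>e\<in>E. \<Sum>e'\<in>G. B e e' * (f e (x i) * g e' (y i)))"
        by (simp only: bilinear_formD(3,4)[OF True])
          (simp add: bilinear_formD(1,2)[OF True] mult.assoc mult.left_commute mult.commute,
            rule sum.swap)
      finally show ?thesis .
    qed
    then have "u B = (\<Sum>i<n. \<Sum>e\<in>E. \<Sum>e'\<in>G. B e e' * (f e (x i) * g e' (y i)))"
      by (simp add: rep tensor_sum_def sum_fun_apply tensor_def True)
    also have "\<dots> = (\<Sum>e\<in>E. \<Sum>i<n. \<Sum>e'\<in>G. B e e' * (f e (x i) * g e' (y i)))"
      by (rule sum.swap)
    also have "\<dots> = (\<Sum>e\<in>E. \<Sum>e'\<in>G. \<Sum>i<n. B e e' * (f e (x i) * g e' (y i)))"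
      by (intro sum.cong refl sum.swap)
    also have "\<dots> = (\<Sum>e\<in>E. \<Sum>e'\<in>G. B e e' * (\<Sum>i<n. f e (x i) * g e' (y i)))"
      by (simp only: sum_distrib_left)
    also have "\<dots> = 0"
      by (intro sum.neutral ballI) (simp add: z)
    finally show ?thesis .
  qed
  then show ?thesis by (simp add: fun_eq_iff)
qed

lemma normed_space_on_tensor_product:
  "normed_space_on fun_scale (tensor_product sX sY) (proj_norm sX N sY M)"
proof -
  let ?T = "tensor_product sX sY" and ?p = "proj_norm sX N sY M"
  have sub: "F.subspace ?T" by (simp add: tensor_product_def)
  have nonneg: "0 \<le> ?p u" if "u \<in> ?T" for u using that by (intro proj_norm_ge rep_nonneg)
  have z0: "tensor_sum 0 x y = 0" for x y by (simp add: tensor_sum_def)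
  have zero: "?p 0 = 0"
    using nonneg[of 0] F.subspace_0[OF sub] proj_norm_le[of 0 0 "\<lambda>_. 0" "\<lambda>_. 0"] z0 by auto
  have scl: "?p (fun_scale c u) = norm c * ?p u" if u: "u \<in> ?T" for c u
  proof (cases "c = 0")
    case True then show ?thesis using zero by simp
  next
    case False
    have "?p (fun_scale (inverse c) (fun_scale c u)) \<le> norm (inverse c) * ?p (fun_scale c u)"
      using False u F.subspace_scale[OF sub] by (intro proj_norm_scale_le) auto
    then have "norm c * ?p u \<le> ?p (fun_scale c u)"
      using False by (simp add: norm_divide inverse_eq_divide field_simps)
    with proj_norm_scale_le[OF u False] show ?thesis by simp
  qed
  have tri: "?p (u + v) \<le> ?p u + ?p v" if u: "u \<in> ?T" and v: "v \<in> ?T" for u v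
  proof -
    have 1: "?p (u + v) \<le> (\<Sum>i<n. N (x i) * M (y i)) + (\<Sum>i<m. N (x' i) * M (y' i))"
      if "u = tensor_sum n x y" "v = tensor_sum m x' y'" for n x y m x' y'
      using tensor_sum_add[of n m x y x' y'] that proj_norm_le by metis
    have "?p (u + v) - (\<Sum>i<n. N (x i) * M (y i)) \<le> ?p v" if "u = tensor_sum n x y" for n x y
      using 1[OF that] by (intro proj_norm_ge[OF v]) (simp add: algebra_simps)
    then have "?p (u + v) - ?p v \<le> ?p u"
      by (intro proj_norm_ge[OF u]) (simp add: algebra_simps)
    then show ?thesis by simp
  qed
  show ?thesis
    by standard (use sub scl tri zero proj_norm_definite in auto)
qed

end

lemma (in vector_space) projection_along_subspace:
  assumes A: "subspace A" and C: "subspace C" and AC: "A \<subseteq> C"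
  obtains f where "Vector_Spaces.linear scale scale f" "\<And>c. c \<in> C \<Longrightarrow> f c \<in> C"
    "\<And>a. a \<in> A \<Longrightarrow> f a = 0" "\<And>c. c \<in> C \<Longrightarrow> c - f c \<in> A"
proof -
  interpret vp: vector_space_pair scale scale ..
  obtain B where B: "B \<subseteq> A" "independent B" "A \<subseteq> span B"
    using maximal_independent_subset by metis
  obtain B' where B': "B \<subseteq> B'" "B' \<subseteq> C" "independent B'" "C \<subseteq> span B'"
    using maximal_independent_subset_extend[of B C] B AC by (metis subset_trans)
  obtain f where f: "Vector_Spaces.linear scale scale f" "\<And>b. b \<in> B' \<Longrightarrow> f b = (if b \<in> B then 0 else b)"
    using vp.linear_independent_extend[OF B'(3), of "\<lambda>b. if b \<in> B then 0 else b"] by blast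
  interpret f: Vector_Spaces.linear scale scale f by (rule f(1))
  have spanC: "span B' = C" using B' C by (simp add: span_subspace)
  have spanA: "span B = A" using B A by (simp add: span_subspace)
  show thesis
  proof (rule that[OF f(1)])
    fix c assume "c \<in> C"
    then have c: "c \<in> span B'" using spanC by simp
    then show "f c \<in> C"
    proof (induction rule: span_induct_alt)
      case base then show ?case using C by (simp add: f.zero subspace_0)
    next
      case (step s b y)
      then show ?case using f(2) B' C
        by (auto simp: f.add f.scale subspace_0 intro!: subspace_add subspace_scale)
    qed
    from c show "c - f c \<in> A"
    proof (induction rule: span_induct_alt)
      case base then show ?case using A by (simp add: f.zero subspace_0)
    next
      case (step s b y)
      have "b - f b \<in> A" using f(2) step.hyps B A by (auto simp: subspace_0)
      then have "scale s (b - f b) + (y - f y) \<in> A"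
        using step.IH A by (intro subspace_add subspace_scale)
      also have "scale s (b - f b) + (y - f y) = scale s b + y - f (scale s b + y)"
        by (simp add: f.add f.scale scale_right_diff_distrib algebra_simps)
      finally show ?case .
    qed
  next
    fix a assume "a \<in> A"
    then have "a \<in> span B" using spanA by simp
    then show "f a = 0"
      by (induction rule: span_induct_alt) (use f(2) B' in \<open>auto simp: f.zero f.add f.scale\<close>)
  qed
qed

lemma limitin_norm_topology:
  assumes "normed_space_on scl V p" "\<And>n. \<sigma> n \<in> V"
  shows "limitin (norm_topology V p) \<sigma> l sequentially \<longleftrightarrow>
    l \<in> V \<and> (\<forall>e>0. \<exists>K. \<forall>n\<ge>K. p (\<sigma> n - l) < e)"
proof -
  interpret Metric_space V "norm_dist V p" by (rule Metric_space_norm_dist[OF assms(1)])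
  show ?thesis
    using assms(2) by (auto simp: norm_topology_def limitin_metric eventually_sequentially norm_dist_def)
qed

lemma completion_exists:
  fixes sV :: "'k::real_normed_field \<Rightarrow> 'v::ab_group_add \<Rightarrow> 'v"
  assumes V: "normed_space_on sV V p"
  shows "\<exists>(W :: (nat \<Rightarrow> 'v) set) q \<iota>. completion_map sV V p (\<lambda>c s n. sV c (s n)) W q \<iota>"
proof -
  interpret normed_space_on sV V p by (rule V)
  let ?sS = "\<lambda>c (s :: nat \<Rightarrow> 'v) n. sV c (s n)"
  interpret S: vector_space ?sS by (rule vector_space_pointwise) unfold_locales
  note sub = subspace_diff[OF subspace_V] subspace_add[OF subspace_V] subspace_scale[OF subspace_V]
    subspace_0[OF subspace_V]
  note nonneg = norm_nonneg_on[OF V] and tri = norm_diff_triangle[OF V] and comm = norm_diff_commute[OF V]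
  have p0: "p 0 = 0" using norm_eq_0_iff[of 0] sub by simp
  define C where "C = {s :: nat \<Rightarrow> 'v. (\<forall>n. s n \<in> V) \<and> (\<forall>e>0. \<exists>K. \<forall>m\<ge>K. \<forall>n\<ge>K. p (s m - s n) < e)}"
  have CV: "s n \<in> V" if "s \<in> C" for s n using that by (simp add: C_def)
  have rev: "\<bar>p u - p v\<bar> \<le> p (u - v)" if "u \<in> V" "v \<in> V" for u v
    using norm_triangle[of "u - v" v] norm_triangle[of "v - u" u] that sub comm[of u v] by simp
  have conv: "(\<lambda>n. p (s n)) \<longlonglongrightarrow> lim (\<lambda>n. p (s n))" if s: "s \<in> C" for s
  proof -
    have "Cauchy (\<lambda>n. p (s n))"
    proof (rule metric_CauchyI)
      fix e :: real assume "e > 0"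
      then obtain K where K: "\<forall>m\<ge>K. \<forall>n\<ge>K. p (s m - s n) < e" using s by (auto simp: C_def)
      have "dist (p (s m)) (p (s n)) < e" if "m \<ge> K" "n \<ge> K" for m n
      proof -
        have "dist (p (s m)) (p (s n)) \<le> p (s m - s n)"
          using rev CV[OF s] by (simp add: dist_real_def)
        also have "\<dots> < e" using K that by blast
        finally show ?thesis .
      qed
      then show "\<exists>K. \<forall>m\<ge>K. \<forall>n\<ge>K. dist (p (s m)) (p (s n)) < e" by blast
    qed
    then show ?thesis by (simp add: Cauchy_convergent_iff convergent_LIMSEQ_iff)
  qed
  define q where "q s = lim (\<lambda>n. p (s n))" for s
  have qconv: "(\<lambda>n. p (s n)) \<longlonglongrightarrow> q s" if "s \<in> C" for s using conv[OF that] by (simp add: q_def)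
  have subC: "S.subspace C"
    unfolding S.subspace_def
  proof (intro conjI ballI allI)
    show "0 \<in> C" using sub p0 by (auto simp: C_def)
  next
    fix s t assume s: "s \<in> C" and t: "t \<in> C"
    have "\<exists>K::nat. \<forall>m\<ge>K. \<forall>n\<ge>K. p ((s + t) m - (s + t) n) < e" if "e > 0" for e
    proof -
      have "e / 2 > 0" using that by simp
      then obtain K L where K: "\<forall>m\<ge>K. \<forall>n\<ge>K. p (s m - s n) < e / 2"
        and L: "\<forall>m\<ge>L. \<forall>n\<ge>L. p (t m - t n) < e / 2"
        using s t unfolding C_def by blast
      have "p ((s + t) m - (s + t) n) < e" if "m \<ge> max K L" "n \<ge> max K L" for m n
      proof -
        have "p ((s + t) m - (s + t) n) \<le> p (s m - s n) + p (t m - t n)"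
          using norm_triangle[of "s m - s n" "t m - t n"] CV s t sub by (simp add: algebra_simps)
        also have "\<dots> < e / 2 + e / 2" using K L that by (intro add_strict_mono) auto
        finally show ?thesis by simp
      qed
      then show ?thesis by blast
    qed
    then show "s + t \<in> C" using CV s t sub by (simp add: C_def)
  next
    fix c s assume s: "s \<in> C"
    have "\<exists>K. \<forall>m\<ge>K. \<forall>n\<ge>K. p (sV c (s m) - sV c (s n)) < e" if "e > 0" for e
    proof (cases "c = 0")
      case True then show ?thesis using that p0 by simp
    next
      case False
      then have "e / norm c > 0" using that by simp
      then obtain K where K: "\<forall>m\<ge>K. \<forall>n\<ge>K. p (s m - s n) < e / norm c" using s unfolding C_def by blast
      have "p (sV c (s m) - sV c (s n)) = norm c * p (s m - s n)" for m n
        using norm_scale[of "s m - s n" c] CV[OF s] sub by (simp add: scale_right_diff_distrib)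
      then show ?thesis using K False by (intro exI[of _ K]) (simp add: field_simps)
    qed
    then show "(\<lambda>n. sV c (s n)) \<in> C" using CV s sub by (simp add: C_def)
  qed
  note Csub = S.subspace_diff[OF subC] S.subspace_add[OF subC] S.subspace_scale[OF subC] S.subspace_0[OF subC]
  have qadd: "q (s + t) \<le> q s + q t" if s: "s \<in> C" and t: "t \<in> C" for s t
  proof (rule LIMSEQ_le)
    show "(\<lambda>n. p ((s + t) n)) \<longlonglongrightarrow> q (s + t)" by (intro qconv Csub s t)
    show "(\<lambda>n. p (s n) + p (t n)) \<longlonglongrightarrow> q s + q t" by (intro tendsto_add qconv s t)
    show "\<exists>N. \<forall>n\<ge>N. p ((s + t) n) \<le> p (s n) + p (t n)"
      using norm_triangle CV[OF s] CV[OF t] by simp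
  qed
  have qscl: "q (\<lambda>n. sV c (s n)) = norm c * q s" if s: "s \<in> C" for c s
  proof (rule LIMSEQ_unique)
    show "(\<lambda>n. p (sV c (s n))) \<longlonglongrightarrow> q (\<lambda>n. sV c (s n))" by (intro qconv Csub s)
    show "(\<lambda>n. p (sV c (s n))) \<longlonglongrightarrow> norm c * q s"
      using tendsto_mult_left[OF qconv[OF s], of "norm c"] CV[OF s] by (simp add: norm_scale)
  qed
  have qneg: "q (- s) = q s" if "s \<in> C" for s
    using qscl[OF that, of "-1"] by (simp add: fun_Compl_def)
  have qnonneg: "0 \<le> q s" if "s \<in> C" for s
    by (rule LIMSEQ_le_const[OF qconv[OF that]]) (use nonneg CV[OF that] in auto)
  define Z where "Z = {s \<in> C. q s = 0}"
  have q0: "q 0 = 0" by (simp add: q_def p0)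
  have subZ: "S.subspace Z"
    unfolding S.subspace_def
  proof (intro conjI ballI allI)
    show "0 \<in> Z" using q0 Csub by (simp add: Z_def)
  next
    fix s t assume "s \<in> Z" "t \<in> Z"
    then show "s + t \<in> Z" using qadd[of s t] qnonneg[of "s + t"] Csub by (auto simp: Z_def)
  next
    fix c s assume "s \<in> Z"
    then show "(\<lambda>n. sV c (s n)) \<in> Z" using qscl[of s c] Csub by (auto simp: Z_def)
  qed
  obtain f where f: "Vector_Spaces.linear ?sS ?sS f" "\<And>c. c \<in> C \<Longrightarrow> f c \<in> C"
    "\<And>a. a \<in> Z \<Longrightarrow> f a = 0" "\<And>c. c \<in> C \<Longrightarrow> c - f c \<in> Z"
    using S.projection_along_subspace[OF subZ subC] by (auto simp: Z_def)
  interpret f: Vector_Spaces.linear ?sS ?sS f by (rule f(1))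
  define W where "W = f ` C"
  have WC: "w \<in> C" if "w \<in> W" for w using that f(2) by (auto simp: W_def)
  have qZ: "q s = q t" if "s \<in> C" "t \<in> C" "s - t \<in> Z" for s t
  proof -
    have "q s \<le> q t" using qadd[of "s - t" t] that Csub by (simp add: Z_def)
    moreover have "q t \<le> q s"
      using qadd[of "- (s - t)" s] qneg[of "s - t"] that Csub S.subspace_neg[OF subC, of "s - t"] by (simp add: Z_def)
    ultimately show ?thesis by simp
  qed
  have ff: "f (f s) = f s" if "s \<in> C" for s
    using f(3)[OF f(4)[OF that]] f.diff[of s "f s"] by simp
  have fW: "f w = w" if "w \<in> W" for w using that ff by (auto simp: W_def)
  have subW: "S.subspace W" unfolding W_def by (rule f.subspace_image[OF subC])
  note Wsub = S.subspace_diff[OF subW] S.subspace_add[OF subW] S.subspace_scale[OF subW] S.subspace_0[OF subW]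
  have W: "normed_space_on ?sS W q"
  proof
    show "S.subspace W" by (rule subW)
    show "q w = 0 \<longleftrightarrow> w = 0" if "w \<in> W" for w
      using that WC[OF that] fW[OF that] f(3)[of w] q0 by (auto simp: Z_def)
    show "q (u + v) \<le> q u + q v" if "u \<in> W" "v \<in> W" for u v
      using that WC qadd by blast
    show "q (\<lambda>n. sV c (v n)) = norm c * q v" if "v \<in> W" for c v
      using that WC qscl by blast
  qed
  define k where "k v = (\<lambda>_ :: nat. v :: 'v)" for v
  have kC: "k v \<in> C" if "v \<in> V" for v using that p0 by (auto simp: k_def C_def)
  have qk: "q (k v) = p v" for v by (simp add: q_def k_def)
  define \<iota> where "\<iota> v = f (k v)" for v
  have \<iota>W: "\<iota> v \<in> W" if "v \<in> V" for v using kC[OF that] by (simp add: \<iota>_def W_def)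
  have qf: "q (w - f s) = q (w - s)" if "w \<in> W" "s \<in> C" for w s
  proof (rule qZ)
    show "w - f s \<in> C" "w - s \<in> C" using that WC f(2) Csub by auto
    have "w - f s - (w - s) = s - f s" by simp
    then show "w - f s - (w - s) \<in> Z" using f(4)[OF that(2)] by simp
  qed
  have approx: "\<exists>v\<in>V. q (s - k v) \<le> e" if s: "s \<in> C" and e: "e > 0" for s e
  proof -
    obtain K where K: "\<forall>m\<ge>K. \<forall>n\<ge>K. p (s m - s n) < e" using s e by (auto simp: C_def)
    have "(\<lambda>n. p ((s - k (s K)) n)) \<longlonglongrightarrow> q (s - k (s K))"
      using s kC CV by (intro qconv Csub) auto
    then have "q (s - k (s K)) \<le> e"
      by (rule LIMSEQ_le_const2) (use K in \<open>auto simp: k_def intro!: exI[of _ K] less_imp_le\<close>)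
    then show ?thesis using CV[OF s] by blast
  qed
  have qtri: "q (r - t) \<le> q (r - s) + q (s - t)" if "r \<in> C" "s \<in> C" "t \<in> C" for r s t
    using qadd[of "r - s" "s - t"] that Csub by simp
  have qcomm: "q (r - s) = q (s - r)" if "r \<in> C" "s \<in> C" for r s
    using qneg[of "r - s"] that Csub by simp
  have k_diff: "k (u - v) = k u - k v" for u v by (simp add: k_def fun_eq_iff)
  interpret MW: Metric_space W "norm_dist W q" by (rule Metric_space_norm_dist[OF W])
  have complete: "Metric_space.mcomplete W (norm_dist W q)"
    unfolding MW.mcomplete_def
  proof (intro allI impI)
    fix \<sigma> assume \<sigma>: "MW.MCauchy \<sigma>"
    have \<sigma>W: "\<sigma> n \<in> W" for n using \<sigma> by (auto simp: MW.MCauchy_def)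
    have \<sigma>C: "\<sigma> n \<in> C" for n using \<sigma>W WC by blast
    have cau: "\<exists>K. \<forall>m\<ge>K. \<forall>n\<ge>K. q (\<sigma> m - \<sigma> n) < e" if "e > 0" for e
    proof -
      have "\<exists>K. \<forall>n n'. K \<le> n \<longrightarrow> K \<le> n' \<longrightarrow> norm_dist W q (\<sigma> n) (\<sigma> n') < e"
        using \<sigma> that unfolding MW.MCauchy_def by blast
      then show ?thesis by (auto simp: norm_dist_def \<sigma>W)
    qed
    have "\<forall>n. \<exists>v\<in>V. q (\<sigma> n - k v) \<le> inverse (real (Suc n))"
      using approx[OF \<sigma>C] by simp
    then obtain v where v: "\<And>n. v n \<in> V" "\<And>n. q (\<sigma> n - k (v n)) \<le> inverse (real (Suc n))"
      by metis
    have small: "\<exists>K. \<forall>n\<ge>K. q (\<sigma> n - k (v n)) < e" if "e > 0" for e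
    proof -
      obtain K where K: "inverse (real (Suc K)) < e" using reals_Archimedean \<open>e > 0\<close> by blast
      have "q (\<sigma> n - k (v n)) < e" if "n \<ge> K" for n
      proof -
        have "inverse (real (Suc n)) \<le> inverse (real (Suc K))" using that by (simp add: field_simps)
        then show ?thesis using v(2)[of n] K by linarith
      qed
      then show ?thesis by blast
    qed
    have vC: "v \<in> C"
      unfolding C_def
    proof (intro CollectI conjI allI impI v(1))
      fix e :: real assume "e > 0"
      then have e3: "e / 3 > 0" by simp
      obtain K L where K: "\<forall>m\<ge>K. \<forall>n\<ge>K. q (\<sigma> m - \<sigma> n) < e / 3"
        and L: "\<forall>n\<ge>L. q (\<sigma> n - k (v n)) < e / 3"
        using cau[OF e3] small[OF e3] by blast
      have "p (v m - v n) < e" if m: "m \<ge> max K L" and n: "n \<ge> max K L" for m n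
      proof -
        have "p (v m - v n) = q (k (v m) - k (v n))" by (simp add: qk flip: k_diff)
        also have "\<dots> \<le> q (k (v m) - \<sigma> m) + q (\<sigma> m - k (v n))"
          by (intro qtri kC v \<sigma>C)
        also have "\<dots> \<le> q (k (v m) - \<sigma> m) + (q (\<sigma> m - \<sigma> n) + q (\<sigma> n - k (v n)))"
          by (intro add_left_mono qtri kC v \<sigma>C)
        also have "q (k (v m) - \<sigma> m) = q (\<sigma> m - k (v m))" by (intro qcomm kC v \<sigma>C)
        also have "q (\<sigma> m - k (v m)) + (q (\<sigma> m - \<sigma> n) + q (\<sigma> n - k (v n))) < e / 3 + (e / 3 + e / 3)"
          using K L m n by (intro add_strict_mono) auto
        finally show ?thesis by simp
      qed
      then show "\<exists>K. \<forall>m\<ge>K. \<forall>n\<ge>K. p (v m - v n) < e" by blast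
    qed
    have "limitin (norm_topology W q) \<sigma> (f v) sequentially"
      unfolding limitin_norm_topology[OF W \<sigma>W]
    proof (intro conjI allI impI)
      show "f v \<in> W" using vC by (simp add: W_def)
      fix e :: real assume "e > 0"
      then have e3: "e / 2 > 0" by simp
      obtain K L where K: "\<forall>m\<ge>K. \<forall>n\<ge>K. p (v m - v n) < e / 2"
        and L: "\<forall>n\<ge>L. q (\<sigma> n - k (v n)) < e / 2"
        using vC e3 small[OF e3] unfolding C_def by blast
      have "q (\<sigma> n - f v) < e" if n: "n \<ge> max K L" for n
      proof -
        have "(\<lambda>m. p ((k (v n) - v) m)) \<longlonglongrightarrow> q (k (v n) - v)"
          by (intro qconv Csub kC v vC)
        then have "q (k (v n) - v) \<le> e / 2"
          by (rule LIMSEQ_le_const2) (use K n in \<open>auto simp: k_def intro!: exI[of _ K] less_imp_le\<close>)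
        moreover have "q (\<sigma> n - f v) = q (\<sigma> n - v)" by (intro qf \<sigma>W vC)
        moreover have "q (\<sigma> n - v) \<le> q (\<sigma> n - k (v n)) + q (k (v n) - v)"
          by (intro qtri kC v \<sigma>C vC)
        moreover have "q (\<sigma> n - k (v n)) < e / 2" using L n by simp
        ultimately show ?thesis by linarith
      qed
      then show "\<exists>K. \<forall>n\<ge>K. q (\<sigma> n - f v) < e" by blast
    qed
    then show "\<exists>x. limitin MW.mtopology \<sigma> x sequentially" by (auto simp: norm_topology_def)
  qed
  have dense: "norm_topology W q closure_of (\<iota> ` V) = W"
  proof
    show "norm_topology W q closure_of (\<iota> ` V) \<subseteq> W"
      using closure_of_subset_topspace[of "norm_topology W q"] by (simp add: norm_topology_def)
    show "W \<subseteq> norm_topology W q closure_of (\<iota> ` V)"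
    proof
      fix w assume w: "w \<in> W"
      have "\<exists>y\<in>\<iota> ` V. y \<in> MW.mball w r" if "r > 0" for r
      proof -
        have "r / 2 > 0" using that by simp
        then obtain v where v: "v \<in> V" "q (w - k v) \<le> r / 2" using approx[OF WC[OF w]] by blast
        have "q (w - \<iota> v) = q (w - k v)" unfolding \<iota>_def by (intro qf w kC v)
        then have "\<iota> v \<in> MW.mball w r" using v that w \<iota>W[OF v(1)] by (simp add: norm_dist_def)
        then show ?thesis using v by blast
      qed
      then show "w \<in> norm_topology W q closure_of (\<iota> ` V)"
        using w by (simp add: norm_topology_def MW.metric_closure_of)
    qed
  qed
  have "banach_space_on ?sS W q"
    by (simp add: banach_space_on_def banach_space_on_axioms_def W complete)
  moreover have "\<iota> (u + v) = \<iota> u + \<iota> v" for u v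
    by (simp add: \<iota>_def f.add[symmetric]) (simp add: k_def plus_fun_def)
  moreover have "\<iota> (sV c v) = (\<lambda>n. sV c (\<iota> v n))" for c v
    using f.scale[of c "k v"] by (simp add: \<iota>_def k_def)
  moreover have "q (\<iota> v) = p v" if "v \<in> V" for v
    using qZ[OF kC[OF that] f(2)[OF kC[OF that]] f(4)[OF kC[OF that]]] by (simp add: \<iota>_def qk)
  ultimately have "completion_map sV V p ?sS W q \<iota>"
    using dense \<iota>W by (auto simp: completion_map_def)
  then show ?thesis by blast
qed

theorem completed_projective_tensor_exists:
  fixes sX :: "'k::real_or_complex \<Rightarrow> 'a::ab_group_add \<Rightarrow> 'a" and sY :: "'k \<Rightarrow> 'b::ab_group_add \<Rightarrow> 'b"
  assumes "normed_space_on sX UNIV N" and "normed_space_on sY UNIV M"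
  shows "\<exists>sW (W :: (nat \<Rightarrow> ('a \<Rightarrow> 'b \<Rightarrow> 'k) \<Rightarrow> 'k) set) q \<tau>.
    completed_projective_tensor sX N sY M sW W q \<tau>"
proof -
  obtain W :: "(nat \<Rightarrow> ('a \<Rightarrow> 'b \<Rightarrow> 'k) \<Rightarrow> 'k) set" and q \<iota> where
    "completion_map fun_scale (tensor_product sX sY) (proj_norm sX N sY M)
      (\<lambda>c s n. fun_scale c (s n)) W q \<iota>"
    using completion_exists[OF normed_space_on_tensor_product[OF assms]] by blast
  then have "completed_projective_tensor sX N sY M (\<lambda>c s n. fun_scale c (s n)) W q
      (\<lambda>x y. \<iota> (tensor sX sY x y))"
    unfolding completed_projective_tensor_def by blast
  then show ?thesis by blast
qed

end

theory Submission
  imports Defs "HOL-Probability.Distribution_Functions"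
begin

text \<open>
  Let (e_n, f_n) be a biorthogonal sequence in X with rapidly decreasing e_n, and let
  \<gamma>(t) = \<Sum> t^n e_n, so that f_n(\<gamma>(t)) = t^n.  The symmetric form
  B(x, y) = f_0(x) f_0(y) - f_2(x) f_0(y) + 2 f_1(x) f_1(y) - f_0(x) f_2(y) satisfies
  B(\<gamma>(s), \<gamma>(t)) = 1 - (s - t)^2.  Renorm X by the gauge of the absolutely convex hull of the
  curve and a small ball.  Then B is bounded by 1 on the new ball, and B(x, y) = 1 is possible there only
  for x = a \<gamma>(t), y = b \<gamma>(t) with a b = 1.

  The map \<Psi> sends \<alpha> to the integral of \<gamma>(t) \<otimes> \<gamma>(t).  The form B shows that its
  values have norm 1, and the forms f_n(x) f_0(y) recover the moments of \<alpha>, which gives injectivity and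
  the continuity of the inverse.  If \<Psi>(\<alpha>) = \<Sum> \<lambda>_n x_n \<otimes> y_n is an optimal
  representation, evaluating B forces x_n \<otimes> y_n = \<gamma>(t_n) \<otimes> \<gamma>(t_n) whenever
  \<lambda>_n > 0, and comparing moments shows that \<alpha> is carried by the points t_n.
\<close>

section \<open>Biorthogonal sequences\<close>

text \<open>If an affine map has all its values on the unit sphere, then all curve tensors lie in
  one face of the ball; to control attainment, this face must contain no other elementary tensors.
  So a bounded form is wanted that equals 1 on the diagonal of the curve and, up to scalars, nowhere
  else on the ball. With no inner product at hand it has to be built from finitely many functionals:
  the kernel \<open>1 - (s - t)^2\<close> is a polynomial attaining its maximum 1 exactly on the
  diagonal, and a monomial \<open>s^i t^j\<close> is read as \<open>f_i x * f_j y\<close>. The small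
  ball makes the gauge an equivalent norm; its radius is such that pairings with it lose a fixed
  proportion, so it creates no new points of attainment. These points cannot be read off from the
  hull, since the unit ball is only its closure: almost optimal combinations must be shown to
  concentrate at a single parameter, and for this the loss of the form is quantified. In the
  converse direction, a countably supported measure yields the series over its own atoms, which is
  already optimal.\<close>

lemma infinite_dimensional_biorthogonal_step:
  fixes scl :: "'k::real_or_complex \<Rightarrow> 'v::ab_group_add \<Rightarrow> 'v" and n :: nat
  assumes X: "normed_space_on scl UNIV p" and inf: "infinite_dimensional scl"
    and lin: "\<And>i. i < n \<Longrightarrow> Vector_Spaces.linear scl (*) (f i)"
    and bd: "\<And>i. i < n \<Longrightarrow> \<exists>C\<ge>0. \<forall>x. norm (f i x) \<le> C * p x"
    and orth: "\<And>i j. i < n \<Longrightarrow> j < n \<Longrightarrow> f i (e j) = (if i = j then 1 else 0)"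
    and r: "r > 0"
  shows "\<exists>a g. Vector_Spaces.linear scl (*) g \<and> (\<exists>C\<ge>0. \<forall>x. norm (g x) \<le> C * p x) \<and>
    (\<forall>i<n. f i a = 0 \<and> g (e i) = 0) \<and> g a = 1 \<and> p a \<le> r"
proof -
  interpret normed_space_on scl UNIV p by (rule X)
  note nn = norm_nonneg_on[OF X, simplified]
  have fadd: "f i (x + y) = f i x + f i y" and fscl: "f i (scl c x) = c * f i x"
    and fsum: "f i (\<Sum>j\<in>J. h j) = (\<Sum>j\<in>J. f i (h j))" and fdiff: "f i (x - y) = f i x - f i y"
    if "i < n" for i c x y and h :: "nat \<Rightarrow> 'v" and J
  proof -
    interpret f: Vector_Spaces.linear scl "(*)" "f i" by (rule lin[OF that])
    show "f i (x + y) = f i x + f i y" "f i (scl c x) = c * f i x"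
      "f i (\<Sum>j\<in>J. h j) = (\<Sum>j\<in>J. f i (h j))" "f i (x - y) = f i x - f i y"
      by (simp_all add: f.add f.scale f.sum f.diff)
  qed
  \<comment> \<open>Otherwise every \<open>x\<close> equals
    \<open>\<Sum>j<n. scl (f j x) (e j)\<close>, because the difference lies in all the kernels, and
    finitely many vectors span.\<close>
  have "\<exists>b. b \<noteq> 0 \<and> (\<forall>i<n. f i b = 0)"
  proof (rule ccontr)
    assume no: "\<not> ?thesis"
    have "x \<in> span (e ` {..<n})" for x
    proof -
      let ?y = "\<Sum>j<n. scl (f j x) (e j)"
      have "f i (x - ?y) = 0" if i: "i < n" for i
      proof -
        have "f i ?y = (\<Sum>j<n. f j x * (if i = j then 1 else 0))"
          by (subst fsum[OF i]) (rule sum.cong, auto simp add: fscl[OF i] orth[OF i])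
        also have "\<dots> = f i x"
        proof -
          have "(\<Sum>j<n. f j x * (if i = j then 1 else 0)) = (\<Sum>j<n. if i = j then f j x else 0)"
            by (intro sum.cong) auto
          then show ?thesis using i by simp
        qed
        finally show ?thesis using i by (simp add: fdiff)
      qed
      then have "x = ?y" using no by (metis eq_iff_diff_eq_0)
      also have "?y \<in> span (e ` {..<n})" by (intro span_sum span_scale span_base) auto
      finally show ?thesis .
    qed
    then have "span (e ` {..<n}) = UNIV" by blast
    then show False using inf unfolding infinite_dimensional_def by (metis finite_imageI finite_lessThan)
  qed
  then obtain b where b: "b \<noteq> 0" "\<And>i. i < n \<Longrightarrow> f i b = 0" by blast
  have pb: "p b > 0" using b(1) norm_eq_0_iff[of b] nn[of b] by simp
  define a where "a = scl (of_real (r / p b)) b"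
  have pa: "p a = r" using pb r by (simp add: a_def norm_scale norm_divide)
  have fa: "f i a = 0" if "i < n" for i using that by (simp add: a_def fscl b(2))
  obtain g0 C0 where g0: "Vector_Spaces.linear scl (*) g0" and C0: "\<And>x. norm (g0 x) \<le> C0 * p x"
    and g0a: "g0 a = 1"
    using seminorm_functional[of scl p a] vector_space_axioms norm_triangle norm_scale pa r by auto
  interpret g0: Vector_Spaces.linear scl "(*)" g0 by (rule g0)
  \<comment> \<open>The correction removes the values at the earlier \<open>e i\<close> and leaves
    \<open>g0 a = 1\<close> alone, as every \<open>f i\<close> vanishes at \<open>a\<close>.\<close>
  define g where "g x = g0 x - (\<Sum>i<n. g0 (e i) * f i x)" for x
  have "\<forall>i\<in>{..<n}. \<exists>C\<ge>0. \<forall>x. norm (f i x) \<le> C * p x" using bd by blast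
  then obtain D where D: "\<And>i. i < n \<Longrightarrow> D i \<ge> 0" "\<And>i x. i < n \<Longrightarrow> norm (f i x) \<le> D i * p x"
    by (metis lessThan_iff)
  let ?C = "\<bar>C0\<bar> + (\<Sum>i<n. norm (g0 (e i)) * D i)"
  have "norm (g x) \<le> ?C * p x" for x
  proof -
    have "norm (g x) \<le> norm (g0 x) + norm (\<Sum>i<n. g0 (e i) * f i x)"
      unfolding g_def by (rule norm_triangle_ineq4)
    also have "norm (\<Sum>i<n. g0 (e i) * f i x) \<le> (\<Sum>i<n. norm (g0 (e i)) * (D i * p x))"
      by (rule sum_norm_le) (simp add: norm_mult D mult_left_mono)
    also have "norm (g0 x) \<le> \<bar>C0\<bar> * p x"
      using C0[of x] mult_right_mono[OF abs_ge_self nn, of C0 x] by linarith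
    finally show ?thesis by (simp add: algebra_simps sum_distrib_left)
  qed
  moreover have "?C \<ge> 0" using D by (intro add_nonneg_nonneg sum_nonneg) auto
  moreover have "Vector_Spaces.linear scl (*) g"
    by unfold_locales (simp_all add: g_def fadd fscl g0.add g0.scale algebra_simps sum.distrib sum_distrib_left)
  moreover have "g (e j) = 0" if "j < n" for j
  proof -
    have "(\<Sum>i<n. g0 (e i) * f i (e j)) = (\<Sum>i<n. if i = j then g0 (e i) else 0)"
      using that by (intro sum.cong) (auto simp: orth)
    then show ?thesis using that by (simp add: g_def)
  qed
  moreover have "g a = 1" by (simp add: g_def fa g0a)
  ultimately show ?thesis using fa pa by (intro exI[of _ a] exI[of _ g]) auto
qed

text \<open>Pairs of vector and functional are chosen by well-founded recursion. Each new pair is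
  orthogonal to all earlier ones in both directions, so biorthogonality follows by comparing
  indices.\<close>

lemma infinite_dimensional_biorthogonal_sequence:
  fixes scl :: "'k::real_or_complex \<Rightarrow> 'v::ab_group_add \<Rightarrow> 'v" and r :: "nat \<Rightarrow> real"
  assumes X: "normed_space_on scl UNIV p" and inf: "infinite_dimensional scl" and r: "\<And>n. r n > 0"
  shows "\<exists>e f. (\<forall>n. Vector_Spaces.linear scl (*) (f n) \<and> (\<exists>C\<ge>0. \<forall>x. norm (f n x) \<le> C * p x) \<and> p (e n) \<le> r n) \<and>
    (\<forall>i j. f i (e j) = (if i = j then 1 else 0))"
proof -
  define P where "P h n z \<longleftrightarrow> Vector_Spaces.linear scl (*) (snd z) \<and> (\<exists>C\<ge>0. \<forall>x. norm (snd z x) \<le> C * p x) \<and>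
    (\<forall>i<n. snd (h i) (fst z) = 0 \<and> snd z (fst (h i)) = 0) \<and> snd z (fst z) = 1 \<and> p (fst z) \<le> r n"
    for h :: "nat \<Rightarrow> 'v \<times> ('v \<Rightarrow> 'k)" and n :: nat and z
  have "\<exists>h. \<forall>n. P h n (h n)"
  proof (rule dependent_wellorder_choice)
    fix z and h g :: "nat \<Rightarrow> 'v \<times> ('v \<Rightarrow> 'k)" and n :: nat assume "\<And>m. m < n \<Longrightarrow> h m = g m"
    then show "P h n z = P g n z" by (simp add: P_def)
  next
    fix n :: nat and h assume IH: "\<And>m. m < n \<Longrightarrow> P h m (h m)"
    have "\<exists>a g. Vector_Spaces.linear scl (*) g \<and> (\<exists>C\<ge>0. \<forall>x. norm (g x) \<le> C * p x) \<and>
        (\<forall>i<n. snd (h i) a = 0 \<and> g (fst (h i)) = 0) \<and> g a = 1 \<and> p a \<le> r n"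
    proof (rule infinite_dimensional_biorthogonal_step[OF X inf _ _ _ r])
      show "snd (h i) (fst (h j)) = (if i = j then 1 else 0)" if "i < n" "j < n" for i j
        using IH[OF that(1)] IH[OF that(2)] by (cases i j rule: linorder_cases) (auto simp: P_def)
    qed (use IH in \<open>auto simp: P_def\<close>)
    then obtain a g where "P h n (a, g)" unfolding P_def by auto
    then show "\<exists>z. P h n z" by blast
  qed
  then obtain h where h: "\<And>n. P h n (h n)" by blast
  have "snd (h i) (fst (h j)) = (if i = j then 1 else 0)" for i j
    using h[of i] h[of j] by (cases i j rule: linorder_cases) (auto simp: P_def)
  then show ?thesis using h
    by (intro exI[of _ "\<lambda>n. fst (h n)"] exI[of _ "\<lambda>n. snd (h n)"]) (auto simp: P_def)
qed

text \<open>This is the real part of the isometric embedding into the complex numbers. Its last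
  property, that in the unit disc only 1 has real part 1, later recovers the equation
  \<open>B x y = 1\<close> from real-valued functionals.\<close>

lemma real_part_functional:
  "\<exists>\<rho> :: 'k::real_or_complex \<Rightarrow> real. (\<forall>a b. \<rho> (a + b) = \<rho> a + \<rho> b) \<and> (\<forall>r a. \<rho> (of_real r * a) = r * \<rho> a) \<and>
    (\<forall>a. \<bar>\<rho> a\<bar> \<le> norm a) \<and> \<rho> 1 = 1 \<and> (\<forall>a. norm a \<le> 1 \<longrightarrow> \<rho> a = 1 \<longrightarrow> a = 1)"
proof -
  obtain h :: "'k \<Rightarrow> complex" where add: "\<And>x y. h (x + y) = h x + h y"
    and mult: "\<And>x y. h (x * y) = h x * h y" and nrm: "\<And>x. cmod (h x) = norm x"
    using real_or_complex by blast
  have h1: "h 1 = 1"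
    using mult[of 1 1] nrm[of 1] by (metis mult_cancel_left2 mult.left_neutral norm_one norm_zero zero_neq_one)
  have rng: "\<bar>Re (h a)\<bar> \<le> norm a" for a using abs_Re_le_cmod[of "h a"] nrm by simp
  have hdiff: "h (x - y) = h x - h y" for x y
    using add[of "x - y" y] by simp
  \<comment> \<open>A complex number at distance \<open>\<bar>r\<bar>\<close> from 0 and
    \<open>\<bar>r - 1\<bar>\<close> from 1 is \<open>r\<close>.\<close>
  have hr: "h (of_real r) = of_real r" for r
  proof -
    let ?z = "h (of_real r)"
    have "cmod ?z = \<bar>r\<bar>" "cmod (?z - 1) = \<bar>r - 1\<bar>"
      using nrm[of "of_real r"] nrm[of "of_real r - 1"] hdiff[of "of_real r" 1] h1
      by (simp, metis norm_of_real of_real_1 of_real_diff)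
    then have a: "(Re ?z)\<^sup>2 + (Im ?z)\<^sup>2 = r\<^sup>2" "(Re ?z - 1)\<^sup>2 + (Im ?z)\<^sup>2 = (r - 1)\<^sup>2"
      using cmod_power2[of ?z] cmod_power2[of "?z - 1"] by simp_all
    then have "Re ?z = r" by (simp add: power2_eq_square algebra_simps)
    with a show ?thesis by (simp add: complex_eq_iff)
  qed
  have strict: "a = 1" if "norm a \<le> 1" "Re (h a) = 1" for a
  proof -
    have "(Im (h a))\<^sup>2 \<le> 0"
      using that cmod_power2[of "h a"] nrm[of a] power_mono[of "norm a" 1 2] by simp
    then have "h a = 1" using that by (simp add: complex_eq_iff)
    then have "norm (a - 1) = 0" using nrm[of "a - 1"] by (simp add: hdiff h1)
    then show ?thesis by simp
  qed
  show ?thesis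
    by (intro exI[of _ "\<lambda>a. Re (h a)"]) (auto simp: add mult hr h1 rng strict)
qed

section \<open>The renorming\<close>

text \<open>The renorming depends only on these properties of the curve and the form. The functional
  \<open>g\<close> is 1 along the curve, so on a combination of curve points it returns the sum of
  the coefficients.\<close>

locale curve_renorming =
  fixes scl :: "'k::real_or_complex \<Rightarrow> 'a::real_normed_vector \<Rightarrow> 'a"
    and \<gamma> :: "real \<Rightarrow> 'a" and B :: "'a \<Rightarrow> 'a \<Rightarrow> 'k" and g :: "'a \<Rightarrow> 'k" and M :: real
  assumes normed: "normed_space_on scl UNIV norm"
    and curve_bound: "t \<in> {0..1} \<Longrightarrow> norm (\<gamma> t) \<le> 2"
    and curve_lipschitz: "s \<in> {0..1} \<Longrightarrow> t \<in> {0..1} \<Longrightarrow> norm (\<gamma> s - \<gamma> t) \<le> 2 * \<bar>s - t\<bar>"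
    and form_add: "B (x + y) z = B x z + B y z" and form_scale: "B (scl c x) z = c * B x z"
    and form_commute: "B x y = B y x"
    and form_bound: "norm (B x y) \<le> M * norm x * norm y" and M_ge_1: "1 \<le> M"
    and form_curve: "s \<in> {0..1} \<Longrightarrow> t \<in> {0..1} \<Longrightarrow> B (\<gamma> s) (\<gamma> t) = of_real (1 - (s - t)\<^sup>2)"
    and g_add: "g (x + y) = g x + g y" and g_scale: "g (scl c x) = c * g x"
    and g_bound: "norm (g x) \<le> M * norm x" and g_curve: "t \<in> {0..1} \<Longrightarrow> g (\<gamma> t) = 1"
begin

interpretation X: normed_space_on scl UNIV norm by (rule normed)

lemma form_simps:
  "B 0 z = 0" "B z 0 = 0" "B z (x + y) = B z x + B z y" "B z (scl c x) = c * B z x"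
  "B (x - y) z = B x z - B y z" "B z (x - y) = B z x - B z y"
proof -
  show 1: "B 0 z = 0" for z using form_add[of 0 0 z] by simp
  then show "B z 0 = 0" by (simp add: form_commute[of z])
  show "B z (x + y) = B z x + B z y" "B z (scl c x) = c * B z x"
    by (simp_all add: form_commute[of z] form_add form_scale)
  show "B (x - y) z = B x z - B y z" for x y z using form_add[of "x - y" y z] by simp
  then show "B z (x - y) = B z x - B z y" by (simp add: form_commute[of z])
qed

lemma form_sum: "B (\<Sum>i\<in>I. h i) z = (\<Sum>i\<in>I. B (h i) z)" "B z (\<Sum>i\<in>I. h i) = (\<Sum>i\<in>I. B z (h i))"
  by (induction I rule: infinite_finite_induct) (simp_all add: form_simps form_add)

lemma g_sum: "g (\<Sum>i\<in>I. h i) = (\<Sum>i\<in>I. g (h i))"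
proof -
  have "g 0 = 0" using g_add[of 0 0] by simp
  then show ?thesis by (induction I rule: infinite_finite_induct) (simp_all add: g_add)
qed

lemma g_diff: "g (x - y) = g x - g y"
  using g_add[of "x - y" y] by simp

section \<open>The gauge norm and its equivalence with the given norm\<close>

definition comb :: "real set \<Rightarrow> (real \<Rightarrow> 'k) \<Rightarrow> 'a" where
  "comb F c = (\<Sum>t\<in>F. scl (c t) (\<gamma> t))"

definition mass :: "real set \<Rightarrow> (real \<Rightarrow> 'k) \<Rightarrow> real" where
  "mass F c = (\<Sum>t\<in>F. norm (c t))"

text \<open>The price of approximating \<open>x\<close> by a combination of curve points. The rate
  \<open>4 * M\<close> for the remainder is twice what a remainder can contribute to
  \<open>B\<close> when paired with the curve, where vectors have norm at most 2.\<close>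

definition cost :: "'a \<Rightarrow> real set \<Rightarrow> (real \<Rightarrow> 'k) \<Rightarrow> real" where
  "cost x F c = mass F c + 4 * M * norm (x - comb F c)"

definition atoms :: "real set set" where
  "atoms = {F. finite F \<and> F \<subseteq> {0..1}}"

text \<open>Up to closure, the unit ball of this norm is the absolutely convex hull of the curve and of the
  ball of radius \<^term>\<open>1 / (4 * M)\<close>.\<close>

definition curve_norm :: "'a \<Rightarrow> real" where
  "curve_norm x = Inf {cost x F c | F c. F \<in> atoms}"

lemma mass_nonneg: "0 \<le> mass F c"
  by (simp add: mass_def sum_nonneg)

lemma cost_nonneg: "0 \<le> cost x F c"
  using M_ge_1 mass_nonneg by (simp add: cost_def)

lemma curve_norm_le: "F \<in> atoms \<Longrightarrow> curve_norm x \<le> cost x F c"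
  unfolding curve_norm_def by (rule cInf_lower) (auto intro!: bdd_belowI[of _ 0] cost_nonneg)

lemma empty_atoms: "{} \<in> atoms"
  by (simp add: atoms_def)

lemma curve_norm_ge: "(\<And>F c. F \<in> atoms \<Longrightarrow> b \<le> cost x F c) \<Longrightarrow> b \<le> curve_norm x"
  unfolding curve_norm_def using empty_atoms by (intro cInf_greatest) auto

lemma curve_norm_approx:
  assumes "curve_norm x < b"
  obtains F c where "F \<in> atoms" "cost x F c < b"
  using assms curve_norm_ge[of b x] by (meson linorder_not_le)

lemma curve_norm_nonneg: "0 \<le> curve_norm x"
  by (intro curve_norm_ge cost_nonneg)

lemma curve_norm_le_norm: "curve_norm x \<le> 4 * M * norm x"
  using curve_norm_le[OF empty_atoms, of x "\<lambda>_. 0"] by (simp add: cost_def mass_def comb_def)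

lemma norm_comb_le: "F \<in> atoms \<Longrightarrow> norm (comb F c) \<le> 2 * mass F c"
  unfolding comb_def mass_def sum_distrib_left
  by (rule sum_norm_le)
    (use curve_bound in \<open>auto simp: X.norm_scale atoms_def mult.commute intro!: mult_right_mono\<close>)

lemma norm_le_curve_norm: "norm x \<le> 2 * curve_norm x"
proof -
  have "norm x / 2 \<le> curve_norm x"
  proof (rule curve_norm_ge)
    fix F c assume "F \<in> atoms"
    then have "norm x \<le> 2 * mass F c + norm (x - comb F c)"
      using norm_comb_le[of F c] norm_triangle_sub[of x "comb F c"] by linarith
    also have "norm (x - comb F c) \<le> 8 * M * norm (x - comb F c)"
      using M_ge_1 by (simp add: mult_le_cancel_right1)
    finally show "norm x / 2 \<le> cost x F c" by (simp add: cost_def)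
  qed
  then show ?thesis by simp
qed

lemma curve_norm_curve: "t \<in> {0..1} \<Longrightarrow> curve_norm (\<gamma> t) \<le> 1"
  using curve_norm_le[of "{t}" "\<gamma> t" "\<lambda>_. 1"] by (simp add: atoms_def cost_def mass_def comb_def)

lemma comb_add:
  assumes "F \<in> atoms" "F' \<in> atoms"
  obtains F'' c'' where "F'' \<in> atoms" "comb F'' c'' = comb F c + comb F' c'" "mass F'' c'' \<le> mass F c + mass F' c'"
proof
  let ?c = "\<lambda>t. (if t \<in> F then c t else 0)" and ?c' = "\<lambda>t. (if t \<in> F' then c' t else 0)"
  let ?F = "F \<union> F'"
  show F: "?F \<in> atoms" using assms by (auto simp: atoms_def)
  have fin: "finite ?F" using F by (simp add: atoms_def)
  have 1: "(\<Sum>t\<in>?F. scl (?c t) (\<gamma> t)) = comb F c" "(\<Sum>t\<in>?F. scl (?c' t) (\<gamma> t)) = comb F' c'"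
    "(\<Sum>t\<in>?F. norm (?c t)) = mass F c" "(\<Sum>t\<in>?F. norm (?c' t)) = mass F' c'"
    unfolding comb_def mass_def using fin by (auto intro!: sum.mono_neutral_cong_right)
  show "comb ?F (\<lambda>t. ?c t + ?c' t) = comb F c + comb F' c'"
    unfolding 1[symmetric] by (simp add: comb_def X.scale_left_distrib sum.distrib)
  have "(\<Sum>t\<in>?F. norm (?c t + ?c' t)) \<le> (\<Sum>t\<in>?F. norm (?c t)) + (\<Sum>t\<in>?F. norm (?c' t))"
    unfolding sum.distrib[symmetric] by (intro sum_mono norm_triangle_ineq)
  then show "mass ?F (\<lambda>t. ?c t + ?c' t) \<le> mass F c + mass F' c'"
    unfolding 1 by (simp add: mass_def)
qed

lemma curve_norm_triangle: "curve_norm (x + y) \<le> curve_norm x + curve_norm y"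
proof -
  have 1: "curve_norm (x + y) \<le> cost x F c + cost y F' c'" if F: "F \<in> atoms" "F' \<in> atoms" for F F' c c'
  proof -
    obtain F'' c'' where F'': "F'' \<in> atoms" "comb F'' c'' = comb F c + comb F' c'"
      "mass F'' c'' \<le> mass F c + mass F' c'" using comb_add[OF F] by blast
    have "norm (x + y - comb F'' c'') \<le> norm (x - comb F c) + norm (y - comb F' c')"
      unfolding F'' using norm_triangle_ineq[of "x - comb F c" "y - comb F' c'"] by (simp add: algebra_simps)
    then have "4 * M * norm (x + y - comb F'' c'') \<le> 4 * M * (norm (x - comb F c) + norm (y - comb F' c'))"
      using M_ge_1 by (intro mult_left_mono) auto
    then show ?thesis using curve_norm_le[OF F''(1), of "x + y" c''] F''(3)
      by (simp add: cost_def algebra_simps)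
  qed
  have "curve_norm (x + y) - cost x F c \<le> curve_norm y" if "F \<in> atoms" for F c
    using 1[OF that] by (intro curve_norm_ge) (simp add: algebra_simps)
  then have "curve_norm (x + y) - curve_norm y \<le> curve_norm x"
    by (intro curve_norm_ge) (simp add: algebra_simps)
  then show ?thesis by simp
qed

lemma cost_scale: "cost (scl a x) F (\<lambda>t. a * c t) = norm a * cost x F c"
proof -
  have "comb F (\<lambda>t. a * c t) = scl a (comb F c)" by (simp add: comb_def X.scale_sum_right)
  then have "norm (scl a x - comb F (\<lambda>t. a * c t)) = norm a * norm (x - comb F c)"
    by (simp add: X.norm_scale flip: X.scale_right_diff_distrib)
  then show ?thesis by (simp add: cost_def mass_def norm_mult sum_distrib_left algebra_simps)
qed

lemma curve_norm_scale: "curve_norm (scl a x) = norm a * curve_norm x"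
proof -
  have le: "curve_norm (scl a x) \<le> norm a * curve_norm x" if "a \<noteq> 0" for a x
  proof -
    have "curve_norm (scl a x) / norm a \<le> curve_norm x"
      using curve_norm_le cost_scale that
      by (intro curve_norm_ge) (metis divide_le_eq mult.commute zero_less_norm_iff)
    then show ?thesis using that by (simp add: field_simps)
  qed
  show ?thesis
  proof (cases "a = 0")
    case True
    then show ?thesis using curve_norm_le_norm[of 0] curve_norm_nonneg[of 0] by simp
  next
    case False
    have "norm a * curve_norm x \<le> curve_norm (scl a x)"
      using le[of "inverse a" "scl a x"] False by (simp add: norm_divide inverse_eq_divide field_simps)
    with le[OF False] show ?thesis by (meson antisym)
  qed
qed

lemma equivalent_curve_norm: "equivalent_norm scl curve_norm"
  unfolding equivalent_norm_def
proof (intro conjI exI)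
  show "normed_space_on scl UNIV curve_norm"
  proof
    show "curve_norm x = 0 \<longleftrightarrow> x = 0" for x
      using norm_le_curve_norm[of x] curve_norm_le_norm[of x] curve_norm_nonneg[of x] by auto
  qed (simp_all add: X.subspace_V curve_norm_triangle curve_norm_scale)
  show "(1/2 :: real) > 0" "4 * M > 0" using M_ge_1 by simp_all
  show "\<forall>x. 1/2 * norm x \<le> curve_norm x \<and> curve_norm x \<le> 4 * M * norm x"
    using norm_le_curve_norm curve_norm_le_norm by (simp add: mult.commute)
qed

section \<open>Loss estimates for the form and its points of attainment\<close>

text \<open>On the curve the form falls short of \<^term>\<open>1\<close> by a square, and off the curve by the factor
  \<^term>\<open>1/2\<close>; this records the total loss.\<close>

lemma form_cost_estimate:
  fixes x y :: 'a and F c F' c'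
  defines "A \<equiv> mass F c" and "A' \<equiv> mass F' c'"
    and "R \<equiv> 4 * M * norm (x - comb F c)" and "R' \<equiv> 4 * M * norm (y - comb F' c')"
  assumes F: "F \<in> atoms" and F': "F' \<in> atoms"
  shows "norm (B x y) + (\<Sum>t\<in>F. \<Sum>s\<in>F'. norm (c t) * norm (c' s) * (t - s)\<^sup>2)
      + (A * R' + R * A' + R * R') / 2 \<le> cost x F c * cost y F' c'"
proof -
  let ?P = "comb F c" and ?P' = "comb F' c'"
  let ?D = "\<Sum>t\<in>F. \<Sum>s\<in>F'. norm (c t) * norm (c' s) * (t - s)\<^sup>2"
  have norm4: "norm (u + v + w + z) \<le> norm u + norm v + norm w + norm z" for u v w z :: 'k
    using norm_triangle_ineq[of "u + v + w" z] norm_triangle_ineq[of "u + v" w] norm_triangle_ineq[of u v]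
    by linarith
  have "B x y = B ?P ?P' + B ?P (y - ?P') + B (x - ?P) ?P' + B (x - ?P) (y - ?P')"
    by (simp add: form_simps)
  then have "norm (B x y) \<le> norm (B ?P ?P') + norm (B ?P (y - ?P')) + norm (B (x - ?P) ?P') + norm (B (x - ?P) (y - ?P'))"
    using norm4 by metis
  moreover have "norm (B ?P ?P') \<le> A * A' - ?D"
  proof -
    \<comment> \<open>Each pair of atoms contributes \<open>1 - (t - s)^2\<close>, which is
      nonnegative on the unit square; the deficits add up to \<open>?D\<close>.\<close>
    have "B ?P ?P' = (\<Sum>t\<in>F. \<Sum>s\<in>F'. c t * (c' s * B (\<gamma> t) (\<gamma> s)))"
      by (simp add: comb_def form_sum form_simps form_scale sum_distrib_left)
        (subst sum.swap, simp add: mult.left_commute)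
    also have "norm \<dots> \<le> (\<Sum>t\<in>F. \<Sum>s\<in>F'. norm (c t) * norm (c' s) * (1 - (t - s)\<^sup>2))"
    proof (intro sum_norm_le)
      fix t s assume "t \<in> F" "s \<in> F'"
      then have ts: "t \<in> {0..1}" "s \<in> {0..1}" using F F' by (auto simp: atoms_def)
      then have "\<bar>t - s\<bar> \<le> 1" by (auto simp: abs_if)
      then have "(t - s)\<^sup>2 \<le> 1" by (simp add: abs_square_le_1)
      then show "norm (c t * (c' s * B (\<gamma> t) (\<gamma> s))) \<le> norm (c t) * norm (c' s) * (1 - (t - s)\<^sup>2)"
        using ts by (simp add: form_curve norm_mult del: of_real_diff of_real_power)
    qed
    also have "\<dots> = A * A' - ?D"
      by (simp add: A_def A'_def mass_def sum_product sum_subtractf right_diff_distrib)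
    finally show ?thesis .
  qed
  \<comment> \<open>The bound \<open>2 * A\<close> for \<open>norm ?P\<close> against the rate
    \<open>4 * M\<close> inside \<open>R'\<close> leaves the factor 1/2.\<close>
  moreover have "norm (B ?P (y - ?P')) \<le> A * R' / 2"
  proof -
    have "norm (B ?P (y - ?P')) \<le> M * norm ?P * norm (y - ?P')" by (rule form_bound)
    also have "\<dots> \<le> M * (2 * A) * norm (y - ?P')"
      using norm_comb_le[OF F, of c] M_ge_1 by (intro mult_right_mono mult_left_mono) (auto simp: A_def)
    finally show ?thesis by (simp add: R'_def algebra_simps)
  qed
  moreover have "norm (B (x - ?P) ?P') \<le> R * A' / 2"
  proof -
    have "norm (B (x - ?P) ?P') \<le> M * norm (x - ?P) * norm ?P'" by (rule form_bound)
    also have "\<dots> \<le> M * norm (x - ?P) * (2 * A')"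
      using norm_comb_le[OF F', of c'] M_ge_1 by (intro mult_left_mono) (auto simp: A'_def)
    finally show ?thesis by (simp add: R_def algebra_simps)
  qed
  \<comment> \<open>The form bound has one factor \<open>M\<close>, while \<open>R * R'\<close> has
    two; \<open>8 * M \<ge> 1\<close> bridges the gap.\<close>
  moreover have "norm (B (x - ?P) (y - ?P')) \<le> R * R' / 2"
  proof -
    have "norm (B (x - ?P) (y - ?P')) \<le> M * norm (x - ?P) * norm (y - ?P')" by (rule form_bound)
    also have "\<dots> \<le> (8 * M) * (M * norm (x - ?P) * norm (y - ?P'))"
      using mult_right_mono[of 1 "8 * M" "M * norm (x - ?P) * norm (y - ?P')"] M_ge_1 by simp
    finally show ?thesis by (simp add: R_def R'_def algebra_simps)
  qed
  moreover have "cost x F c * cost y F' c' = A * A' + A * R' + R * A' + R * R'"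
    by (simp add: cost_def A_def A'_def R_def R'_def algebra_simps)
  ultimately show ?thesis
    unfolding add_divide_distrib by linarith
qed

text \<open>Both losses in \<open>form_cost_estimate\<close> are nonnegative, so the product of the
  costs dominates the form; the costs are then driven down to the norms.\<close>

lemma form_le_curve_norm: "norm (B x y) \<le> curve_norm x * curve_norm y"
proof -
  have 1: "norm (B x y) \<le> cost x F c * cost y F' c'" if F: "F \<in> atoms" "F' \<in> atoms" for F c F' c'
  proof -
    have "0 \<le> (\<Sum>t\<in>F. \<Sum>s\<in>F'. norm (c t) * norm (c' s) * (t - s)\<^sup>2)"
      by (intro sum_nonneg) simp
    moreover have "0 \<le> (mass F c * (4 * M * norm (y - comb F' c')) + 4 * M * norm (x - comb F c) * mass F' c'
        + 4 * M * norm (x - comb F c) * (4 * M * norm (y - comb F' c'))) / 2"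
      using mass_nonneg M_ge_1 by simp
    ultimately show ?thesis using form_cost_estimate[OF F, of x y c c'] by linarith
  qed
  have nx: "curve_norm x < curve_norm x + d" if "d > 0" for d :: real and x :: 'a using that by simp
  have 2: "norm (B x y) \<le> (curve_norm x + d) * (curve_norm y + d)" if d: "d > 0" for d
  proof -
    obtain F c where F: "F \<in> atoms" "cost x F c < curve_norm x + d" by (rule curve_norm_approx[OF nx[OF d]])
    obtain F' c' where F': "F' \<in> atoms" "cost y F' c' < curve_norm y + d" by (rule curve_norm_approx[OF nx[OF d]])
    have "cost x F c * cost y F' c' \<le> (curve_norm x + d) * (curve_norm y + d)"
      using F F' cost_nonneg by (intro mult_mono) (auto intro: less_imp_le order_trans[OF cost_nonneg])
    then show ?thesis using 1[OF F(1) F'(1), of c c'] by linarith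
  qed
  have "((\<lambda>d. (curve_norm x + d) * (curve_norm y + d)) \<longlongrightarrow> (curve_norm x + 0) * (curve_norm y + 0)) (at_right 0)"
    by (intro tendsto_intros)
  then have "norm (B x y) \<le> (curve_norm x + 0) * (curve_norm y + 0)"
    by (rule tendsto_lowerbound) (auto simp: eventually_at_right_less 2 intro: eventually_at_rightI[of 0 1])
  then show ?thesis by simp
qed

text \<open>Take decompositions of \<open>x\<close> and \<open>y\<close> whose costs exceed 1 by
  less than \<open>e\<^sup>2\<close>. Since \<open>B x y = 1\<close>, the total loss is of order
  \<open>e\<^sup>2\<close>: the remainders are small, and the atoms of \<open>x\<close> are close to
  those of \<open>y\<close> in weighted mean square. As the loss is quadratic in the distance of
  parameters and the curve is Lipschitz, \<open>x\<close> is within order \<open>e\<close> of a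
  multiple of one curve point. The factor 100 is generous.\<close>

lemma near_curve:
  assumes x: "curve_norm x \<le> 1" and y: "curve_norm y \<le> 1" and xy: "B x y = 1" and e: "0 < e" "e \<le> 1/100"
  shows "\<exists>s\<in>{0..1}. norm (x - scl (g x) (\<gamma> s)) \<le> 100 * M * e"
proof -
  define d where "d = e\<^sup>2"
  have d: "0 < d" "d \<le> e / 100" using e by (auto simp: d_def power2_eq_square)
  obtain F c where F: "F \<in> atoms" and cx: "cost x F c < 1 + d" using curve_norm_approx[of x "1 + d"] x d by auto
  obtain F' c' where F': "F' \<in> atoms" and cy: "cost y F' c' < 1 + d" using curve_norm_approx[of y "1 + d"] y d by auto
  define A A' R R' where "A = mass F c" and "A' = mass F' c'"
    and "R = 4 * M * norm (x - comb F c)" and "R' = 4 * M * norm (y - comb F' c')"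
  define D where "D = (\<Sum>t\<in>F. \<Sum>s\<in>F'. norm (c t) * norm (c' s) * (t - s)\<^sup>2)"
  have pos: "0 \<le> A" "0 \<le> A'" "0 \<le> R" "0 \<le> R'" "0 \<le> D"
    using mass_nonneg M_ge_1 by (auto simp: A_def A'_def R_def R'_def D_def intro!: sum_nonneg)
  have c1: "A + R < 1 + d" "A' + R' < 1 + d" using cx cy by (simp_all add: cost_def A_def A'_def R_def R'_def)
  have est: "1 + D + (A * R' + R * A' + R * R') / 2 \<le> (A + R) * (A' + R')"
    using form_cost_estimate[OF F F', of x y c c'] xy
    by (simp add: cost_def A_def[symmetric] A'_def[symmetric] R_def[symmetric] R'_def[symmetric] D_def)
  have "(A + R) * (A' + R') \<le> (1 + d) * (1 + d)" using c1 pos by (intro mult_mono) auto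
  also have "\<dots> \<le> 1 + 3 * d" using d e by (simp add: algebra_simps mult_left_le_one_le)
  finally have up: "(A + R) * (A' + R') \<le> 1 + 3 * d" .
  have prods: "0 \<le> A * R'" "0 \<le> R * A'" "0 \<le> R * R'" using pos by auto
  have "1 \<le> 1 + D + (A * R' + R * A' + R * R') / 2" using pos prods by simp
  then have ge1: "1 \<le> (A + R) * (A' + R')" using est by (rule order_trans)
  have AR': "A' + R' \<ge> 1/2"
  proof (rule ccontr)
    assume "\<not> ?thesis"
    then have "A' + R' < 1/2" by simp
    moreover have "(A + R) * (A' + R') \<le> 2 * (A' + R')"
      using c1 pos d e by (intro mult_right_mono) auto
    ultimately show False using order_trans[OF ge1] by fastforce
  qed
  have AR: "A + R \<ge> 1/2"
  proof (rule ccontr)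
    assume "\<not> ?thesis"
    then have "A + R < 1/2" by simp
    moreover have "(A + R) * (A' + R') \<le> (A + R) * 2"
      using c1 pos d e by (intro mult_left_mono) auto
    ultimately show False using order_trans[OF ge1] by fastforce
  qed
  have lin: "D \<le> 3 * d \<and> v + w \<le> 6 * d \<and> u + w \<le> 6 * d"
    if "1 + D + (u + v + w) / 2 \<le> 1 + 3 * d" "0 \<le> u" "0 \<le> v" "0 \<le> w" for u v w :: real
    using that pos(5) by argo
  have DR: "D \<le> 3 * d" "R * A' + R * R' \<le> 6 * d" "A * R' + R * R' \<le> 6 * d"
    using lin[OF order_trans[OF est up] prods] by simp_all
  have R: "R \<le> 12 * d"
  proof -
    have "R * (1/2) \<le> R * (A' + R')" using AR' pos by (intro mult_left_mono) auto
    then show ?thesis using DR by (simp add: algebra_simps)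
  qed
  have R': "R' \<le> 12 * d"
  proof -
    have "(1/2) * R' \<le> (A + R) * R'" using AR pos by (intro mult_right_mono) auto
    then show ?thesis using DR by (simp add: algebra_simps)
  qed
  have A': "A' \<ge> 1/4" using AR' R' d e by linarith
  \<comment> \<open>averaging the loss over the atoms of y yields a point s near which the mass of x is concentrated\<close>
  define I where "I s = (\<Sum>t\<in>F. norm (c t) * (t - s)\<^sup>2)" for s
  have D_eq: "D = (\<Sum>s\<in>F'. norm (c' s) * I s)"
    unfolding D_def I_def by (subst sum.swap) (simp add: sum_distrib_left mult_ac)
  \<comment> \<open>The threshold \<open>12 * d\<close> is the bound \<open>3 * d\<close> for the
    total loss \<open>D\<close> divided by the lower bound \<open>1/4\<close> for the mass
    \<open>A'\<close>.\<close>
  have "\<exists>s\<in>F'. I s \<le> 12 * d"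
  proof (rule ccontr)
    assume no: "\<not> ?thesis"
    have "A' * (12 * d) < D"
    proof -
      have "\<exists>s\<in>F'. norm (c' s) > 0"
      proof (rule ccontr)
        assume "\<not> ?thesis"
        then have "A' = 0" by (auto simp: A'_def mass_def intro!: sum.neutral)
        then show False using A' by simp
      qed
      then obtain s where s: "s \<in> F'" "norm (c' s) > 0" by blast
      then have "norm (c' s) * (12 * d) < norm (c' s) * I s"
        using no by (intro mult_strict_left_mono) (auto simp: not_le)
      moreover have "norm (c' s) * (12 * d) \<le> norm (c' s) * I s" if "s \<in> F'" for s
        using no that by (intro mult_left_mono) (auto simp: not_le)
      moreover have "finite F'" using F' by (simp add: atoms_def)
      ultimately show ?thesis
        unfolding A'_def mass_def D_eq sum_distrib_right using s(1) by (intro sum_strict_mono_ex1) blast+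
    qed
    moreover have "1/4 * (12 * d) \<le> A' * (12 * d)" using A' d by (intro mult_right_mono) auto
    ultimately show False using DR(1) by linarith
  qed
  then obtain s where sF': "s \<in> F'" and I: "I s \<le> 12 * d" by blast
  have s: "s \<in> {0..1}" using sF' F' by (auto simp: atoms_def)
  define J where "J = (\<Sum>t\<in>F. norm (c t) * \<bar>t - s\<bar>)"
  \<comment> \<open>Young's inequality with weight \<open>e\<close> trades the second moment, of
    order \<open>e\<^sup>2\<close>, for a first moment of order \<open>e\<close>, which is what the
    Lipschitz bound of the curve asks for.\<close>
  have "2 * e * J \<le> e\<^sup>2 * A + I s"
  proof -
    have "2 * e * J = (\<Sum>t\<in>F. norm (c t) * (2 * e * \<bar>t - s\<bar>))"
      by (simp add: J_def sum_distrib_left mult_ac)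
    also have "\<dots> \<le> (\<Sum>t\<in>F. norm (c t) * (e\<^sup>2 + (t - s)\<^sup>2))"
    proof (intro sum_mono mult_left_mono)
      fix t
      have "0 \<le> (e - \<bar>t - s\<bar>)\<^sup>2" by simp
      then show "2 * e * \<bar>t - s\<bar> \<le> e\<^sup>2 + (t - s)\<^sup>2" by (simp add: power2_diff)
    qed simp
    also have "\<dots> = e\<^sup>2 * A + I s"
      by (simp add: A_def mass_def I_def sum_distrib_left sum.distrib distrib_left mult_ac)
    finally show ?thesis .
  qed
  also have "\<dots> \<le> e\<^sup>2 * 2 + 12 * e\<^sup>2"
    using I c1 pos d e by (intro add_mono mult_left_mono) (auto simp: d_def)
  finally have "e * J \<le> e * (7 * e)" by (simp add: power2_eq_square algebra_simps)
  then have J: "J \<le> 7 * e" using e by simp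
  define C where "C = (\<Sum>t\<in>F. c t)"
  have Fin: "t \<in> {0..1}" if "t \<in> F" for t using that F by (auto simp: atoms_def)
  have r: "norm (x - comb F c) \<le> R" using M_ge_1 mult_right_mono[of 1 "4 * M" "norm (x - comb F c)"] by (simp add: R_def)
  have 1: "norm (comb F c - scl C (\<gamma> s)) \<le> 2 * J"
  proof -
    have "comb F c - scl C (\<gamma> s) = (\<Sum>t\<in>F. scl (c t) (\<gamma> t - \<gamma> s))"
      by (simp add: comb_def C_def X.scale_sum_left X.scale_right_diff_distrib sum_subtractf)
    also have "norm \<dots> \<le> (\<Sum>t\<in>F. norm (c t) * (2 * \<bar>t - s\<bar>))"
      using curve_lipschitz[OF Fin s] by (intro sum_norm_le) (auto simp: X.norm_scale intro!: mult_left_mono)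
    also have "\<dots> = 2 * J" by (simp add: J_def sum_distrib_left mult_ac)
    finally show ?thesis .
  qed
  \<comment> \<open>The functional \<open>g\<close> returns the coefficient sum \<open>C\<close> of
    the combination, so \<open>C\<close> may be replaced by \<open>g x\<close>, a scalar that
    depends neither on the decomposition nor on \<open>e\<close>.\<close>
  have 2: "norm (scl C (\<gamma> s) - scl (g x) (\<gamma> s)) \<le> 2 * M * R"
  proof -
    have "g (comb F c) = C" unfolding comb_def g_sum C_def by (intro sum.cong) (simp_all add: g_scale g_curve[OF Fin])
    then have "norm (C - g x) \<le> M * norm (x - comb F c)"
      using g_bound[of "x - comb F c"] by (simp add: g_diff norm_minus_commute)
    also have "\<dots> \<le> M * R" using r M_ge_1 by (intro mult_left_mono) auto
    finally have "norm (C - g x) \<le> M * R" .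
    then have "norm (C - g x) * norm (\<gamma> s) \<le> (M * R) * 2"
      using curve_bound[OF s] pos M_ge_1 by (intro mult_mono) auto
    moreover have "norm (scl C (\<gamma> s) - scl (g x) (\<gamma> s)) = norm (C - g x) * norm (\<gamma> s)"
      by (simp add: X.norm_scale flip: X.scale_left_diff_distrib)
    ultimately show ?thesis by simp
  qed
  have "norm (x - scl (g x) (\<gamma> s)) \<le> R + 2 * J + 2 * M * R"
    using norm_triangle_ineq[of "x - comb F c" "comb F c - scl C (\<gamma> s)"]
      norm_triangle_ineq[of "x - scl C (\<gamma> s)" "scl C (\<gamma> s) - scl (g x) (\<gamma> s)"] r 1 2 by simp
  also have "\<dots> \<le> M * e + 14 * (M * e) + 2 * (M * e)"
  proof -
    have "R \<le> e" using R d by linarith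
    then have "M * R \<le> M * e" "R \<le> M * e" "J \<le> 7 * (M * e)"
      using M_ge_1 J e mult_right_mono[of 1 M e] by (auto intro: mult_left_mono order_trans)
    then show ?thesis by linarith
  qed
  also have "\<dots> \<le> 100 * M * e" using M_ge_1 e by simp
  finally show ?thesis using s by blast
qed

text \<open>By \<open>near_curve\<close>, \<open>x\<close> comes arbitrarily close to one fixed set,
  the curve multiplied by \<open>g x\<close>. This set is a continuous image of a compact interval,
  so the distance is attained and is 0.\<close>

lemma on_curve:
  assumes x: "curve_norm x \<le> 1" and y: "curve_norm y \<le> 1" and xy: "B x y = 1"
  obtains s where "s \<in> {0..1}" "x = scl (g x) (\<gamma> s)"
proof -
  let ?f = "\<lambda>s. norm (x - scl (g x) (\<gamma> s))"
  have "(2 * norm (g x))-lipschitz_on {0..1} (\<lambda>s. scl (g x) (\<gamma> s))"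
  proof (rule lipschitz_onI)
    fix s t :: real assume "s \<in> {0..1}" "t \<in> {0..1}"
    then show "dist (scl (g x) (\<gamma> s)) (scl (g x) (\<gamma> t)) \<le> 2 * norm (g x) * dist s t"
      using mult_left_mono[OF curve_lipschitz, of s t "norm (g x)"]
      by (simp add: dist_norm X.norm_scale flip: X.scale_right_diff_distrib)
  qed simp
  then have "continuous_on {0..1} (\<lambda>s. scl (g x) (\<gamma> s))" by (rule lipschitz_on_continuous_on)
  then have "continuous_on {0..1} ?f" by (intro continuous_intros)
  then obtain s where s: "s \<in> {0..1}" "\<And>t. t \<in> {0..1} \<Longrightarrow> ?f s \<le> ?f t"
    using continuous_attains_inf[of "{0..1::real}" ?f] by auto
  have le: "?f s \<le> 100 * M * e" if "0 < e" "e \<le> 1/100" for e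
    using near_curve[OF assms that] s(2) by (meson order_trans)
  have "?f s = 0"
  proof (rule ccontr)
    assume "?f s \<noteq> 0"
    then have pos: "?f s > 0" by (metis norm_ge_zero order_le_less)
    define e where "e = min (1/100) (?f s / (200 * M))"
    have e: "0 < e" "e \<le> 1/100" "e \<le> ?f s / (200 * M)" using pos M_ge_1 by (auto simp: e_def)
    then have "100 * M * e \<le> 100 * M * (?f s / (200 * M))" using M_ge_1 by (intro mult_left_mono) auto
    also have "\<dots> < ?f s" using pos M_ge_1 by simp
    finally show False using le[OF e(1,2)] by simp
  qed
  then show thesis using s(1) that by simp
qed

text \<open>Both vectors are multiples of curve points by \<open>on_curve\<close> and symmetry. The
  scalars have modulus at most 1, because \<open>B z z\<close> is the square of \<open>g z\<close>;
  hence the factor \<open>1 - (s - t)^2\<close> cannot fall below 1, and the parameters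
  coincide.\<close>

lemma form_attains_only_on_curve:
  assumes x: "curve_norm x \<le> 1" and y: "curve_norm y \<le> 1" and xy: "B x y = 1"
  obtains t a b where "t \<in> {0..1}" "x = scl a (\<gamma> t)" "y = scl b (\<gamma> t)" "a * b = 1"
proof -
  obtain s where s: "s \<in> {0..1}" "x = scl (g x) (\<gamma> s)" using on_curve[OF assms] by blast
  obtain t where t: "t \<in> {0..1}" "y = scl (g y) (\<gamma> t)" using on_curve[OF y x] xy form_commute by metis
  have g1: "norm (g z) \<le> 1" if "curve_norm z \<le> 1" "z = scl (g z) (\<gamma> u)" "u \<in> {0..1}" for z u
  proof -
    have "B z z = B (scl (g z) (\<gamma> u)) (scl (g z) (\<gamma> u))" using that(2) by simp
    also have "\<dots> = (g z)\<^sup>2" using that(3) by (simp add: form_scale form_simps form_curve power2_eq_square)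
    finally have "(norm (g z))\<^sup>2 \<le> curve_norm z * curve_norm z"
      using form_le_curve_norm[of z z] by (simp add: norm_power)
    also have "\<dots> \<le> 1 * 1" using that(1) curve_norm_nonneg by (intro mult_mono) auto
    finally show ?thesis using power2_le_imp_le[of "norm (g z)" 1] by simp
  qed
  have "1 = B (scl (g x) (\<gamma> s)) (scl (g y) (\<gamma> t))" using s(2) t(2) xy by metis
  also have "\<dots> = g x * g y * of_real (1 - (s - t)\<^sup>2)"
    using s(1) t(1) by (simp add: form_scale form_simps form_curve mult_ac)
  finally have eq: "g x * g y * of_real (1 - (s - t)\<^sup>2) = 1" by simp
  have "norm (g x * g y) \<le> 1 * 1"
    unfolding norm_mult using g1[OF x s(2,1)] g1[OF y t(2,1)] by (intro mult_mono) auto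
  moreover have "norm (g x * g y) * \<bar>1 - (s - t)\<^sup>2\<bar> = 1"
    using arg_cong[OF eq, of norm] by (simp only: norm_mult norm_of_real norm_one)
  ultimately have "1 \<le> \<bar>1 - (s - t)\<^sup>2\<bar>"
    by (metis abs_ge_zero mult_1 mult_right_mono)
  moreover have "(s - t)\<^sup>2 \<le> 1" using s(1) t(1) by (auto simp: abs_square_le_1 abs_if)
  ultimately have "s = t" by simp
  then show thesis using that[OF s] t eq by simp
qed

end

section \<open>Measures on the unit interval\<close>

lemma prob01D:
  assumes "\<alpha> \<in> prob01"
  shows "prob_space \<alpha>" "sets \<alpha> = sets (restrict_space borel {0..1})" "space \<alpha> = {0..1}"
    "measurable \<alpha> N = measurable (restrict_space borel {0..1}) N"
proof -
  show 1: "prob_space \<alpha>" "sets \<alpha> = sets (restrict_space borel {0..1})" using assms by (auto simp: prob01_def)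
  show "space \<alpha> = {0..1}" using sets_eq_imp_space_eq[OF 1(2)] by (simp add: space_restrict_space)
  show "measurable \<alpha> N = measurable (restrict_space borel {0..1}) N" by (rule measurable_cong_sets[OF 1(2) refl])
qed

lemma integrable_prob01:
  fixes f :: "real \<Rightarrow> real"
  assumes "\<alpha> \<in> prob01" "f \<in> borel_measurable (restrict_space borel {0..1})" "\<And>t. t \<in> {0..1} \<Longrightarrow> \<bar>f t\<bar> \<le> c"
  shows "integrable \<alpha> f"
proof -
  interpret prob_space \<alpha> using assms(1) by (simp add: prob01_def)
  show ?thesis
    using assms prob01D[OF assms(1)] by (intro integrable_const_bound[of _ c]) auto
qed

lemma integrable_continuous_prob01:
  fixes f :: "real \<Rightarrow> real"
  assumes "\<alpha> \<in> prob01" "continuous_on {0..1} f"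
  shows "integrable \<alpha> f"
proof -
  have "bounded (f ` {0..1})" using assms(2) by (intro compact_imp_bounded compact_continuous_image) auto
  then obtain c where "\<forall>x\<in>f ` {0..1}. \<bar>x\<bar> \<le> c" unfolding bounded_real by blast
  then show ?thesis
    using assms by (intro integrable_prob01[of _ _ c] borel_measurable_continuous_on_restrict) auto
qed

lemma integral_const_prob01: "\<alpha> \<in> prob01 \<Longrightarrow> (\<integral>t. c \<partial>\<alpha>) = (c :: real)"
  using prob01D(1)[of \<alpha>] by (simp add: prob_space.prob_space)

lemma integral_mono_prob01:
  fixes f g :: "real \<Rightarrow> real"
  assumes "\<alpha> \<in> prob01" "integrable \<alpha> f" "integrable \<alpha> g" "\<And>t. t \<in> {0..1} \<Longrightarrow> f t \<le> g t"
  shows "(\<integral>t. f t \<partial>\<alpha>) \<le> (\<integral>t. g t \<partial>\<alpha>)"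
  using assms prob01D(3)[OF assms(1)] by (intro integral_mono) auto

lemma integral_diff_le_prob01:
  fixes f g :: "real \<Rightarrow> real"
  assumes "\<alpha> \<in> prob01" "integrable \<alpha> f" "integrable \<alpha> g" "\<And>t. t \<in> {0..1} \<Longrightarrow> \<bar>f t - g t\<bar> \<le> c"
  shows "\<bar>(\<integral>t. f t \<partial>\<alpha>) - (\<integral>t. g t \<partial>\<alpha>)\<bar> \<le> c"
proof -
  interpret prob_space \<alpha> using assms(1) by (simp add: prob01_def)
  have "f t \<le> g t + c" "g t \<le> f t + c" if "t \<in> {0..1}" for t using assms(4)[OF that] by auto
  then have "(\<integral>t. f t \<partial>\<alpha>) \<le> (\<integral>t. g t + c \<partial>\<alpha>)" "(\<integral>t. g t \<partial>\<alpha>) \<le> (\<integral>t. f t + c \<partial>\<alpha>)"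
    using assms(2,3) by (intro integral_mono_prob01[OF assms(1)]; simp)+
  then show ?thesis using assms(2,3) by (simp add: prob_space)
qed

lemma polynomial_approximation_01:
  fixes f :: "real \<Rightarrow> real"
  assumes "continuous_on {0..1} f" "e > 0"
  obtains a m where "\<And>t. t \<in> {0..1} \<Longrightarrow> \<bar>f t - (\<Sum>i\<le>m. a i * t ^ i)\<bar> < e"
proof -
  obtain g where g: "real_polynomial_function g" "\<And>t. t \<in> {0..1} \<Longrightarrow> \<bar>f t - g t\<bar> < e"
    using Stone_Weierstrass_real_polynomial_function[OF compact_Icc assms] by blast
  obtain a m where g_eq: "g = (\<lambda>x. \<Sum>i\<le>m. a i * x ^ i)" using g(1) real_polynomial_function_iff_sum by blast
  show thesis by (rule that[of a m]) (use g(2) g_eq in simp)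
qed

lemma integral_polynomial_prob01:
  fixes a :: "nat \<Rightarrow> real"
  assumes "\<alpha> \<in> prob01"
  shows "integrable \<alpha> (\<lambda>t. \<Sum>i\<le>m. a i * t ^ i)"
    and "(\<integral>t. (\<Sum>i\<le>m. a i * t ^ i) \<partial>\<alpha>) = (\<Sum>i\<le>m. a i * (\<integral>t. t ^ i \<partial>\<alpha>))"
proof -
  have int: "integrable \<alpha> (\<lambda>t. t ^ i)" for i
    by (intro integrable_continuous_prob01[OF assms] continuous_intros)
  then show "integrable \<alpha> (\<lambda>t. \<Sum>i\<le>m. a i * t ^ i)" by simp
  show "(\<integral>t. (\<Sum>i\<le>m. a i * t ^ i) \<partial>\<alpha>) = (\<Sum>i\<le>m. a i * (\<integral>t. t ^ i \<partial>\<alpha>))"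
    using int by (simp add: Bochner_Integration.integral_sum)
qed

section \<open>Measures and their moments\<close>

lemma integral_eq_if_moments_eq:
  fixes f :: "real \<Rightarrow> real"
  assumes "\<alpha> \<in> prob01" "\<beta> \<in> prob01" "\<And>i. (\<integral>t. t ^ i \<partial>\<alpha>) = (\<integral>t. t ^ i \<partial>\<beta>)" "continuous_on {0..1} f"
  shows "(\<integral>t. f t \<partial>\<alpha>) = (\<integral>t. f t \<partial>\<beta>)"
proof -
  have "\<bar>(\<integral>t. f t \<partial>\<alpha>) - (\<integral>t. f t \<partial>\<beta>)\<bar> \<le> e" if e: "e > 0" for e
  proof -
    obtain a m where am: "\<And>t. t \<in> {0..1} \<Longrightarrow> \<bar>f t - (\<Sum>i\<le>m. a i * t ^ i)\<bar> < e / 2"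
      using polynomial_approximation_01[OF assms(4), of "e / 2"] e by auto
    have *: "\<bar>(\<integral>t. f t \<partial>\<mu>) - (\<Sum>i\<le>m. a i * (\<integral>t. t ^ i \<partial>\<mu>))\<bar> \<le> e / 2" if "\<mu> \<in> prob01" for \<mu>
      unfolding integral_polynomial_prob01(2)[OF that, symmetric]
      by (intro integral_diff_le_prob01[OF that] integrable_continuous_prob01[OF that assms(4)]
          integral_polynomial_prob01(1)[OF that] less_imp_le am)
    show ?thesis using *[OF assms(1), unfolded assms(3)] *[OF assms(2)] unfolding abs_le_iff by argo
  qed
  then show ?thesis using dense_ge[of 0 "\<bar>(\<integral>t. f t \<partial>\<alpha>) - (\<integral>t. f t \<partial>\<beta>)\<bar>"] by simp
qed

text \<open>The integrands are continuous and decrease to the indicator of \<open>F\<close>. This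
  carries information on integrals of continuous functions over to measures of closed sets. The
  empty set is excluded because \<open>infdist t {}\<close> is 0 by convention.\<close>

lemma tendsto_measure_closed:
  assumes \<alpha>: "\<alpha> \<in> prob01" and F: "closed F" "F \<noteq> {}"
  shows "(\<lambda>k. \<integral>t. max 0 (1 - real k * infdist t F) \<partial>\<alpha>) \<longlonglongrightarrow> measure \<alpha> (F \<inter> {0..1})"
proof -
  interpret prob_space \<alpha> using \<alpha> by (simp add: prob01_def)
  note D = prob01D[OF \<alpha>]
  have FA: "F \<inter> {0..1} \<in> sets \<alpha>" using F by (simp add: D sets_restrict_space_iff)
  have "(\<lambda>k. \<integral>t. max 0 (1 - real k * infdist t F) \<partial>\<alpha>) \<longlonglongrightarrow> (\<integral>t. indicator (F \<inter> {0..1}) t \<partial>\<alpha>)"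
  proof (rule integral_dominated_convergence[where w = "\<lambda>_. 1"])
    show "(\<lambda>t. max 0 (1 - real k * infdist t F)) \<in> borel_measurable \<alpha>" for k
      unfolding D by (intro borel_measurable_continuous_on_restrict continuous_intros)
    show "AE t in \<alpha>. norm (max 0 (1 - real k * infdist t F)) \<le> 1" for k
      by (intro AE_I2) (auto intro!: mult_nonneg_nonneg infdist_nonneg)
    show "AE t in \<alpha>. (\<lambda>k. max 0 (1 - real k * infdist t F)) \<longlonglongrightarrow> indicator (F \<inter> {0..1}) t"
    proof (rule AE_I2)
      fix t assume t: "t \<in> space \<alpha>"
      show "(\<lambda>k. max 0 (1 - real k * infdist t F)) \<longlonglongrightarrow> indicator (F \<inter> {0..1}) t"
      proof (cases "t \<in> F")
        case True
        then show ?thesis using t by (simp add: D)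
      next
        case False
        then have d: "infdist t F > 0"
          using F in_closed_iff_infdist_zero[of F t] infdist_nonneg[of t F] by auto
        obtain K where K: "1 < real K * infdist t F" using reals_Archimedean3[OF d] by blast
        have "max 0 (1 - real k * infdist t F) = 0" if "k \<ge> K" for k
        proof -
          have "real K * infdist t F \<le> real k * infdist t F" using that d by (intro mult_right_mono) auto
          then show ?thesis using K by simp
        qed
        then have "\<forall>\<^sub>F k in sequentially. max 0 (1 - real k * infdist t F) = 0"
          by (auto simp: eventually_sequentially)
        then show ?thesis using False by (simp add: tendsto_eventually)
      qed
    qed
  qed (use FA in auto)
  then show ?thesis using FA by simp
qed

text \<open>Moments determine integrals of continuous functions, these determine the measures of
  half-lines, and on the real line the distribution function determines the measure; hence the
  detour through the image measures on \<open>borel\<close>.\<close>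

lemma prob01_eqI:
  assumes \<alpha>: "\<alpha> \<in> prob01" and \<beta>: "\<beta> \<in> prob01"
    and eq: "\<And>i. (\<integral>t. t ^ i \<partial>\<alpha>) = (\<integral>t. t ^ i \<partial>\<beta>)"
  shows "\<alpha> = \<beta>"
proof -
  have id: "(\<lambda>t. t) \<in> measurable \<mu> borel" if "\<mu> \<in> prob01" for \<mu> :: "real measure"
    unfolding prob01D[OF that] by (rule measurable_restrict_space1) simp
  have em: "emeasure (distr \<mu> borel (\<lambda>t. t)) A = emeasure \<mu> (A \<inter> {0..1})" if "\<mu> \<in> prob01" "A \<in> sets borel" for \<mu> A
    using id[OF that(1)] that by (simp add: emeasure_distr prob01D)
  have "(\<lambda>k. \<integral>t. max 0 (1 - real k * infdist t {..x}) \<partial>\<alpha>) = (\<lambda>k. \<integral>t. max 0 (1 - real k * infdist t {..x}) \<partial>\<beta>)" for x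
    by (intro ext integral_eq_if_moments_eq[OF \<alpha> \<beta> eq] continuous_intros)
  then have meq: "measure \<alpha> ({..x} \<inter> {0..1}) = measure \<beta> ({..x} \<inter> {0..1})" for x
    using LIMSEQ_unique[OF tendsto_measure_closed[OF \<alpha>, of "{..x}"]] tendsto_measure_closed[OF \<beta>, of "{..x}"]
    by auto
  have "distr \<alpha> borel (\<lambda>t. t) = distr \<beta> borel (\<lambda>t. t)"
  proof (rule cdf_unique)
    show "real_distribution (distr \<alpha> borel (\<lambda>t. t))" "real_distribution (distr \<beta> borel (\<lambda>t. t))"
      using prob_space.real_distribution_distr prob01D(1) id \<alpha> \<beta> by blast+
    show "cdf (distr \<alpha> borel (\<lambda>t. t)) = cdf (distr \<beta> borel (\<lambda>t. t))"
      using meq em[OF \<alpha>] em[OF \<beta>] by (simp add: cdf_def fun_eq_iff measure_def)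
  qed
  show ?thesis
  proof (rule measure_eqI)
    show "sets \<alpha> = sets \<beta>" using \<alpha> \<beta> by (simp add: prob01D)
    fix A assume "A \<in> sets \<alpha>"
    then have A: "A \<in> sets borel" "A \<subseteq> {0..1}" using \<alpha> by (auto simp: prob01D sets_restrict_space_iff)
    then have "A \<inter> {0..1} = A" by blast
    then show "emeasure \<alpha> A = emeasure \<beta> A"
      using em[OF \<alpha> A(1)] em[OF \<beta> A(1)] \<open>distr \<alpha> borel (\<lambda>t. t) = distr \<beta> borel (\<lambda>t. t)\<close> by simp
  qed
qed

text \<open>The moments are those of a sum of point masses, but a one-sided comparison is enough:
  partial sums of \<open>l n * f (t n)\<close> stay below the integral of a continuous
  \<open>f \<ge> 0\<close>. With \<open>f\<close> shrinking to the indicator of finitely many of the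
  points, these points carry at least their share of \<open>l\<close>, and all shares add up to
  1.\<close>

lemma countably_supported_if_moments_eq:
  fixes l t :: "nat \<Rightarrow> real"
  assumes \<alpha>: "\<alpha> \<in> prob01" and l: "\<And>n. 0 \<le> l n" "l sums 1" and t: "\<And>n. t n \<in> {0..1}"
    and mom: "\<And>i. (\<lambda>n. l n * t n ^ i) sums (\<integral>x. x ^ i \<partial>\<alpha>)"
  shows "countably_supported \<alpha>"
proof -
  interpret prob_space \<alpha> using \<alpha> by (simp add: prob01_def)
  note D = prob01D[OF \<alpha>]
  have lsum: "summable l" "suminf l = 1" using l(2) by (auto simp: sums_iff)
  have f: "(\<Sum>n<m. l n * f (t n)) \<le> (\<integral>x. f x \<partial>\<alpha>)"
    if cont: "continuous_on {0..1} f" and f: "\<And>x. x \<in> {0..1} \<Longrightarrow> 0 \<le> f x" for f :: "real \<Rightarrow> real" and m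
  proof (rule field_le_epsilon)
    fix e :: real assume "e > 0"
    then have e2: "e / 2 > 0" by simp
    obtain a N where am: "\<And>x. x \<in> {0..1} \<Longrightarrow> \<bar>f x - (\<Sum>i\<le>N. a i * x ^ i)\<bar> < e / 2"
      using polynomial_approximation_01[OF cont e2] by blast
    let ?p = "\<lambda>x. \<Sum>i\<le>N. a i * x ^ i"
    have "(\<lambda>n. \<Sum>i\<le>N. a i * (l n * t n ^ i)) sums (\<Sum>i\<le>N. a i * (\<integral>x. x ^ i \<partial>\<alpha>))"
      by (intro sums_sum sums_mult mom)
    then have ps: "(\<lambda>n. l n * ?p (t n)) sums (\<integral>x. ?p x \<partial>\<alpha>)"
      by (simp add: integral_polynomial_prob01(2)[OF \<alpha>] sum_distrib_left mult_ac)
    have sm: "(\<lambda>n. l n * ?p (t n) + l n * (e / 2)) sums ((\<integral>x. ?p x \<partial>\<alpha>) + 1 * (e / 2))"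
      by (intro sums_add ps sums_mult2 l(2))
    have le: "l n * f (t n) \<le> l n * ?p (t n) + l n * (e / 2)" for n
    proof -
      have "f (t n) \<le> ?p (t n) + e / 2" using am[OF t[of n]] unfolding abs_less_iff by argo
      then show ?thesis using mult_left_mono[OF _ l(1)[of n]] by (simp only: distrib_left[symmetric])
    qed
    have "(\<Sum>n<m. l n * f (t n)) \<le> (\<Sum>n<m. l n * ?p (t n) + l n * (e / 2))" by (intro sum_mono le)
    \<comment> \<open>The terms dominate \<open>l n * f (t n) \<ge> 0\<close>, so a partial sum is
      at most the full series, which the moments evaluate.\<close>
    also have "\<dots> \<le> (\<integral>x. ?p x \<partial>\<alpha>) + 1 * (e / 2)"
      unfolding sums_unique[OF sm]
      by (intro sum_le_suminf sums_summable[OF sm] ballI order_trans[OF mult_nonneg_nonneg[OF l(1) f[OF t]] le]) simp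
    also have "(\<integral>x. ?p x \<partial>\<alpha>) \<le> (\<integral>x. f x \<partial>\<alpha>) + e / 2"
    proof -
      have "\<bar>(\<integral>x. f x \<partial>\<alpha>) - (\<integral>x. ?p x \<partial>\<alpha>)\<bar> \<le> e / 2"
        using am by (intro integral_diff_le_prob01[OF \<alpha>] integrable_continuous_prob01[OF \<alpha> cont]
            integral_polynomial_prob01(1)[OF \<alpha>] less_imp_le) blast
      then show ?thesis unfolding abs_le_iff by argo
    qed
    finally show "(\<Sum>n<m. l n * f (t n)) \<le> (\<integral>x. f x \<partial>\<alpha>) + e" by simp
  qed
  have T: "A \<in> sets \<alpha>" if "countable A" "A \<subseteq> {0..1}" for A
    using that sets.countable[of A borel] by (auto simp: D sets_restrict_space_iff)
  have rng: "range t \<in> sets \<alpha>" using t by (intro T) auto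
  \<comment> \<open>Finite initial pieces of the sequence are closed, whereas the range of
    \<open>t\<close> need not be; \<open>Suc m\<close> keeps them nonempty.\<close>
  have "(\<Sum>n<Suc m. l n) \<le> measure \<alpha> (range t)" for m
  proof -
    let ?F = "t ` {..<Suc m}"
    have FT: "?F \<inter> {0..1} = ?F" using t by auto
    have "(\<Sum>n<Suc m. l n) \<le> (\<integral>x. max 0 (1 - real k * infdist x ?F) \<partial>\<alpha>)" for k
    proof -
      have "(\<Sum>n<Suc m. l n) = (\<Sum>n<Suc m. l n * max 0 (1 - real k * infdist (t n) ?F))"
        by (intro sum.cong refl) simp
      also have "\<dots> \<le> (\<integral>x. max 0 (1 - real k * infdist x ?F) \<partial>\<alpha>)"
        by (intro f continuous_intros) auto
      finally show ?thesis .
    qed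
    then have "(\<Sum>n<Suc m. l n) \<le> measure \<alpha> (?F \<inter> {0..1})"
      by (intro LIMSEQ_le_const[OF tendsto_measure_closed[OF \<alpha>]]) (auto intro: finite_imp_closed)
    also have "\<dots> \<le> measure \<alpha> (range t)" unfolding FT using rng by (intro finite_measure_mono) auto
    finally show ?thesis .
  qed
  moreover have "(\<lambda>m. \<Sum>n<Suc m. l n) \<longlonglongrightarrow> 1" using l(2) LIMSEQ_Suc by (fastforce simp: sums_def)
  ultimately have "1 \<le> measure \<alpha> (range t)" by (intro LIMSEQ_le_const2) auto
  then have "measure \<alpha> (range t) = 1" using prob_le_1 by (meson antisym)
  then have "measure \<alpha> ({0..1} - range t) = 0" using prob_compl[OF rng] by (simp add: D)
  then have "emeasure \<alpha> ({0..1} - range t) = 0" by (simp add: emeasure_eq_measure)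
  then show ?thesis using t unfolding countably_supported_def by (intro exI[of _ "range t"]) auto
qed

section \<open>Fine partitions of unity\<close>

text \<open>A partition of unity with a sample point \<open>s i\<close> for each part, at distance
  at most \<open>d\<close> from wherever the part is nonzero. Only measurability is demanded, so
  that continuous and discontinuous partitions can be compared with one another.\<close>

definition fine_partition :: "real \<Rightarrow> 'i set \<Rightarrow> ('i \<Rightarrow> real \<Rightarrow> real) \<Rightarrow> ('i \<Rightarrow> real) \<Rightarrow> bool" where
  "fine_partition d I \<phi> s \<longleftrightarrow> finite I \<and>
     (\<forall>i\<in>I. s i \<in> {0..1} \<and> \<phi> i \<in> borel_measurable (restrict_space borel {0..1}) \<and>
        (\<forall>t\<in>{0..1}. 0 \<le> \<phi> i t \<and> (\<phi> i t \<noteq> 0 \<longrightarrow> \<bar>t - s i\<bar> \<le> d))) \<and>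
     (\<forall>t\<in>{0..1}. (\<Sum>i\<in>I. \<phi> i t) = 1)"

lemma fine_partitionD:
  assumes "fine_partition d I \<phi> s"
  shows "finite I" "i \<in> I \<Longrightarrow> s i \<in> {0..1}" "i \<in> I \<Longrightarrow> \<phi> i \<in> borel_measurable (restrict_space borel {0..1})"
    "i \<in> I \<Longrightarrow> t \<in> {0..1} \<Longrightarrow> 0 \<le> \<phi> i t" "i \<in> I \<Longrightarrow> t \<in> {0..1} \<Longrightarrow> \<phi> i t \<noteq> 0 \<Longrightarrow> \<bar>t - s i\<bar> \<le> d"
    "t \<in> {0..1} \<Longrightarrow> (\<Sum>i\<in>I. \<phi> i t) = 1" "i \<in> I \<Longrightarrow> t \<in> {0..1} \<Longrightarrow> \<phi> i t \<le> 1"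
proof -
  show 1: "finite I" "i \<in> I \<Longrightarrow> s i \<in> {0..1}" "i \<in> I \<Longrightarrow> \<phi> i \<in> borel_measurable (restrict_space borel {0..1})"
    "i \<in> I \<Longrightarrow> t \<in> {0..1} \<Longrightarrow> 0 \<le> \<phi> i t" "i \<in> I \<Longrightarrow> t \<in> {0..1} \<Longrightarrow> \<phi> i t \<noteq> 0 \<Longrightarrow> \<bar>t - s i\<bar> \<le> d"
    "t \<in> {0..1} \<Longrightarrow> (\<Sum>i\<in>I. \<phi> i t) = 1" for i t
    using assms by (auto simp: fine_partition_def)
  show "i \<in> I \<Longrightarrow> t \<in> {0..1} \<Longrightarrow> \<phi> i t \<le> 1"
    using member_le_sum[of i I "\<lambda>i. \<phi> i t"] 1 by auto
qed

lemma fine_partition_integrable: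
  assumes "\<alpha> \<in> prob01" "fine_partition d I \<phi> s" "i \<in> I"
  shows "integrable \<alpha> (\<phi> i)" and "0 \<le> (\<integral>t. \<phi> i t \<partial>\<alpha>)"
proof -
  note P = fine_partitionD[OF assms(2)]
  show "integrable \<alpha> (\<phi> i)"
    using P(3,4,7)[OF assms(3)] by (intro integrable_prob01[OF assms(1), of _ 1]) auto
  show "0 \<le> (\<integral>t. \<phi> i t \<partial>\<alpha>)"
    using P(4)[OF assms(3)] prob01D(3)[OF assms(1)] by (intro Bochner_Integration.integral_nonneg) auto
qed

lemma fine_partition_integral_sum:
  assumes "\<alpha> \<in> prob01" "fine_partition d I \<phi> s"
  shows "(\<Sum>i\<in>I. \<integral>t. \<phi> i t \<partial>\<alpha>) = 1"
proof -
  have "(\<Sum>i\<in>I. \<integral>t. \<phi> i t \<partial>\<alpha>) = (\<integral>t. (\<Sum>i\<in>I. \<phi> i t) \<partial>\<alpha>)"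
    using fine_partition_integrable[OF assms] by (simp add: Bochner_Integration.integral_sum)
  also have "\<dots> = (\<integral>t. 1 \<partial>\<alpha>)"
    using fine_partitionD(6)[OF assms(2)] prob01D(3)[OF assms(1)] by (intro Bochner_Integration.integral_cong) auto
  also have "\<dots> = 1" by (rule integral_const_prob01[OF assms(1)])
  finally show ?thesis .
qed

lemma fine_partition_integrable_mult:
  assumes \<alpha>: "\<alpha> \<in> prob01" and P: "fine_partition d I \<phi> s" "i \<in> I" and Q: "fine_partition d' J \<psi> r" "j \<in> J"
  shows "integrable \<alpha> (\<lambda>t. \<phi> i t * \<psi> j t)"
proof (rule integrable_prob01[OF \<alpha>, of _ 1])
  show "(\<lambda>t. \<phi> i t * \<psi> j t) \<in> borel_measurable (restrict_space borel {0..1})"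
    using fine_partitionD(3)[OF P(1) P(2)] fine_partitionD(3)[OF Q(1) Q(2)] by measurable
  show "\<bar>\<phi> i t * \<psi> j t\<bar> \<le> 1" if "t \<in> {0..1}" for t
    using fine_partitionD(4,7)[OF P(1) P(2) that] fine_partitionD(4,7)[OF Q(1) Q(2) that]
    by (simp add: abs_mult mult_le_one)
qed

text \<open>The products of the parts of two partitions form a common refinement.\<close>

lemma fine_partition_refine:
  assumes \<alpha>: "\<alpha> \<in> prob01" and P: "fine_partition d I \<phi> s" "i \<in> I" and Q: "fine_partition d' J \<psi> r"
  shows "(\<integral>t. \<phi> i t \<partial>\<alpha>) = (\<Sum>j\<in>J. \<integral>t. \<phi> i t * \<psi> j t \<partial>\<alpha>)"
proof -
  have "(\<Sum>j\<in>J. \<integral>t. \<phi> i t * \<psi> j t \<partial>\<alpha>) = (\<integral>t. (\<Sum>j\<in>J. \<phi> i t * \<psi> j t) \<partial>\<alpha>)"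
    using fine_partition_integrable_mult[OF assms] by (simp add: Bochner_Integration.integral_sum)
  also have "\<dots> = (\<integral>t. \<phi> i t \<partial>\<alpha>)"
    using fine_partitionD(6)[OF Q] prob01D(3)[OF \<alpha>]
    by (intro Bochner_Integration.integral_cong) (auto simp flip: sum_distrib_left)
  finally show ?thesis by simp
qed

section \<open>Three concrete partitions of the unit interval\<close>

text \<open>Hat functions make the approximating sums weak-star continuous in the measure, cells make them
  integrals of simple functions.\<close>

definition hat :: "nat \<Rightarrow> nat \<Rightarrow> real \<Rightarrow> real" where
  "hat n i t = max 0 (1 - \<bar>real n * t - real i\<bar>)"

lemma hat_partition:
  assumes "n > 0"
  shows "fine_partition (1 / n) {..n} (hat n) (\<lambda>i. i / n)"
  unfolding fine_partition_def
proof (intro conjI ballI)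
  fix i
  show "hat n i \<in> borel_measurable (restrict_space borel {0..1})"
    unfolding hat_def[abs_def] by (intro borel_measurable_continuous_on_restrict continuous_intros)
next
  fix i t assume t: "t \<in> {0..1::real}"
  show "0 \<le> hat n i t" by (simp add: hat_def)
  show "hat n i t \<noteq> 0 \<longrightarrow> \<bar>t - i / n\<bar> \<le> 1 / n"
  proof
    assume "hat n i t \<noteq> 0"
    then have "\<bar>real n * t - real i\<bar> \<le> 1" by (auto simp: hat_def max_def split: if_splits)
    moreover have "real n * t - real i = real n * (t - i / n)" using assms by (simp add: field_simps)
    ultimately have "real n * \<bar>t - i / n\<bar> \<le> 1" by (simp add: abs_mult)
    then show "\<bar>t - i / n\<bar> \<le> 1 / n" using assms by (simp add: field_simps)
  qed
next
  fix t assume t: "t \<in> {0..1::real}"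
  \<comment> \<open>The cap \<open>n - 1\<close> matters only at \<open>t = 1\<close>, where the
    floor is \<open>n\<close> and the index \<open>Suc k\<close> would leave
    \<open>{..n}\<close>.\<close>
  define k where "k = min (nat \<lfloor>real n * t\<rfloor>) (n - 1)"
  have nt: "0 \<le> real n * t" "real n * t \<le> real n" using t by (auto simp: mult_left_le)
  have k: "k < n" "real k \<le> real n * t" "real n * t \<le> real k + 1"
  proof -
    show "k < n" using assms by (simp add: k_def)
    have fl: "real (nat \<lfloor>real n * t\<rfloor>) = of_int \<lfloor>real n * t\<rfloor>" using nt by simp
    show "real k \<le> real n * t" 
    proof -
      have "real k \<le> real (nat \<lfloor>real n * t\<rfloor>)" by (simp add: k_def)
      then show ?thesis using fl of_int_floor_le[of "real n * t"] by linarith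
    qed
    show "real n * t \<le> real k + 1"
      using fl floor_correct[of "real n * t"] nt assms by (auto simp: k_def min_def of_nat_diff)
  qed
  have "(\<Sum>i\<in>{..n}. hat n i t) = (\<Sum>i\<in>{k, Suc k}. hat n i t)"
  proof (rule sum.mono_neutral_right)
    show "\<forall>i\<in>{..n} - {k, Suc k}. hat n i t = 0"
    proof
      fix i assume "i \<in> {..n} - {k, Suc k}"
      then consider "i + 1 \<le> k" | "k + 2 \<le> i" by fastforce
      then show "hat n i t = 0"
      proof cases
        case 1
        then have "real i + 1 \<le> real k" by linarith
        then show ?thesis using k by (simp add: hat_def)
      next
        case 2
        then have "real k + 2 \<le> real i" by linarith
        then show ?thesis using k by (simp add: hat_def)
      qed
    qed
  qed (use k in auto)
  also have "\<dots> = 1" using k by (simp add: hat_def)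
  finally show "(\<Sum>i\<in>{..n}. hat n i t) = 1" .
qed (use assms in auto)

text \<open>For \<open>n > 0\<close>, inside the unit interval, this is the half-open interval from
  \<open>i / n\<close> to \<open>(i + 1) / n\<close>. The last cell \<open>i = n\<close> meets the
  unit interval only in the point 1, which is why the index runs over \<open>{..n}\<close>.\<close>

definition cell :: "nat \<Rightarrow> nat \<Rightarrow> real set" where
  "cell n i = {t. nat \<lfloor>real n * t\<rfloor> = i}"

lemma cell_measurable: "cell n i \<in> sets borel"
proof -
  have "(\<lambda>t. nat \<lfloor>real n * t\<rfloor>) -` {i} \<inter> space borel \<in> sets borel"
    by (rule measurable_sets[of _ _ "count_space UNIV"]) (auto intro: measurable_compose[OF _ measurable_real_floor])
  then show ?thesis by (simp add: cell_def vimage_def)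
qed

lemma cell_bound:
  assumes "n > 0" "t \<in> {0..1}" "t \<in> cell n i"
  shows "i \<le> n" "\<bar>t - i / n\<bar> \<le> 1 / n"
proof -
  have nt: "0 \<le> real n * t" "real n * t \<le> real n" using assms(2) by (auto simp: mult_left_le)
  have i: "real i = of_int \<lfloor>real n * t\<rfloor>" using assms(3) nt by (auto simp: cell_def)
  have 1: "real i \<le> real n * t" "real n * t \<le> real i + 1"
    unfolding i using floor_correct[of "real n * t"] by linarith+
  then have "real i \<le> real n" using nt by linarith
  then show "i \<le> n" by simp
  have "real n * \<bar>t - i / n\<bar> = \<bar>real n * t - real i\<bar>"
    using assms(1) by (simp add: abs_mult_pos' right_diff_distrib)
  also have "\<dots> \<le> 1" using 1 by (simp add: abs_le_iff)
  finally show "\<bar>t - i / n\<bar> \<le> 1 / n" using assms(1) by (simp add: field_simps)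
qed

lemma cell_partition:
  assumes "n > 0"
  shows "fine_partition (1 / n) {..n} (\<lambda>i. indicator (cell n i)) (\<lambda>i. i / n)"
  unfolding fine_partition_def
proof (intro conjI ballI)
  fix i
  show "(indicator (cell n i) :: real \<Rightarrow> real) \<in> borel_measurable (restrict_space borel {0..1})"
    using cell_measurable by (intro measurable_restrict_space1 borel_measurable_indicator)
next
  fix i t assume t: "t \<in> {0..1::real}"
  show "(indicator (cell n i) t :: real) \<noteq> 0 \<longrightarrow> \<bar>t - i / n\<bar> \<le> 1 / n"
    using cell_bound(2)[OF assms t] by (auto simp: indicator_def)
next
  fix t assume t: "t \<in> {0..1::real}"
  let ?k = "nat \<lfloor>real n * t\<rfloor>"
  have "?k \<le> n" using cell_bound(1)[OF assms t] by (simp add: cell_def)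
  then have "(\<Sum>i\<in>{..n}. indicator (cell n i) t) = (\<Sum>i\<in>{?k}. indicator (cell n i) t :: real)"
    by (intro sum.mono_neutral_right) (auto simp: cell_def indicator_def)
  then show "(\<Sum>i\<in>{..n}. indicator (cell n i) t) = (1 :: real)" by (simp add: cell_def)
qed (use assms in auto)

text \<open>Every point of \<open>F\<close> becomes a part of its own whose sample point is exact;
  the cells serve for the rest. Sums over this partition therefore separate chosen atoms from the
  remaining mass without error on the atoms.\<close>

lemma atoms_partition:
  assumes "n > 0" and F: "finite F" "F \<subseteq> {0..1}"
  shows "fine_partition (1 / n) (F <+> {..n})
    (case_sum (\<lambda>a. indicator {a}) (\<lambda>i. indicator (cell n i - F))) (case_sum (\<lambda>a. a) (\<lambda>i. i / n))"
  unfolding fine_partition_def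
proof (intro conjI ballI)
  fix z assume z: "z \<in> F <+> {..n}"
  let ?\<phi> = "case_sum (\<lambda>a. indicator {a}) (\<lambda>i. indicator (cell n i - F)) :: _ \<Rightarrow> real \<Rightarrow> real"
  have "F \<in> sets borel" using F(1) by (intro borel_closed finite_imp_closed)
  then have "cell n i - F \<in> sets borel" for i using cell_measurable by blast
  then show "?\<phi> z \<in> borel_measurable (restrict_space borel {0..1})"
    by (intro measurable_restrict_space1) (auto split: sum.split intro!: borel_measurable_indicator)
  show "case_sum (\<lambda>a. a) (\<lambda>i. i / n) z \<in> {0..1}" using z F(2) assms(1) by auto
  fix t assume t: "t \<in> {0..1::real}"
  show "0 \<le> ?\<phi> z t" by (simp split: sum.split)
  show "?\<phi> z t \<noteq> 0 \<longrightarrow> \<bar>t - case_sum (\<lambda>a. a) (\<lambda>i. i / n) z\<bar> \<le> 1 / n"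
    using cell_bound(2)[OF assms(1) t] by (auto split: sum.split simp: indicator_def)
next
  fix t assume t: "t \<in> {0..1::real}"
  have 1: "(\<Sum>i\<le>n. indicator (cell n i) t :: real) = 1" using fine_partitionD(6)[OF cell_partition[OF assms(1)] t] .
  have 2: "(\<Sum>i\<le>n. indicator (cell n i - F) t :: real) = indicator (- F) t"
    using 1 by (cases "t \<in> F") (simp_all add: indicator_def)
  have 3: "(\<Sum>a\<in>F. indicator {a} t :: real) = indicator F t"
    using F(1) by (simp add: indicator_def sum.delta eq_commute[of t])
  show "(\<Sum>z\<in>F <+> {..n}. case_sum (\<lambda>a. indicator {a}) (\<lambda>i. indicator (cell n i - F)) z t) = (1 :: real)"
    using F(1) 2 3 by (simp add: sum.Plus) (simp add: indicator_def)
qed (use F in auto)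

section \<open>Integration along a curve in a Banach space\<close>

lemma le_if_le_plus_over_n:
  fixes x y c :: real
  assumes "\<And>n. (0::nat) < n \<Longrightarrow> x \<le> y + c / real n"
  shows "x \<le> y"
proof (rule LIMSEQ_le_const)
  show "(\<lambda>n. y + c * (1 / real (Suc n))) \<longlonglongrightarrow> y"
    using tendsto_add[OF tendsto_const tendsto_mult[OF tendsto_const LIMSEQ_Suc[OF lim_1_over_n]], of y c] by simp
  show "\<exists>N. \<forall>n\<ge>N. x \<le> y + c * (1 / real (Suc n))"
    using assms[of "Suc _"] by (simp del: of_nat_Suc)
qed

locale curve_in_banach = banach_space_on sW W q
  for sW :: "'k::real_normed_field \<Rightarrow> 'w::ab_group_add \<Rightarrow> 'w" and W q +
  fixes v :: "real \<Rightarrow> 'w" and C :: real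
  assumes v_in: "t \<in> {0..1} \<Longrightarrow> v t \<in> W" and v_bound: "t \<in> {0..1} \<Longrightarrow> q (v t) \<le> 1"
    and v_lipschitz: "s \<in> {0..1} \<Longrightarrow> t \<in> {0..1} \<Longrightarrow> q (v s - v t) \<le> C * \<bar>s - t\<bar>"
    and C_nonneg: "0 \<le> C"
begin

abbreviation rs :: "real \<Rightarrow> 'w \<Rightarrow> 'w" where
  "rs r \<equiv> sW (of_real r)"

lemmas W_closed = subspace_diff[OF subspace_V] subspace_add[OF subspace_V] subspace_scale[OF subspace_V]
  subspace_0[OF subspace_V] subspace_sum[OF subspace_V] subspace_neg[OF subspace_V]

lemmas q_nonneg = norm_nonneg_on[OF normed_space_on_axioms]
  and q_diff_commute = norm_diff_commute[OF normed_space_on_axioms]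
  and q_diff_triangle = norm_diff_triangle[OF normed_space_on_axioms]

lemma q_0: "q 0 = 0"
  using norm_eq_0_iff[of 0] W_closed by simp

lemma q_rs: "x \<in> W \<Longrightarrow> q (rs r x) = \<bar>r\<bar> * q x"
  by (simp add: norm_scale)

lemma q_sum_le:
  assumes "finite I" "\<And>i. i \<in> I \<Longrightarrow> f i \<in> W" "\<And>i. i \<in> I \<Longrightarrow> q (f i) \<le> b i"
  shows "q (\<Sum>i\<in>I. f i) \<le> (\<Sum>i\<in>I. b i)"
  using assms
proof (induction I rule: finite_induct)
  case empty
  then show ?case by (simp add: q_0)
next
  case (insert i I)
  have "q (f i + (\<Sum>i\<in>I. f i)) \<le> q (f i) + q (\<Sum>i\<in>I. f i)"
    using insert by (intro norm_triangle W_closed) auto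
  also have "\<dots> \<le> b i + (\<Sum>i\<in>I. b i)" using insert by (intro add_mono) auto
  finally show ?case using insert by simp
qed

text \<open>A Riemann sum for the integral of \<open>v\<close> against \<open>\<alpha>\<close>, with
  a partition of unity in place of subintervals.\<close>

definition psum :: "real measure \<Rightarrow> 'i set \<Rightarrow> ('i \<Rightarrow> real \<Rightarrow> real) \<Rightarrow> ('i \<Rightarrow> real) \<Rightarrow> 'w" where
  "psum \<alpha> I \<phi> s = (\<Sum>i\<in>I. rs (\<integral>t. \<phi> i t \<partial>\<alpha>) (v (s i)))"

lemma psum_in:
  assumes "fine_partition d I \<phi> s"
  shows "psum \<alpha> I \<phi> s \<in> W"
  unfolding psum_def using fine_partitionD(2)[OF assms] v_in by (intro W_closed) auto

text \<open>Both sums are rewritten over the common refinement with weights \<open>a i j\<close> of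
  total 1. A weight can be nonzero only if the two parts overlap, and then their sample points are
  at most \<open>d + d'\<close> apart.\<close>

lemma psum_diff:
  assumes \<alpha>: "\<alpha> \<in> prob01" and P: "fine_partition d I \<phi> s" and Q: "fine_partition d' J \<psi> r"
  shows "q (psum \<alpha> I \<phi> s - psum \<alpha> J \<psi> r) \<le> C * (d + d')"
proof -
  define a where "a i j = (\<integral>t. \<phi> i t * \<psi> j t \<partial>\<alpha>)" for i j
  note PD = fine_partitionD[OF P] and QD = fine_partitionD[OF Q]
  have 1: "psum \<alpha> I \<phi> s = (\<Sum>i\<in>I. \<Sum>j\<in>J. rs (a i j) (v (s i)))"
    unfolding psum_def
    by (intro sum.cong refl) (simp add: fine_partition_refine[OF \<alpha> P _ Q] a_def scale_sum_left)
  have "psum \<alpha> J \<psi> r = (\<Sum>j\<in>J. \<Sum>i\<in>I. rs (a i j) (v (r j)))"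
    unfolding psum_def
    by (intro sum.cong refl) (simp add: fine_partition_refine[OF \<alpha> Q _ P] a_def scale_sum_left mult.commute)
  then have 2: "psum \<alpha> J \<psi> r = (\<Sum>i\<in>I. \<Sum>j\<in>J. rs (a i j) (v (r j)))" by (simp add: sum.swap[of _ J])
  have "q (psum \<alpha> I \<phi> s - psum \<alpha> J \<psi> r) = q (\<Sum>i\<in>I. \<Sum>j\<in>J. rs (a i j) (v (s i) - v (r j)))"
    by (simp add: 1 2 sum_subtractf scale_right_diff_distrib)
  also have "\<dots> \<le> (\<Sum>i\<in>I. \<Sum>j\<in>J. a i j * (C * (d + d')))"
  proof (intro q_sum_le)
    fix i j assume ij: "i \<in> I" "j \<in> J"
    have sr: "s i \<in> {0..1}" "r j \<in> {0..1}" using PD(2) QD(2) ij by auto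
    then have in_W: "v (s i) - v (r j) \<in> W" using v_in by (intro W_closed)
    then show "rs (a i j) (v (s i) - v (r j)) \<in> W" by (rule W_closed(3))
    have nn: "0 \<le> a i j"
      unfolding a_def using PD(4)[OF ij(1)] QD(4)[OF ij(2)] prob01D(3)[OF \<alpha>]
      by (intro Bochner_Integration.integral_nonneg) auto
    show "q (rs (a i j) (v (s i) - v (r j))) \<le> a i j * (C * (d + d'))"
    proof (cases "\<exists>t\<in>{0..1}. \<phi> i t * \<psi> j t \<noteq> 0")
      case True
      then obtain t where t: "t \<in> {0..1}" "\<phi> i t \<noteq> 0" "\<psi> j t \<noteq> 0" by auto
      then have "\<bar>s i - r j\<bar> \<le> d + d'" using PD(5)[OF ij(1) t(1)] QD(5)[OF ij(2) t(1)] by linarith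
      then have "q (v (s i) - v (r j)) \<le> C * (d + d')"
        using v_lipschitz[OF sr] mult_left_mono[OF _ C_nonneg] by (meson order_trans)
      then show ?thesis using nn by (simp add: q_rs[OF in_W] mult_left_mono)
    next
      case False
      then have "a i j = (\<integral>t. 0 \<partial>\<alpha>)"
        unfolding a_def using prob01D(3)[OF \<alpha>] by (intro Bochner_Integration.integral_cong) auto
      then show ?thesis by (simp add: q_0)
    qed
  qed (use PD(1,2) QD(1,2) v_in in \<open>auto intro!: W_closed\<close>)
  also have "\<dots> = (\<Sum>i\<in>I. (\<integral>t. \<phi> i t \<partial>\<alpha>) * (C * (d + d')))"
    by (intro sum.cong refl) (simp add: fine_partition_refine[OF \<alpha> P _ Q] a_def sum_distrib_right)
  also have "\<dots> = C * (d + d')"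
    by (simp add: fine_partition_integral_sum[OF \<alpha> P] flip: sum_distrib_right)
  finally show ?thesis .
qed

lemma psum_le_1:
  assumes \<alpha>: "\<alpha> \<in> prob01" and P: "fine_partition d I \<phi> s"
  shows "q (psum \<alpha> I \<phi> s) \<le> 1"
proof -
  have "q (psum \<alpha> I \<phi> s) \<le> (\<Sum>i\<in>I. (\<integral>t. \<phi> i t \<partial>\<alpha>) * 1)"
    unfolding psum_def
  proof (rule q_sum_le)
    fix i assume i: "i \<in> I"
    have s: "s i \<in> {0..1}" using fine_partitionD(2)[OF P i] .
    then show "rs (\<integral>t. \<phi> i t \<partial>\<alpha>) (v (s i)) \<in> W" by (intro W_closed v_in)
    show "q (rs (\<integral>t. \<phi> i t \<partial>\<alpha>) (v (s i))) \<le> (\<integral>t. \<phi> i t \<partial>\<alpha>) * 1"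
      using fine_partition_integrable(2)[OF \<alpha> P i] v_bound[OF s] v_in[OF s]
      by (simp add: q_rs mult_left_le)
  qed (rule fine_partitionD(1)[OF P])
  then show ?thesis using fine_partition_integral_sum[OF \<alpha> P] by simp
qed

section \<open>The vector integral and its approximations\<close>

definition hat_sum :: "real measure \<Rightarrow> nat \<Rightarrow> 'w" where
  "hat_sum \<alpha> n = psum \<alpha> {..n} (hat n) (\<lambda>i. i / n)"

definition cell_sum :: "real measure \<Rightarrow> nat \<Rightarrow> 'w" where
  "cell_sum \<alpha> n = psum \<alpha> {..n} (\<lambda>i. indicator (cell n i)) (\<lambda>i. i / n)"

text \<open>The integral of \<open>v\<close> against \<open>\<alpha>\<close>, chosen by its rate of
  approximation; letting \<open>n\<close> grow shows that at most one vector satisfies the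
  estimate.\<close>

definition vint :: "real measure \<Rightarrow> 'w" where
  "vint \<alpha> = (SOME w. w \<in> W \<and> (\<forall>n>0. q (w - hat_sum \<alpha> n) \<le> C / n))"

text \<open>The hat sums are Cauchy by \<open>psum_diff\<close>. Letting one of the two meshes tend
  to 0 in the same estimate leaves the rate \<open>C / n\<close>.\<close>

lemma vint_hat:
  assumes \<alpha>: "\<alpha> \<in> prob01"
  shows "vint \<alpha> \<in> W" and "n > 0 \<Longrightarrow> q (vint \<alpha> - hat_sum \<alpha> n) \<le> C / n"
proof -
  interpret MW: Metric_space W "norm_dist W q"
    by (rule Metric_space_norm_dist[OF normed_space_on_axioms])
  have hW: "hat_sum \<alpha> n \<in> W" if "n > 0" for n
    unfolding hat_sum_def by (rule psum_in[OF hat_partition[OF that]])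
  have hd: "q (hat_sum \<alpha> m - hat_sum \<alpha> n) \<le> C * (1 / m + 1 / n)" if "m > 0" "n > 0" for m n
    unfolding hat_sum_def by (rule psum_diff[OF \<alpha> hat_partition[OF that(1)] hat_partition[OF that(2)]])
  \<comment> \<open>The shift avoids the index 0, for which the hats form no partition.\<close>
  let ?\<sigma> = "\<lambda>n. hat_sum \<alpha> (Suc n)"
  have lim0: "(\<lambda>m. C * (1 / real (Suc m) + c)) \<longlonglongrightarrow> C * (0 + c)" for c
    by (intro tendsto_intros LIMSEQ_Suc[OF lim_1_over_n])
  have "MW.MCauchy ?\<sigma>"
    unfolding MW.MCauchy_def
  proof (intro conjI allI impI)
    show "range ?\<sigma> \<subseteq> W" using hW by auto
    fix e :: real assume e: "e > 0"
    have "(\<lambda>m. C * (1 / real (Suc m) + 0)) \<longlonglongrightarrow> 0" using lim0[of 0] by simp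
    then have "\<forall>\<^sub>F m in sequentially. C * (1 / real (Suc m) + 0) < e / 2"
      using e by (intro order_tendstoD(2)[of _ 0]) auto
    then obtain K where K: "\<And>m. m \<ge> K \<Longrightarrow> C * (1 / real (Suc m)) < e / 2"
      by (auto simp: eventually_sequentially)
    have "norm_dist W q (?\<sigma> m) (?\<sigma> n) < e" if "K \<le> m" "K \<le> n" for m n
    proof -
      have "q (?\<sigma> m - ?\<sigma> n) \<le> C * (1 / Suc m) + C * (1 / Suc n)"
        using hd[of "Suc m" "Suc n"] by (simp add: distrib_left)
      also have "\<dots> < e / 2 + e / 2" using K that by (intro add_strict_mono) auto
      finally show ?thesis using e by (simp add: norm_dist_def)
    qed
    then show "\<exists>N. \<forall>n n'. N \<le> n \<longrightarrow> N \<le> n' \<longrightarrow> norm_dist W q (?\<sigma> n) (?\<sigma> n') < e" by blast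
  qed
  then obtain w where "limitin MW.mtopology ?\<sigma> w sequentially"
    using complete unfolding MW.mcomplete_def by blast
  then have w: "w \<in> W" "\<And>e. e > 0 \<Longrightarrow> \<exists>K. \<forall>n\<ge>K. q (?\<sigma> n - w) < e"
    using limitin_norm_topology[OF normed_space_on_axioms, of ?\<sigma> w] hW by (auto simp: norm_topology_def)
  have "q (w - hat_sum \<alpha> n) \<le> C / n" if n: "n > 0" for n
  proof (rule field_le_epsilon)
    fix e :: real assume e: "e > 0"
    then obtain K where K: "\<And>m. m \<ge> K \<Longrightarrow> q (?\<sigma> m - w) < e / 2" using w(2)[of "e / 2"] by auto
    have "\<forall>\<^sub>F m in sequentially. C * (1 / real (Suc m) + 1 / n) < C / n + e / 2"
      using e by (intro order_tendstoD(2)[OF lim0]) auto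
    then obtain L where L: "\<And>m. m \<ge> L \<Longrightarrow> C * (1 / real (Suc m) + 1 / n) < C / n + e / 2"
      by (auto simp: eventually_sequentially)
    let ?m = "max K L"
    have "q (w - hat_sum \<alpha> n) \<le> q (w - ?\<sigma> ?m) + q (?\<sigma> ?m - hat_sum \<alpha> n)"
      using w hW n by (intro q_diff_triangle) auto
    also have "q (w - ?\<sigma> ?m) = q (?\<sigma> ?m - w)" using w hW by (intro q_diff_commute) auto
    finally show "q (w - hat_sum \<alpha> n) \<le> C / n + e"
      using K[of ?m] L[of ?m] hd[of "Suc ?m" n] n by (simp del: of_nat_Suc)
  qed
  then have "\<exists>w. w \<in> W \<and> (\<forall>n>0. q (w - hat_sum \<alpha> n) \<le> C / n)" using w(1) by blast
  then have "vint \<alpha> \<in> W \<and> (\<forall>n>0. q (vint \<alpha> - hat_sum \<alpha> n) \<le> C / n)"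
    unfolding vint_def by (rule someI_ex)
  then show "vint \<alpha> \<in> W" "n > 0 \<Longrightarrow> q (vint \<alpha> - hat_sum \<alpha> n) \<le> C / n" by auto
qed

text \<open>The detour through hat sums of mesh \<open>1 / n\<close> costs \<open>2 * C / n\<close>,
  which vanishes in the limit. Thus one vector serves all partitions, continuous or not.\<close>

lemma vint_psum:
  assumes \<alpha>: "\<alpha> \<in> prob01" and P: "fine_partition d I \<phi> s"
  shows "q (vint \<alpha> - psum \<alpha> I \<phi> s) \<le> C * d"
proof (rule le_if_le_plus_over_n)
  fix n :: nat assume n: "n > 0"
  have hW: "hat_sum \<alpha> n \<in> W" unfolding hat_sum_def by (rule psum_in[OF hat_partition[OF n]])
  have "q (vint \<alpha> - psum \<alpha> I \<phi> s) \<le> q (vint \<alpha> - hat_sum \<alpha> n) + q (hat_sum \<alpha> n - psum \<alpha> I \<phi> s)"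
    using vint_hat(1)[OF \<alpha>] hW psum_in[OF P] by (intro q_diff_triangle)
  also have "\<dots> \<le> C / n + C * (1 / n + d)"
    using vint_hat(2)[OF \<alpha> n] psum_diff[OF \<alpha> hat_partition[OF n] P]
    by (intro add_mono) (simp_all add: hat_sum_def)
  finally show "q (vint \<alpha> - psum \<alpha> I \<phi> s) \<le> C * d + (2 * C) / n" by (simp add: distrib_left)
qed

lemma vint_eqI:
  assumes \<alpha>: "\<alpha> \<in> prob01" and w: "w \<in> W" "\<And>n. n > 0 \<Longrightarrow> q (w - cell_sum \<alpha> n) \<le> c / n"
  shows "vint \<alpha> = w"
proof -
  have "q (vint \<alpha> - w) \<le> 0"
  proof (rule le_if_le_plus_over_n)
    fix n :: nat assume n: "n > 0"
    have cW: "cell_sum \<alpha> n \<in> W" unfolding cell_sum_def by (rule psum_in[OF cell_partition[OF n]])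
    have "q (vint \<alpha> - w) \<le> q (vint \<alpha> - cell_sum \<alpha> n) + q (cell_sum \<alpha> n - w)"
      using vint_hat(1)[OF \<alpha>] cW w by (intro q_diff_triangle)
    also have "q (cell_sum \<alpha> n - w) = q (w - cell_sum \<alpha> n)" by (intro q_diff_commute cW w)
    also have "q (vint \<alpha> - cell_sum \<alpha> n) + q (w - cell_sum \<alpha> n) \<le> C / n + c / n"
      using vint_psum[OF \<alpha> cell_partition[OF n]] w(2)[OF n] by (intro add_mono) (simp_all add: cell_sum_def)
    finally show "q (vint \<alpha> - w) \<le> 0 + (C + c) / n" by (simp add: add_divide_distrib)
  qed
  then have "vint \<alpha> - w = 0"
    using q_nonneg[of "vint \<alpha> - w"] norm_eq_0_iff[of "vint \<alpha> - w"] w vint_hat(1)[OF \<alpha>] W_closed by fastforce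
  then show ?thesis by simp
qed

lemma cell_sum_eq:
  assumes \<alpha>: "\<alpha> \<in> prob01"
  shows "cell_sum \<alpha> n = (\<Sum>i\<le>n. rs (measure \<alpha> (cell n i \<inter> {0..1})) (v (i / n)))"
  unfolding cell_sum_def psum_def
proof (intro sum.cong refl arg_cong2[where f = sW] arg_cong[where f = of_real])
  fix i
  have "(\<integral>t. indicator (cell n i) t \<partial>\<alpha>) = (\<integral>t. indicator (cell n i \<inter> {0..1}) t \<partial>\<alpha> :: real)"
    using prob01D(3)[OF \<alpha>] by (intro Bochner_Integration.integral_cong) (auto simp: indicator_def)
  then show "(\<integral>t. indicator (cell n i) t \<partial>\<alpha>) = measure \<alpha> (cell n i \<inter> {0..1})"
    by (simp add: prob01D(3)[OF \<alpha>])
qed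

text \<open>A convex combination of measures is given here through the measures of sets. Cell sums
  involve only such values, so they are affine exactly, and the integral inherits this in the
  limit.\<close>

lemma vint_affine: "affine_on_prob01 sW vint"
  unfolding affine_on_prob01_def
proof (intro ballI impI)
  fix \<alpha> \<beta> \<gamma> :: "real measure" and t :: real
  assume \<alpha>: "\<alpha> \<in> prob01" and \<beta>: "\<beta> \<in> prob01" and \<gamma>: "\<gamma> \<in> prob01" and t: "t \<in> {0..1}"
    and eq: "\<forall>A\<in>sets \<gamma>. measure \<gamma> A = (1 - t) * measure \<alpha> A + t * measure \<beta> A"
  show "vint \<gamma> = rs (1 - t) (vint \<alpha>) + rs t (vint \<beta>)"
  proof (rule vint_eqI[OF \<gamma>])
    note aW = vint_hat(1)[OF \<alpha>] vint_hat(1)[OF \<beta>]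
    then show "rs (1 - t) (vint \<alpha>) + rs t (vint \<beta>) \<in> W" by (intro W_closed)
    fix n :: nat assume n: "n > 0"
    have cs: "cell n i \<inter> {0..1} \<in> sets \<gamma>" for i
      using cell_measurable by (auto simp: prob01D(2)[OF \<gamma>] sets_restrict_space_iff)
    have "cell_sum \<gamma> n = rs (1 - t) (cell_sum \<alpha> n) + rs t (cell_sum \<beta> n)"
      using eq cs by (simp add: cell_sum_eq \<alpha> \<beta> \<gamma> scale_sum_right scale_left_distrib sum.distrib)
    then have "rs (1 - t) (vint \<alpha>) + rs t (vint \<beta>) - cell_sum \<gamma> n
        = rs (1 - t) (vint \<alpha> - cell_sum \<alpha> n) + rs t (vint \<beta> - cell_sum \<beta> n)"
      by (simp add: scale_right_diff_distrib del: of_real_diff)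
    moreover have cW: "cell_sum \<alpha> n \<in> W" for \<alpha> unfolding cell_sum_def by (rule psum_in[OF cell_partition[OF n]])
    moreover have "q (rs (1 - t) (vint \<alpha> - cell_sum \<alpha> n) + rs t (vint \<beta> - cell_sum \<beta> n))
        \<le> q (rs (1 - t) (vint \<alpha> - cell_sum \<alpha> n)) + q (rs t (vint \<beta> - cell_sum \<beta> n))"
      using aW cW by (intro norm_triangle W_closed)
    moreover have "\<dots> = \<bar>1 - t\<bar> * q (vint \<alpha> - cell_sum \<alpha> n) + \<bar>t\<bar> * q (vint \<beta> - cell_sum \<beta> n)"
      using aW cW W_closed by (simp add: q_rs del: of_real_diff)
    moreover have "\<dots> \<le> \<bar>1 - t\<bar> * (C / n) + \<bar>t\<bar> * (C / n)"
      using vint_psum[OF \<alpha> cell_partition[OF n]] vint_psum[OF \<beta> cell_partition[OF n]]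
      by (intro add_mono mult_left_mono) (simp_all add: cell_sum_def)
    moreover have "\<dots> = C / n"
    proof -
      have "\<bar>1 - t\<bar> + \<bar>t\<bar> = 1" using t by simp
      then show ?thesis by (metis distrib_right mult_1)
    qed
    ultimately show "q (rs (1 - t) (vint \<alpha>) + rs t (vint \<beta>) - cell_sum \<gamma> n) \<le> C / n" by simp
  qed
qed

lemma vint_le_1:
  assumes "\<alpha> \<in> prob01"
  shows "q (vint \<alpha>) \<le> 1"
proof (rule le_if_le_plus_over_n)
  fix n :: nat assume n: "n > 0"
  have hW: "hat_sum \<alpha> n \<in> W" unfolding hat_sum_def by (rule psum_in[OF hat_partition[OF n]])
  have "q (vint \<alpha>) \<le> q (vint \<alpha> - hat_sum \<alpha> n) + q (hat_sum \<alpha> n)"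
    using norm_triangle[of "vint \<alpha> - hat_sum \<alpha> n" "hat_sum \<alpha> n"] vint_hat(1)[OF assms] hW W_closed by simp
  then show "q (vint \<alpha>) \<le> 1 + C / n"
    using vint_hat(2)[OF assms n] psum_le_1[OF assms hat_partition[OF n]] by (simp add: hat_sum_def)
qed

text \<open>Applied to a hat sum, the functional gives the integral of an interpolation of
  \<open>l (v t)\<close>. Both sides of the claim differ from this number by at most
  \<open>D * C / n\<close>.\<close>

lemma functional_vint:
  assumes \<alpha>: "\<alpha> \<in> prob01"
    and add: "\<And>x y. x \<in> W \<Longrightarrow> y \<in> W \<Longrightarrow> l (x + y) = l x + l y"
    and scale: "\<And>r x. x \<in> W \<Longrightarrow> l (rs r x) = r * l x"
    and bd: "\<And>x. x \<in> W \<Longrightarrow> \<bar>l x\<bar> \<le> D * q x" and D: "D \<ge> 0"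
  shows "l (vint \<alpha>) = (\<integral>t. l (v t) \<partial>\<alpha>)"
proof -
  have l0: "l 0 = 0" using add[of 0 0] W_closed by simp
  have lsum: "l (\<Sum>i\<in>I. f i) = (\<Sum>i\<in>I. l (f i))" if "finite I" "\<And>i. i \<in> I \<Longrightarrow> f i \<in> W" for I :: "nat set" and f
    using that by (induction I rule: finite_induct) (simp_all add: l0 add W_closed)
  have ldiff: "l (x - y) = l x - l y" if "x \<in> W" "y \<in> W" for x y
    using add[of "x - y" y] that W_closed by simp
  have ll: "\<bar>l (v s) - l (v t)\<bar> \<le> D * (C * \<bar>s - t\<bar>)" if "s \<in> {0..1}" "t \<in> {0..1}" for s t
  proof -
    have "\<bar>l (v s) - l (v t)\<bar> \<le> D * q (v s - v t)"
      using bd[of "v s - v t"] ldiff v_in that W_closed by simp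
    also have "\<dots> \<le> D * (C * \<bar>s - t\<bar>)" using v_lipschitz[OF that] D by (intro mult_left_mono)
    finally show ?thesis .
  qed
  have "(D * C)-lipschitz_on {0..1} (\<lambda>t. l (v t))"
    using ll D C_nonneg by (intro lipschitz_onI) (auto simp: dist_real_def mult.assoc)
  then have cont: "continuous_on {0..1} (\<lambda>t. l (v t))" by (rule lipschitz_on_continuous_on)
  have "\<bar>l (vint \<alpha>) - (\<integral>t. l (v t) \<partial>\<alpha>)\<bar> \<le> 0"
  proof (rule le_if_le_plus_over_n)
    fix n :: nat assume n: "n > 0"
    note P = hat_partition[OF n] and PD = fine_partitionD[OF hat_partition[OF n]]
    have hW: "hat_sum \<alpha> n \<in> W" unfolding hat_sum_def by (rule psum_in[OF P])
    have "l (hat_sum \<alpha> n) = (\<Sum>i\<le>n. (\<integral>t. hat n i t \<partial>\<alpha>) * l (v (i / n)))"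
      unfolding hat_sum_def psum_def using PD(2) v_in W_closed by (subst lsum) (auto simp: scale)
    also have "\<dots> = (\<integral>t. (\<Sum>i\<le>n. hat n i t * l (v (i / n))) \<partial>\<alpha>)"
      using fine_partition_integrable[OF \<alpha> P] by (simp add: Bochner_Integration.integral_sum)
    finally have lh: "l (hat_sum \<alpha> n) = (\<integral>t. (\<Sum>i\<le>n. hat n i t * l (v (i / n))) \<partial>\<alpha>)" .
    have "\<bar>(\<integral>t. l (v t) \<partial>\<alpha>) - (\<integral>t. (\<Sum>i\<le>n. hat n i t * l (v (i / n))) \<partial>\<alpha>)\<bar> \<le> D * (C * (1 / n))"
    proof (rule integral_diff_le_prob01[OF \<alpha> integrable_continuous_prob01[OF \<alpha> cont]])
      show "integrable \<alpha> (\<lambda>t. \<Sum>i\<le>n. hat n i t * l (v (i / n)))"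
        using fine_partition_integrable(1)[OF \<alpha> P] by (intro Bochner_Integration.integrable_sum integrable_mult_left) simp
      fix t assume t: "t \<in> {0..1::real}"
      have "l (v t) = (\<Sum>i\<le>n. hat n i t * l (v t))" using PD(6)[OF t] by (simp flip: sum_distrib_right)
      then have "\<bar>l (v t) - (\<Sum>i\<le>n. hat n i t * l (v (i / n)))\<bar> = \<bar>\<Sum>i\<le>n. hat n i t * (l (v t) - l (v (i / n)))\<bar>"
        by (simp add: sum_subtractf right_diff_distrib)
      also have "\<dots> \<le> (\<Sum>i\<le>n. hat n i t * (D * (C * (1 / n))))"
      proof (rule order_trans[OF sum_abs sum_mono])
        fix i assume i: "i \<in> {..n}"
        show "\<bar>hat n i t * (l (v t) - l (v (i / n)))\<bar> \<le> hat n i t * (D * (C * (1 / n)))"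
        proof (cases "hat n i t = 0")
          case False
          have "\<bar>l (v t) - l (v (i / n))\<bar> \<le> D * (C * \<bar>t - i / n\<bar>)" using ll[OF t PD(2)[OF i]] .
          also have "\<dots> \<le> D * (C * (1 / n))"
            using PD(5)[OF i t False] D C_nonneg by (intro mult_left_mono)
          finally show ?thesis using PD(4)[OF i t] unfolding abs_mult by (intro mult_mono) auto
        qed simp
      qed
      also have "\<dots> = D * (C * (1 / n))" unfolding sum_distrib_right[symmetric] using PD(6)[OF t] by simp
      finally show "\<bar>l (v t) - (\<Sum>i\<le>n. hat n i t * l (v (i / n)))\<bar> \<le> D * (C * (1 / n))" .
    qed
    moreover have "\<bar>l (vint \<alpha>) - l (hat_sum \<alpha> n)\<bar> \<le> D * (C / n)"
    proof -
      have "\<bar>l (vint \<alpha>) - l (hat_sum \<alpha> n)\<bar> \<le> D * q (vint \<alpha> - hat_sum \<alpha> n)"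
        using bd[of "vint \<alpha> - hat_sum \<alpha> n"] ldiff vint_hat(1)[OF \<alpha>] hW W_closed by simp
      also have "\<dots> \<le> D * (C / n)" using vint_hat(2)[OF \<alpha> n] D by (intro mult_left_mono)
      finally show ?thesis .
    qed
    ultimately have "\<bar>l (vint \<alpha>) - (\<integral>t. l (v t) \<partial>\<alpha>)\<bar> \<le> D * (C / n) + D * (C * (1 / n))"
      unfolding lh by linarith
    then show "\<bar>l (vint \<alpha>) - (\<integral>t. l (v t) \<partial>\<alpha>)\<bar> \<le> 0 + 2 * (D * C) / n" by (simp add: mult.commute)
  qed
  then show ?thesis by simp
qed

text \<open>Partitions that keep the points of \<open>F\<close> as separate parts split the sum into
  the atomic part and a remainder of total weight \<open>1 - measure \<alpha> F\<close>, whose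
  vectors have norm at most 1. The mesh error disappears as \<open>n\<close> grows.\<close>

lemma vint_atoms:
  assumes \<alpha>: "\<alpha> \<in> prob01" and F: "finite F" "F \<subseteq> {0..1}"
  shows "q (vint \<alpha> - (\<Sum>a\<in>F. rs (measure \<alpha> {a}) (v a))) \<le> 1 - measure \<alpha> F"
proof (rule le_if_le_plus_over_n)
  fix n :: nat assume n: "n > 0"
  interpret prob_space \<alpha> using \<alpha> by (simp add: prob01_def)
  let ?\<phi> = "case_sum (\<lambda>a. indicator {a}) (\<lambda>i. indicator (cell n i - F)) :: _ \<Rightarrow> real \<Rightarrow> real"
    and ?s = "case_sum (\<lambda>a. a) (\<lambda>i. real i / n)"
  note P = atoms_partition[OF n F]
  define R where "R = (\<Sum>i\<le>n. rs (\<integral>t. indicator (cell n i - F) t \<partial>\<alpha>) (v (i / n)))"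
  have sF: "A \<in> sets \<alpha>" if "A \<subseteq> F" for A
  proof -
    have "finite A" "A \<subseteq> {0..1}" using that F finite_subset by auto
    then show ?thesis by (auto simp: prob01D(2)[OF \<alpha>] sets_restrict_space_iff intro: borel_closed finite_imp_closed)
  qed
  have ind: "(\<integral>t. indicator {a} t \<partial>\<alpha>) = measure \<alpha> {a}" if "a \<in> F" for a
    using sF[of "{a}"] that by simp
  have mF: "(\<Sum>a\<in>F. measure \<alpha> {a}) = measure \<alpha> F"
    using F sF by (intro finite_measure_eq_sum_singleton[symmetric]) auto
  have sum1: "(\<Sum>i\<le>n. \<integral>t. indicator (cell n i - F) t \<partial>\<alpha>) = 1 - measure \<alpha> F"
    using fine_partition_integral_sum[OF \<alpha> P] F ind mF by (simp add: sum.Plus)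
  have psum: "psum \<alpha> (F <+> {..n}) ?\<phi> ?s = (\<Sum>a\<in>F. rs (measure \<alpha> {a}) (v a)) + R"
    using F ind by (simp add: psum_def sum.Plus R_def)
  have i01: "real i / n \<in> {0..1}" if "i \<le> n" for i using that n by simp
  have RW: "R \<in> W" unfolding R_def using i01 by (intro W_closed v_in) auto
  have SW: "(\<Sum>a\<in>F. rs (measure \<alpha> {a}) (v a)) \<in> W" using F by (intro W_closed v_in) auto
  have "q R \<le> (\<Sum>i\<le>n. \<integral>t. indicator (cell n i - F) t \<partial>\<alpha>)"
    unfolding R_def
  proof (rule q_sum_le)
    fix i assume i: "i \<in> {..n}"
    have "Inr i \<in> F <+> {..n}" using i by blast
    then have nn: "0 \<le> (\<integral>t. indicator (cell n i - F) t \<partial>\<alpha> :: real)"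
      using fine_partition_integrable(2)[OF \<alpha> P, of "Inr i"] by simp
    show "rs (\<integral>t. indicator (cell n i - F) t \<partial>\<alpha>) (v (i / n)) \<in> W" using i i01 by (intro W_closed v_in) auto
    show "q (rs (\<integral>t. indicator (cell n i - F) t \<partial>\<alpha>) (v (i / n))) \<le> (\<integral>t. indicator (cell n i - F) t \<partial>\<alpha>)"
      using nn v_bound[OF i01, of i] v_in[OF i01, of i] i by (simp add: q_rs mult_left_le)
  qed simp
  moreover have "q (vint \<alpha> - (\<Sum>a\<in>F. rs (measure \<alpha> {a}) (v a))) \<le> q (vint \<alpha> - psum \<alpha> (F <+> {..n}) ?\<phi> ?s) + q R"
    using norm_triangle[of "vint \<alpha> - psum \<alpha> (F <+> {..n}) ?\<phi> ?s" R] vint_hat(1)[OF \<alpha>] RW SW W_closed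
    by (simp add: psum algebra_simps)
  ultimately show "q (vint \<alpha> - (\<Sum>a\<in>F. rs (measure \<alpha> {a}) (v a))) \<le> 1 - measure \<alpha> F + C / n"
    using vint_psum[OF \<alpha> P] sum1 by simp
qed

end

section \<open>Functionals on the completed tensor product\<close>

text \<open>Of the completion only the density of the image is known, so bounded functionals have to
  be extended from there. Real values suffice for the later arguments and permit a formula by an
  infimum.\<close>

lemma completion_functional:
  fixes \<rho> :: "'v::ab_group_add \<Rightarrow> real"
  assumes V: "normed_space_on sV V p" and c: "completion_map sV V p sW W q \<iota>"
    and add: "\<And>u v. u \<in> V \<Longrightarrow> v \<in> V \<Longrightarrow> \<rho> (u + v) = \<rho> u + \<rho> v"
    and scale: "\<And>r u. u \<in> V \<Longrightarrow> \<rho> (sV (of_real r) u) = r * \<rho> u"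
    and bd: "\<And>u. u \<in> V \<Longrightarrow> \<bar>\<rho> u\<bar> \<le> C * p u" and C: "C \<ge> 0"
  obtains L where "\<And>x y. x \<in> W \<Longrightarrow> y \<in> W \<Longrightarrow> L (x + y) = L x + L y"
    "\<And>r x. x \<in> W \<Longrightarrow> L (sW (of_real r) x) = r * L x"
    "\<And>x. x \<in> W \<Longrightarrow> \<bar>L x\<bar> \<le> C * q x" "\<And>u. u \<in> V \<Longrightarrow> L (\<iota> u) = \<rho> u"
proof -
  interpret V: normed_space_on sV V p by (rule V)
  have "banach_space_on sW W q" using c by (simp add: completion_map_def)
  then interpret W: banach_space_on sW W q .
  interpret M: Metric_space W "norm_dist W q" by (rule Metric_space_norm_dist[OF W.normed_space_on_axioms])
  note Wc = W.subspace_diff[OF W.subspace_V] W.subspace_add[OF W.subspace_V] W.subspace_scale[OF W.subspace_V]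
  note Vc = V.subspace_diff[OF V.subspace_V] V.subspace_add[OF V.subspace_V] V.subspace_scale[OF V.subspace_V]
    V.subspace_0[OF V.subspace_V]
  note nonneg = norm_nonneg_on[OF W.normed_space_on_axioms]
    and tri = norm_diff_triangle[OF W.normed_space_on_axioms]
    and comm = norm_diff_commute[OF W.normed_space_on_axioms]
  have \<iota>W: "\<iota> u \<in> W" if "u \<in> V" for u using c that by (auto simp: completion_map_def)
  have \<iota>add: "\<iota> (u + v) = \<iota> u + \<iota> v" and \<iota>scale: "\<iota> (sV a u) = sW a (\<iota> u)" and q\<iota>: "q (\<iota> u) = p u"
    if "u \<in> V" "v \<in> V" for u v a using c that by (auto simp: completion_map_def)
  have \<iota>diff: "\<iota> (u - v) = \<iota> u - \<iota> v" if "u \<in> V" "v \<in> V" for u v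
    using \<iota>add[of "u - v" v] that Vc by simp
  have \<rho>diff: "\<rho> (u - v) = \<rho> u - \<rho> v" if "u \<in> V" "v \<in> V" for u v
    using add[of "u - v" v] that Vc by simp
  have dense: "\<exists>u\<in>V. q (w - \<iota> u) < d" if w: "w \<in> W" and d: "d > 0" for w d
  proof -
    have "w \<in> M.mtopology closure_of (\<iota> ` V)" using c w by (simp add: completion_map_def norm_topology_def)
    then have "\<exists>y\<in>\<iota> ` V. y \<in> M.mball w d" using d unfolding M.metric_closure_of by blast
    then show ?thesis using w \<iota>W by (auto simp: norm_dist_def)
  qed
  \<comment> \<open>McShane's formula for Lipschitz extensions, which makes it unnecessary to choose approximating sequences\<close>
  define L where "L w = (INF u\<in>V. \<rho> u + C * q (w - \<iota> u))" for w
  have low: "\<rho> u - C * q (w - \<iota> u) \<le> \<rho> u' + C * q (w - \<iota> u')" if "w \<in> W" "u \<in> V" "u' \<in> V" for w u u'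
  proof -
    have "\<rho> u - \<rho> u' \<le> C * p (u - u')" using bd[of "u - u'"] \<rho>diff that Vc by force
    also have "p (u - u') = q (\<iota> u - \<iota> u')" using q\<iota>[of "u - u'"] \<iota>diff that Vc by simp
    also have "\<dots> \<le> q (\<iota> u - w) + q (w - \<iota> u')" using that \<iota>W by (intro tri) auto
    also have "q (\<iota> u - w) = q (w - \<iota> u)" using that \<iota>W by (intro comm) auto
    finally show ?thesis using C by (simp add: mult_left_mono distrib_left)
  qed
  \<comment> \<open>All later properties of \<open>L\<close> come from this estimate: replace each
    vector by nearby elements of the image, where \<open>\<rho>\<close> is linear.\<close>
  have key: "\<bar>L w - \<rho> u\<bar> \<le> C * q (w - \<iota> u)" if "w \<in> W" "u \<in> V" for w u
  proof -
    have "L w \<le> \<rho> u + C * q (w - \<iota> u)"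
      unfolding L_def using low[OF that(1) that(2)] that(2)
      by (intro cINF_lower bdd_belowI[of _ "\<rho> u - C * q (w - \<iota> u)"]) auto
    moreover have "\<rho> u - C * q (w - \<iota> u) \<le> L w"
      unfolding L_def using low[OF that] that(2) by (intro cINF_greatest) auto
    ultimately show ?thesis by (simp add: abs_le_iff)
  qed
  have L\<iota>: "L (\<iota> u) = \<rho> u" if "u \<in> V" for u
    using key[OF \<iota>W[OF that] that] W.norm_eq_0_iff[of 0] W.subspace_0[OF W.subspace_V] by simp
  have zeroI: "x = 0" if "\<And>d. d > 0 \<Longrightarrow> \<bar>x\<bar> \<le> K * d" for x K :: real
  proof (rule ccontr)
    assume "x \<noteq> 0"
    define d where "d = \<bar>x\<bar> / (2 * (\<bar>K\<bar> + 1))"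
    have d: "d > 0" using \<open>x \<noteq> 0\<close> by (simp add: d_def add_nonneg_pos)
    have "\<bar>x\<bar> \<le> (\<bar>K\<bar> + 1) * d" using that[OF d] d mult_right_mono[of K "\<bar>K\<bar> + 1" d] by linarith
    also have "\<dots> = \<bar>x\<bar> / 2" by (simp add: d_def field_simps)
    finally show False using \<open>x \<noteq> 0\<close> by simp
  qed
  have Ladd: "L (x + y) = L x + L y" if x: "x \<in> W" and y: "y \<in> W" for x y
  proof -
    have "L (x + y) - (L x + L y) = 0"
    proof (rule zeroI[of _ "4 * C"])
      fix d :: real assume d: "d > 0"
      obtain u v where u: "u \<in> V" "q (x - \<iota> u) < d" and v: "v \<in> V" "q (y - \<iota> v) < d"
        using dense[OF x d] dense[OF y d] by blast
      have "q (x + y - \<iota> (u + v)) \<le> q (x - \<iota> u) + q (y - \<iota> v)"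
        using W.norm_triangle[of "x - \<iota> u" "y - \<iota> v"] x y u v \<iota>W \<iota>add Wc by (simp add: algebra_simps)
      then have "q (x + y - \<iota> (u + v)) \<le> 2 * d" using u v by simp
      then have "C * q (x + y - \<iota> (u + v)) \<le> C * (2 * d)" "C * q (x - \<iota> u) \<le> C * d" "C * q (y - \<iota> v) \<le> C * d"
        using C u v by (auto intro!: mult_left_mono)
      moreover have "\<bar>L (x + y) - \<rho> (u + v)\<bar> \<le> C * q (x + y - \<iota> (u + v))"
        using x y u v Wc Vc by (intro key) auto
      moreover note key[OF x u(1)] key[OF y v(1)] add[OF u(1) v(1)]
      ultimately show "\<bar>L (x + y) - (L x + L y)\<bar> \<le> 4 * C * d" by linarith
    qed
    then show ?thesis by simp
  qed
  have Lscale: "L (sW (of_real r) x) = r * L x" if x: "x \<in> W" for r x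
  proof -
    have "L (sW (of_real r) x) - r * L x = 0"
    proof (rule zeroI[of _ "2 * C * \<bar>r\<bar>"])
      fix d :: real assume d: "d > 0"
      obtain u where u: "u \<in> V" "q (x - \<iota> u) < d" using dense[OF x d] by blast
      have "q (sW (of_real r) x - \<iota> (sV (of_real r) u)) = \<bar>r\<bar> * q (x - \<iota> u)"
        using W.norm_scale[of "x - \<iota> u" "of_real r"] x u \<iota>W \<iota>scale Wc by (simp add: W.scale_right_diff_distrib)
      then have "\<bar>L (sW (of_real r) x) - r * \<rho> u\<bar> \<le> C * (\<bar>r\<bar> * q (x - \<iota> u))"
        using key[of "sW (of_real r) x" "sV (of_real r) u"] x u Wc Vc scale by simp
      also have "\<dots> \<le> C * (\<bar>r\<bar> * d)" using u C by (intro mult_left_mono) auto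
      finally have 1: "\<bar>L (sW (of_real r) x) - r * \<rho> u\<bar> \<le> C * (\<bar>r\<bar> * d)" .
      have "\<bar>r * \<rho> u - r * L x\<bar> = \<bar>r\<bar> * \<bar>L x - \<rho> u\<bar>" by (simp add: abs_mult[symmetric] right_diff_distrib abs_minus_commute)
      also have "\<dots> \<le> \<bar>r\<bar> * (C * d)"
      proof (rule mult_left_mono)
        have "C * q (x - \<iota> u) \<le> C * d" using u C by (intro mult_left_mono) auto
        then show "\<bar>L x - \<rho> u\<bar> \<le> C * d" using key[OF x u(1)] by (rule order_trans[rotated])
      qed simp
      also have "\<dots> = C * (\<bar>r\<bar> * d)" by simp
      finally have "\<bar>L (sW (of_real r) x) - r * L x\<bar> \<le> C * (\<bar>r\<bar> * d) + C * (\<bar>r\<bar> * d)" using 1 by linarith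
      then show "\<bar>L (sW (of_real r) x) - r * L x\<bar> \<le> 2 * C * \<bar>r\<bar> * d" by (simp add: mult_ac)
    qed
    then show ?thesis by simp
  qed
  have "\<rho> 0 = 0" using add[of 0 0] Vc by simp
  moreover have "\<iota> 0 = 0" using \<iota>add[of 0 0] Vc by simp
  ultimately have "\<bar>L x\<bar> \<le> C * q x" if "x \<in> W" for x using key[OF that, of 0] Vc by simp
  then show thesis using Ladd Lscale L\<iota> that by blast
qed

context
  fixes sX :: "'k::real_or_complex \<Rightarrow> 'a::ab_group_add \<Rightarrow> 'a" and N
    and sY :: "'k \<Rightarrow> 'b::ab_group_add \<Rightarrow> 'b" and M
  assumes X: "normed_space_on sX UNIV N" and Y: "normed_space_on sY UNIV M"
begin

interpretation X: normed_space_on sX UNIV N by (rule X)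
interpretation Y: normed_space_on sY UNIV M by (rule Y)

lemma bilinear_form_iff:
  "bilinear_form sX sY B \<longleftrightarrow> (\<forall>x x' y. B (x + x') y = B x y + B x' y) \<and> (\<forall>x y y'. B x (y + y') = B x y + B x y') \<and>
    (\<forall>c x y. B (sX c x) y = c * B x y) \<and> (\<forall>c x y. B x (sY c y) = c * B x y)"
  by (auto simp: bilinear_form_def Vector_Spaces.linear_iff X.vector_space_axioms Y.vector_space_axioms vector_space_mult)

lemma tensor_bilinear:
  "tensor sX sY (x + x') y = tensor sX sY x y + tensor sX sY x' y"
  "tensor sX sY x (y + y') = tensor sX sY x y + tensor sX sY x y'"
  "tensor sX sY (sX c x) y = fun_scale c (tensor sX sY x y)"
  "tensor sX sY x (sY c y) = fun_scale c (tensor sX sY x y)"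
  by (auto simp: fun_eq_iff tensor_def fun_scale_def bilinear_form_iff)

lemma tensor_in: "tensor sX sY x y \<in> tensor_product sX sY"
  unfolding tensor_product_iff[OF X Y]
  by (intro exI[of _ 1] exI[of _ "\<lambda>_. x"] exI[of _ "\<lambda>_. y"]) (simp add: tensor_sum_def[OF X Y])

lemma elementary_tensor:
  assumes T: "completed_projective_tensor sX N sY M sW W q \<tau>"
  shows "\<tau> x y \<in> W" and "\<tau> (x + x') y = \<tau> x y + \<tau> x' y"
    and "\<tau> x (y + y') = \<tau> x y + \<tau> x y'"
    and "\<tau> (sX c x) y = sW c (\<tau> x y)" and "\<tau> x (sY c y) = sW c (\<tau> x y)"
    and "q (\<tau> x y) \<le> N x * M y"
proof -
  obtain \<iota> where i: "completion_map fun_scale (tensor_product sX sY) (proj_norm sX N sY M) sW W q \<iota>"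
    and \<tau>: "\<And>x y. \<tau> x y = \<iota> (tensor sX sY x y)" using T by (auto simp: completed_projective_tensor_def)
  show "\<tau> x y \<in> W" "\<tau> (x + x') y = \<tau> x y + \<tau> x' y" "\<tau> x (y + y') = \<tau> x y + \<tau> x y'"
    "\<tau> (sX c x) y = sW c (\<tau> x y)" "\<tau> x (sY c y) = sW c (\<tau> x y)"
    using i tensor_in by (auto simp: \<tau> tensor_bilinear completion_map_def)
  have "q (\<tau> x y) = proj_norm sX N sY M (tensor sX sY x y)" using i tensor_in by (simp add: \<tau> completion_map_def)
  also have "\<dots> \<le> N x * M y"
    using proj_norm_le[OF X Y, of "tensor sX sY x y" 1 "\<lambda>_. x" "\<lambda>_. y"] by (simp add: tensor_sum_def[OF X Y])
  finally show "q (\<tau> x y) \<le> N x * M y" .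
qed

text \<open>An element \<open>u\<close> of the algebraic tensor product is itself a function of
  forms, and \<open>u B\<close> is its pairing with \<open>B\<close>. A bound for \<open>B\<close>
  on pairs bounds this value by every representation of \<open>u\<close>, hence by the projective
  norm, and \<open>completion_functional\<close> extends its real part
  \<open>\<rho> (u B)\<close>.\<close>

lemma bilinear_form_functional:
  assumes T: "completed_projective_tensor sX N sY M sW W q \<tau>"
    and B: "bilinear_form sX sY B" and bd: "\<And>x y. norm (B x y) \<le> C * (N x * M y)" and C: "C \<ge> 0"
    and \<rho>: "\<And>a b :: 'k. \<rho> (a + b) = \<rho> a + \<rho> b" "\<And>r a. \<rho> (of_real r * a) = r * \<rho> a" "\<And>a. \<bar>\<rho> a\<bar> \<le> norm a"
  obtains L where "\<And>x y. x \<in> W \<Longrightarrow> y \<in> W \<Longrightarrow> L (x + y) = L x + L y"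
    "\<And>r x. x \<in> W \<Longrightarrow> L (sW (of_real r) x) = r * L x"
    "\<And>x. x \<in> W \<Longrightarrow> \<bar>L x\<bar> \<le> C * q x" "\<And>x y. L (\<tau> x y) = \<rho> (B x y)"
proof -
  obtain \<iota> where i: "completion_map fun_scale (tensor_product sX sY) (proj_norm sX N sY M) sW W q \<iota>"
    and \<tau>: "\<And>x y. \<tau> x y = \<iota> (tensor sX sY x y)" using T by (auto simp: completed_projective_tensor_def)
  have ub: "norm (u B) \<le> C * proj_norm sX N sY M u" if u: "u \<in> tensor_product sX sY" for u
  \<comment> \<open>The general case divides by \<open>C\<close>; for \<open>C = 0\<close> the form
    vanishes.\<close>
  proof (cases "C = 0")
    case True
    obtain n x y where rep: "u = tensor_sum sX sY n x y" using u tensor_product_iff[OF X Y] by blast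
    have "B x y = 0" for x y using bd[of x y] True by simp
    then show ?thesis by (simp add: rep tensor_sum_def[OF X Y] sum_fun_apply tensor_def B True)
  next
    case False
    have "norm (u B) / C \<le> proj_norm sX N sY M u"
    proof (rule proj_norm_ge[OF X Y u])
      fix n x y assume "u = tensor_sum sX sY n x y"
      then have "norm (u B) = norm (\<Sum>i<n. B (x i) (y i))"
        by (simp add: tensor_sum_def[OF X Y] sum_fun_apply tensor_def B)
      also have "\<dots> \<le> C * (\<Sum>i<n. N (x i) * M (y i))"
        unfolding sum_distrib_left by (intro sum_norm_le bd)
      finally show "norm (u B) / C \<le> (\<Sum>i<n. N (x i) * M (y i))" using False C by (simp add: field_simps)
    qed
    then show ?thesis using False C by (simp add: field_simps)
  qed
  have bd': "\<bar>\<rho> (u B)\<bar> \<le> C * proj_norm sX N sY M u" if "u \<in> tensor_product sX sY" for u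
    using \<rho>(3) ub[OF that] by (rule order_trans)
  have "\<exists>L. (\<forall>x\<in>W. \<forall>y\<in>W. L (x + y) = L x + L y) \<and> (\<forall>r. \<forall>x\<in>W. L (sW (of_real r) x) = r * L x) \<and>
    (\<forall>x\<in>W. \<bar>L x\<bar> \<le> C * q x) \<and> (\<forall>u\<in>tensor_product sX sY. L (\<iota> u) = \<rho> (u B))"
    by (rule completion_functional[OF normed_space_on_tensor_product[OF X Y] i, of "\<lambda>u. \<rho> (u B)" C])
      (simp_all add: fun_scale_def \<rho> bd' C, blast)
  then obtain L where L: "\<And>x y. x \<in> W \<Longrightarrow> y \<in> W \<Longrightarrow> L (x + y) = L x + L y"
    "\<And>r x. x \<in> W \<Longrightarrow> L (sW (of_real r) x) = r * L x"
    "\<And>x. x \<in> W \<Longrightarrow> \<bar>L x\<bar> \<le> C * q x" "\<And>u. u \<in> tensor_product sX sY \<Longrightarrow> L (\<iota> u) = \<rho> (u B)"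
    by blast
  show thesis
    by (rule that[OF L(1-3)]) (simp_all add: \<tau> L(4) tensor_in, simp add: tensor_def B)
qed

end

section \<open>The weak-star embedding\<close>

lemma topspace_weak_star: "topspace weak_star = prob01"
  unfolding weak_star_def Let_def topspace_pullback_topology by auto

lemma continuous_map_weak_star_integral:
  assumes "continuous_on {0..1} f"
  shows "continuous_map weak_star euclideanreal (\<lambda>\<alpha>. \<integral>t. f t \<partial>\<alpha>)"
proof -
  let ?C = "{f :: real \<Rightarrow> real. continuous_on {0..1} f}"
  have "continuous_map (powertop_real ?C) euclideanreal (\<lambda>x. x f)"
    using assms by (intro continuous_map_product_projection) simp
  then have "continuous_map weak_star euclideanreal ((\<lambda>x. x f) \<circ> (\<lambda>\<alpha>. \<lambda>f\<in>?C. \<integral>t. f t \<partial>\<alpha>))"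
    unfolding weak_star_def Let_def by (rule continuous_map_pullback)
  then show ?thesis using assms by (simp add: o_def)
qed

lemma continuous_map_into_weak_star:
  assumes "g ` topspace X \<subseteq> prob01"
    and "\<And>f. continuous_on {0..1} f \<Longrightarrow> continuous_map X euclideanreal (\<lambda>x. \<integral>t. f t \<partial>(g x))"
  shows "continuous_map X weak_star g"
  unfolding weak_star_def Let_def
  using assms by (intro continuous_map_pullback') (auto simp: continuous_map_componentwise o_def)

lemma continuous_map_from_norm_topology:
  assumes N: "normed_space_on scl V p" and S: "S \<subseteq> V"
    and f: "\<And>x e. x \<in> S \<Longrightarrow> e > 0 \<Longrightarrow> \<exists>d>0. \<forall>y\<in>S. p (x - y) < d \<longrightarrow> \<bar>f x - f y\<bar> < (e :: real)"
  shows "continuous_map (subtopology (norm_topology V p) S) euclideanreal f"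
proof -
  interpret M: Metric_space V "norm_dist V p" by (rule Metric_space_norm_dist[OF N])
  interpret MS: Submetric V "norm_dist V p" S by unfold_locales (use S in auto)
  have "continuous_map MS.sub.mtopology euclideanreal f"
    unfolding MS.sub.continuous_map_from_metric
  proof (intro conjI ballI allI impI)
    fix x U assume x: "x \<in> S" and U: "openin euclideanreal U \<and> f x \<in> U"
    then obtain e where e: "e > 0" "ball (f x) e \<subseteq> U" by (meson open_contains_ball open_openin)
    obtain d where d: "d > 0" "\<forall>y\<in>S. p (x - y) < d \<longrightarrow> \<bar>f x - f y\<bar> < e" using f[OF x e(1)] by blast
    have "f y \<in> U" if "y \<in> S" "norm_dist V p x y < d" for y
    proof -
      have "p (x - y) < d" using that x S by (auto simp: norm_dist_def split: if_splits)
      then have "f y \<in> ball (f x) e" using d that by (simp add: dist_real_def)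
      then show ?thesis using e by blast
    qed
    then show "\<exists>r>0. \<forall>y. y \<in> S \<and> norm_dist V p x y < r \<longrightarrow> f y \<in> U" using d by blast
  qed simp
  then show ?thesis by (simp add: norm_topology_def MS.mtopology_submetric)
qed

lemma continuous_map_to_norm_topology:
  assumes N: "normed_space_on scl V p" and f: "f ` topspace X \<subseteq> V"
    and g: "\<And>x e. x \<in> topspace X \<Longrightarrow> e > 0 \<Longrightarrow>
      \<exists>U. openin X U \<and> x \<in> U \<and> (\<forall>y\<in>U. p (f x - f y) < e)"
  shows "continuous_map X (norm_topology V p) f"
proof -
  interpret M: Metric_space V "norm_dist V p" by (rule Metric_space_norm_dist[OF N])
  show ?thesis
    unfolding norm_topology_def M.continuous_map_to_metric
  proof (intro ballI allI impI)
    fix x and e :: real assume x: "x \<in> topspace X" and e: "e > 0"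
    obtain U where U: "openin X U" "x \<in> U" "\<forall>y\<in>U. p (f x - f y) < e" using g[OF x e] by blast
    have "f y \<in> M.mball (f x) e" if "y \<in> U" for y
      using U that x f openin_subset[OF U(1)] by (auto simp: norm_dist_def)
    then show "\<exists>U. openin X U \<and> x \<in> U \<and> (\<forall>y\<in>U. f y \<in> M.mball (f x) e)" using U by blast
  qed
qed

lemma (in curve_in_banach) functional_tendsto:
  assumes add: "\<And>x y. x \<in> W \<Longrightarrow> y \<in> W \<Longrightarrow> f (x + y) = f x + f y"
    and bd: "\<And>x. x \<in> W \<Longrightarrow> \<bar>f x\<bar> \<le> D * q x" and D: "D \<ge> 0"
    and S: "\<And>k. S k \<in> W" and lim: "limitin (norm_topology W q) S u sequentially"
  shows "(\<lambda>k. f (S k)) \<longlonglongrightarrow> f u"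
proof (rule LIMSEQ_I)
  fix e :: real assume e: "e > 0"
  have u: "u \<in> W" and lim': "\<And>e. e > 0 \<Longrightarrow> \<exists>K. \<forall>k\<ge>K. q (S k - u) < e"
    using lim unfolding limitin_norm_topology[OF normed_space_on_axioms S] by simp_all
  define d where "d = e / (D + 1)"
  have d: "d > 0" using e D by (simp add: d_def)
  obtain K where K: "\<forall>k\<ge>K. q (S k - u) < d" using lim'[OF d] by blast
  have "norm (f (S k) - f u) < e" if "k \<ge> K" for k
  proof -
    note dW = W_closed(1)[OF S u]
    have "norm (f (S k) - f u) \<le> D * q (S k - u)"
      using bd[OF dW] add[of "S k - u" u] dW u by simp
    also have "\<dots> \<le> (D + 1) * q (S k - u)" using q_nonneg[OF dW] by (simp add: distrib_right)
    also have "\<dots> < (D + 1) * d" using K that D by (intro mult_strict_left_mono) auto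
    also have "\<dots> = e" using D by (simp add: d_def)
    finally show ?thesis .
  qed
  then show "\<exists>K. \<forall>k\<ge>K. norm (f (S k) - f u) < e" by blast
qed

text \<open>The functionals \<open>L i\<close> read off moments and will come from the forms
  \<open>f i x * f 0 y\<close>; the functional \<open>l\<close> is 1 on the whole curve, exposes the
  face containing it, and will come from \<open>B\<close>.\<close>

locale moment_curve = curve_in_banach sW W q v C
  for sW :: "'k::real_normed_field \<Rightarrow> 'w::ab_group_add \<Rightarrow> 'w" and W q v C +
  fixes L :: "nat \<Rightarrow> 'w \<Rightarrow> real" and D :: "nat \<Rightarrow> real" and l :: "'w \<Rightarrow> real"
  assumes L_add: "x \<in> W \<Longrightarrow> y \<in> W \<Longrightarrow> L i (x + y) = L i x + L i y"
    and L_scale: "x \<in> W \<Longrightarrow> L i (sW (of_real r) x) = r * L i x"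
    and L_bound: "x \<in> W \<Longrightarrow> \<bar>L i x\<bar> \<le> D i * q x" and D_nonneg: "0 \<le> D i"
    and L_curve: "t \<in> {0..1} \<Longrightarrow> L i (v t) = t ^ i"
    and l_add: "x \<in> W \<Longrightarrow> y \<in> W \<Longrightarrow> l (x + y) = l x + l y"
    and l_scale: "x \<in> W \<Longrightarrow> l (sW (of_real r) x) = r * l x"
    and l_bound: "x \<in> W \<Longrightarrow> \<bar>l x\<bar> \<le> q x"
    and l_curve: "t \<in> {0..1} \<Longrightarrow> l (v t) = 1"
begin

section \<open>Norm, injectivity and bicontinuity of the integral\<close>

lemma L_vint: "\<alpha> \<in> prob01 \<Longrightarrow> L i (vint \<alpha>) = (\<integral>t. t ^ i \<partial>\<alpha>)"
proof -
  assume \<alpha>: "\<alpha> \<in> prob01"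
  have "L i (vint \<alpha>) = (\<integral>t. L i (v t) \<partial>\<alpha>)"
    by (rule functional_vint[OF \<alpha>, of "L i" "D i"]) (simp_all add: L_add L_scale L_bound D_nonneg)
  also have "\<dots> = (\<integral>t. t ^ i \<partial>\<alpha>)"
    using prob01D(3)[OF \<alpha>] L_curve by (intro Bochner_Integration.integral_cong) auto
  finally show ?thesis .
qed

lemma L_diff: "x \<in> W \<Longrightarrow> y \<in> W \<Longrightarrow> L i (x - y) = L i x - L i y"
  using L_add[of "x - y" y i] W_closed by simp

lemma L_sum: "finite I \<Longrightarrow> (\<And>j. j \<in> I \<Longrightarrow> f j \<in> W) \<Longrightarrow> L i (\<Sum>j\<in>I. f j) = (\<Sum>j\<in>I. L i (f j))"
proof (induction I rule: finite_induct)
  case empty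
  then show ?case using L_add[of 0 0 i] W_closed by simp
qed (simp add: L_add W_closed)

text \<open>An average of vectors of norm at most 1 has norm at most 1, and \<open>l\<close>, which
  takes the value 1 there, gives the lower bound.\<close>

lemma norm_vint: "\<alpha> \<in> prob01 \<Longrightarrow> q (vint \<alpha>) = 1"
proof -
  assume \<alpha>: "\<alpha> \<in> prob01"
  have "l (vint \<alpha>) = (\<integral>t. l (v t) \<partial>\<alpha>)"
    by (rule functional_vint[OF \<alpha>, of l 1]) (simp_all add: l_add l_scale l_bound)
  also have "\<dots> = (\<integral>t. 1 \<partial>\<alpha>)"
    using prob01D(3)[OF \<alpha>] l_curve by (intro Bochner_Integration.integral_cong) auto
  finally have "l (vint \<alpha>) = 1" using integral_const_prob01[OF \<alpha>, of 1] by simp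
  then show ?thesis using l_bound[OF vint_hat(1)[OF \<alpha>]] vint_le_1[OF \<alpha>] by simp
qed

lemma inj_on_vint: "inj_on vint prob01"
proof (rule inj_onI)
  fix \<alpha> \<beta> assume "\<alpha> \<in> prob01" "\<beta> \<in> prob01" "vint \<alpha> = vint \<beta>"
  then show "\<alpha> = \<beta>" using L_vint by (intro prob01_eqI) metis+
qed

text \<open>For fixed \<open>n\<close> the hat sum depends on finitely many integrals of continuous
  functions, and it approximates the integral at the rate \<open>C / n\<close> for all measures at
  once. So a weak-star neighbourhood that controls these integrals suffices.\<close>

lemma continuous_map_vint: "continuous_map weak_star (norm_topology W q) vint"
proof (rule continuous_map_to_norm_topology[OF normed_space_on_axioms])
  show "vint ` topspace weak_star \<subseteq> W" using vint_hat(1) by (auto simp: topspace_weak_star)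
  fix \<alpha> and e :: real assume "\<alpha> \<in> topspace weak_star" and e: "e > 0"
  then have \<alpha>: "\<alpha> \<in> prob01" by (simp add: topspace_weak_star)
  obtain n where n: "n > 0" "C / real n < e / 4"
  proof -
    obtain n :: nat where "4 * C / e < real n" using reals_Archimedean2 by blast
    moreover then have "0 < real n" using C_nonneg e by (smt (verit) divide_nonneg_pos)
    ultimately show thesis using e by (intro that[of n]) (auto simp: field_simps)
  qed
  note P = hat_partition[OF n(1)]
  define d where "d \<beta> = (\<Sum>i\<le>n. \<bar>(\<integral>t. hat n i t \<partial>\<beta>) - (\<integral>t. hat n i t \<partial>\<alpha>)\<bar>)" for \<beta>
  have cont: "continuous_on {0..1} (hat n i)" for i
    unfolding hat_def[abs_def] by (intro continuous_intros)
  have "continuous_map weak_star euclideanreal d"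
    unfolding d_def[abs_def]
    by (intro continuous_map_sum continuous_map_real_abs continuous_map_diff continuous_map_const[THEN iffD2]
        continuous_map_weak_star_integral cont) auto
  then have op: "openin weak_star {\<beta> \<in> topspace weak_star. d \<beta> \<in> {..<e / 4}}"
    by (rule openin_continuous_map_preimage) auto
  have "q (vint \<alpha> - vint \<beta>) < e" if \<beta>: "\<beta> \<in> prob01" and d: "d \<beta> < e / 4" for \<beta>
  proof -
    have hW: "hat_sum \<alpha> n \<in> W" "hat_sum \<beta> n \<in> W"
      unfolding hat_sum_def by (rule psum_in[OF P])+
    note vW = vint_hat(1)[OF \<alpha>] vint_hat(1)[OF \<beta>]
    have "q (hat_sum \<alpha> n - hat_sum \<beta> n) = q (hat_sum \<beta> n - hat_sum \<alpha> n)" by (intro q_diff_commute hW)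
    also have "hat_sum \<beta> n - hat_sum \<alpha> n
        = (\<Sum>i\<le>n. rs ((\<integral>t. hat n i t \<partial>\<beta>) - (\<integral>t. hat n i t \<partial>\<alpha>)) (v (i / n)))"
      by (simp add: hat_sum_def psum_def scale_left_diff_distrib sum_subtractf)
    also have "q \<dots> \<le> d \<beta>"
      unfolding d_def
    proof (rule q_sum_le)
      fix i assume "i \<in> {..n}"
      then have s: "real i / n \<in> {0..1}" by (rule fine_partitionD(2)[OF P])
      then show "rs ((\<integral>t. hat n i t \<partial>\<beta>) - (\<integral>t. hat n i t \<partial>\<alpha>)) (v (i / n)) \<in> W" by (intro W_closed v_in)
      show "q (rs ((\<integral>t. hat n i t \<partial>\<beta>) - (\<integral>t. hat n i t \<partial>\<alpha>)) (v (i / n)))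
          \<le> \<bar>(\<integral>t. hat n i t \<partial>\<beta>) - (\<integral>t. hat n i t \<partial>\<alpha>)\<bar>"
        using v_bound[OF s] by (subst q_rs[OF v_in[OF s]]) (simp add: mult_left_le)
    qed simp
    finally have 1: "q (hat_sum \<alpha> n - hat_sum \<beta> n) < e / 4" using d by simp
    have 2: "q (vint \<alpha> - hat_sum \<alpha> n) < e / 4" "q (vint \<beta> - hat_sum \<beta> n) < e / 4"
      using vint_hat(2)[OF \<alpha> n(1)] vint_hat(2)[OF \<beta> n(1)] by (blast intro: order_le_less_trans n(2))+
    have "q (vint \<alpha> - vint \<beta>) \<le> q (vint \<alpha> - hat_sum \<alpha> n) + q (hat_sum \<alpha> n - vint \<beta>)"
      by (intro q_diff_triangle hW vW)
    moreover have "q (hat_sum \<alpha> n - vint \<beta>) \<le> q (hat_sum \<alpha> n - hat_sum \<beta> n) + q (hat_sum \<beta> n - vint \<beta>)"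
      by (intro q_diff_triangle hW vW)
    moreover have "q (hat_sum \<beta> n - vint \<beta>) = q (vint \<beta> - hat_sum \<beta> n)" by (intro q_diff_commute hW vW)
    ultimately show ?thesis using 1 2 e by argo
  qed
  moreover have "d \<alpha> = 0" by (simp add: d_def)
  ultimately show "\<exists>U. openin weak_star U \<and> \<alpha> \<in> U \<and> (\<forall>\<beta>\<in>U. q (vint \<alpha> - vint \<beta>) < e)"
    using op \<alpha> e by (intro exI[of _ "{\<beta> \<in> topspace weak_star. d \<beta> \<in> {..<e / 4}}"]) (auto simp: topspace_weak_star)
qed

text \<open>For the inverse, a test function is replaced uniformly by a polynomial. The integral of
  the polynomial is a fixed finite combination of the \<open>L i\<close> at the image point, hence
  continuous for the norm.\<close>

lemma embedding_map_vint: "embedding_map weak_star (norm_topology W q) vint"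
proof -
  let ?S = "vint ` prob01" and ?inv = "inv_into prob01 vint"
  have SW: "?S \<subseteq> W" using vint_hat(1) by auto
  have top: "topspace (subtopology (norm_topology W q) ?S) = ?S"
  proof -
    interpret M: Metric_space W "norm_dist W q" by (rule Metric_space_norm_dist[OF normed_space_on_axioms])
    show ?thesis using SW by (auto simp: norm_topology_def)
  qed
  have "continuous_map (subtopology (norm_topology W q) ?S) weak_star ?inv"
  proof (rule continuous_map_into_weak_star)
    show "?inv ` topspace (subtopology (norm_topology W q) ?S) \<subseteq> prob01"
      unfolding top by (auto intro: inv_into_into)
    fix f :: "real \<Rightarrow> real" assume cont: "continuous_on {0..1} f"
    show "continuous_map (subtopology (norm_topology W q) ?S) euclideanreal (\<lambda>w. \<integral>t. f t \<partial>?inv w)"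
    proof (rule continuous_map_from_norm_topology[OF normed_space_on_axioms SW])
      fix x and e :: real assume x: "x \<in> ?S" and e: "e > 0"
      obtain a m where am: "\<And>t. t \<in> {0..1} \<Longrightarrow> \<bar>f t - (\<Sum>i\<le>m. a i * t ^ i)\<bar> < e / 4"
        using polynomial_approximation_01[OF cont, of "e / 4"] e by auto
      have near: "\<bar>(\<integral>t. f t \<partial>?inv w) - (\<Sum>i\<le>m. a i * L i w)\<bar> \<le> e / 4" if "w \<in> ?S" for w
      proof -
        have \<alpha>: "?inv w \<in> prob01" and w: "vint (?inv w) = w" using that by (auto intro: inv_into_into f_inv_into_f)
        have "(\<Sum>i\<le>m. a i * L i w) = (\<integral>t. (\<Sum>i\<le>m. a i * t ^ i) \<partial>?inv w)"
          using L_vint[OF \<alpha>] w by (simp add: integral_polynomial_prob01(2)[OF \<alpha>])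
        then show ?thesis
          using am by (simp only:) (intro integral_diff_le_prob01[OF \<alpha>] integrable_continuous_prob01[OF \<alpha> cont]
              integral_polynomial_prob01(1)[OF \<alpha>] less_imp_le, blast)
      qed
      \<comment> \<open>A Lipschitz constant of the polynomial's integral as a function of the image
        point; below, \<open>K + 1\<close> avoids a division by 0.\<close>
      define K where "K = (\<Sum>i\<le>m. \<bar>a i\<bar> * D i)"
      have K: "K \<ge> 0" unfolding K_def using D_nonneg by (intro sum_nonneg) simp
      have "\<bar>(\<integral>t. f t \<partial>?inv x) - (\<integral>t. f t \<partial>?inv y)\<bar> < e" if y: "y \<in> ?S" and xy: "q (x - y) < e / (4 * (K + 1))" for y
      proof -
        have W: "x \<in> W" "y \<in> W" using x y SW by auto
        have "\<bar>(\<Sum>i\<le>m. a i * L i x) - (\<Sum>i\<le>m. a i * L i y)\<bar> = \<bar>\<Sum>i\<le>m. a i * L i (x - y)\<bar>"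
          by (simp add: L_diff[OF W] right_diff_distrib sum_subtractf)
        also have "\<dots> \<le> (\<Sum>i\<le>m. \<bar>a i\<bar> * D i * q (x - y))"
          using L_bound[OF W_closed(1)[OF W]]
          by (intro order_trans[OF sum_abs sum_mono]) (simp add: abs_mult mult.assoc mult_left_mono)
        also have "\<dots> = K * q (x - y)" by (simp add: K_def sum_distrib_right)
        also have "\<dots> \<le> (K + 1) * q (x - y)"
          using q_nonneg[OF W_closed(1)[OF W]] by (simp add: distrib_right)
        also have "\<dots> < (K + 1) * (e / (4 * (K + 1)))" using xy K by (intro mult_strict_left_mono) auto
        also have "\<dots> = e / 4" using K by (simp add: field_simps)
        finally show ?thesis using near[OF x] near[OF y] e unfolding abs_le_iff abs_less_iff by argo
      qed
      then show "\<exists>d>0. \<forall>y\<in>?S. q (x - y) < d \<longrightarrow> \<bar>(\<integral>t. f t \<partial>?inv x) - (\<integral>t. f t \<partial>?inv y)\<bar> < e"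
        using e K by (intro exI[of _ "e / (4 * (K + 1))"]) auto
    qed
  qed
  then have "homeomorphic_maps weak_star (subtopology (norm_topology W q) ?S) vint ?inv"
    using continuous_map_vint inj_on_vint top
    by (auto simp: homeomorphic_maps_def continuous_map_in_subtopology topspace_weak_star)
  then show ?thesis
    by (auto simp: embedding_map_def topspace_weak_star homeomorphic_map_maps)
qed

section \<open>Countable support and series over atoms\<close>

lemma countably_supported_if_atomic:
  assumes \<alpha>: "\<alpha> \<in> prob01" and b: "\<And>n. 0 \<le> b n" "b sums 1" and t: "\<And>n. t n \<in> {0..1}"
    and lim: "limitin (norm_topology W q) (\<lambda>k. \<Sum>n<k. rs (b n) (v (t n))) (vint \<alpha>) sequentially"
  shows "countably_supported \<alpha>"
proof (rule countably_supported_if_moments_eq[OF \<alpha> b t])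
  fix i
  let ?S = "\<lambda>k. \<Sum>n<k. rs (b n) (v (t n))"
  have SW: "?S k \<in> W" for k using v_in t by (intro W_closed) auto
  have LS: "L i (?S k) = (\<Sum>n<k. b n * t n ^ i)" for k
    using v_in t W_closed by (simp add: L_sum L_scale L_curve)
  have "(\<lambda>k. L i (?S k)) \<longlonglongrightarrow> L i (vint \<alpha>)"
    by (rule functional_tendsto[OF L_add L_bound D_nonneg SW lim])
  then show "(\<lambda>n. b n * t n ^ i) sums (\<integral>x. x ^ i \<partial>\<alpha>)"
    by (simp add: sums_def LS L_vint[OF \<alpha>])
qed

text \<open>Enumerate the support; the partial sums run over finite sets of atoms that exhaust it,
  and \<open>vint_atoms\<close> bounds the error by the mass still missing.\<close>

lemma atomic_if_countably_supported:
  assumes \<alpha>: "\<alpha> \<in> prob01" and c: "countably_supported \<alpha>"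
  obtains b t where "\<And>n. 0 \<le> b n" "b sums 1" "\<And>n. t n \<in> {0..1}"
    "limitin (norm_topology W q) (\<lambda>k. \<Sum>n<k. rs (b n) (v (t n))) (vint \<alpha>) sequentially"
proof -
  interpret prob_space \<alpha> using \<alpha> by (simp add: prob01_def)
  obtain A where A: "A \<subseteq> {0..1}" "countable A" "emeasure \<alpha> ({0..1} - A) = 0"
    using c by (auto simp: countably_supported_def)
  have meas: "B \<in> sets \<alpha>" if "B \<subseteq> A" for B
    using that A countable_subset[OF that] sets.countable[of B borel]
    by (auto simp: prob01D(2)[OF \<alpha>] sets_restrict_space_iff)
  have mA: "measure \<alpha> A = 1"
    using prob_compl[OF meas[of A]] A(3) by (simp add: prob01D(3)[OF \<alpha>] measure_def)
  define f where "f = to_nat_on A"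
  have f: "inj_on f A" unfolding f_def using A(2) by (rule inj_on_to_nat_on)
  \<comment> \<open>Indices that enumerate no point get the placeholder parameter 0 and weight 0, so
    finite and infinite supports are treated alike.\<close>
  define t where "t n = (if n \<in> f ` A then inv_into A f n else 0)" for n
  define b where "b n = (if n \<in> f ` A then measure \<alpha> {inv_into A f n} else 0)" for n
  define F where "F k = {a \<in> A. f a < k}" for k
  have fF: "f ` F k = f ` A \<inter> {..<k}" for k by (auto simp: F_def)
  have injF: "inj_on f (F k)" for k using f by (rule inj_on_subset) (auto simp: F_def)
  have finF: "finite (F k)" for k using fF[of k] finite_imageD[OF _ injF] by (metis finite_Int finite_lessThan)
  have FA: "F k \<subseteq> A" for k by (auto simp: F_def)
  have reindex: "(\<Sum>n<k. g n) = (\<Sum>a\<in>F k. g (f a))" if "\<And>n. n \<notin> f ` A \<Longrightarrow> g n = 0" for g :: "nat \<Rightarrow> 'b::comm_monoid_add" and k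
  proof -
    have "(\<Sum>n<k. g n) = (\<Sum>n\<in>f ` F k. g n)" using that fF by (intro sum.mono_neutral_right) auto
    also have "\<dots> = (\<Sum>a\<in>F k. g (f a))" by (simp add: sum.reindex[OF injF])
    finally show ?thesis .
  qed
  have tf: "t (f a) = a" "b (f a) = measure \<alpha> {a}" if "a \<in> A" for a
    using that f by (simp_all add: t_def b_def)
  have b0: "b n = 0" if "n \<notin> f ` A" for n using that by (simp add: b_def)
  have "(\<Sum>n<k. b n) = (\<Sum>a\<in>F k. b (f a))" for k by (rule reindex[OF b0])
  also have "(\<Sum>a\<in>F k. b (f a)) = (\<Sum>a\<in>F k. measure \<alpha> {a})" for k
    using FA tf by (intro sum.cong) auto
  also have "(\<Sum>a\<in>F k. measure \<alpha> {a}) = measure \<alpha> (F k)" for k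
  proof (rule finite_measure_eq_sum_singleton[symmetric, OF finF])
    show "{a} \<in> sets \<alpha>" if "a \<in> F k" for a using that FA[of k] by (intro meas) auto
  qed
  finally have sum_b: "(\<Sum>n<k. b n) = measure \<alpha> (F k)" for k .
  have sum_v: "(\<Sum>n<k. rs (b n) (v (t n))) = (\<Sum>a\<in>F k. rs (measure \<alpha> {a}) (v a))" for k
  proof -
    have "(\<Sum>n<k. rs (b n) (v (t n))) = (\<Sum>a\<in>F k. rs (b (f a)) (v (t (f a))))"
      by (rule reindex) (simp add: b0)
    also have "\<dots> = (\<Sum>a\<in>F k. rs (measure \<alpha> {a}) (v a))"
      using subsetD[OF FA] by (intro sum.cong refl) (simp add: tf)
    finally show ?thesis .
  qed
  have "(\<lambda>k. measure \<alpha> (F k)) \<longlonglongrightarrow> measure \<alpha> (\<Union>k. F k)"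
    using FA meas by (intro finite_Lim_measure_incseq) (auto simp: incseq_def F_def)
  moreover have "(\<Union>k. F k) = A" by (auto simp: F_def)
  ultimately have limF: "(\<lambda>k. measure \<alpha> (F k)) \<longlonglongrightarrow> 1" using mA by simp
  show thesis
  proof (rule that)
    show "0 \<le> b n" for n by (simp add: b_def)
    show "b sums 1" using limF by (simp add: sums_def sum_b)
    show t01: "t n \<in> {0..1}" for n using A(1) inv_into_into[of n f A] by (auto simp: t_def)
    have SW: "(\<Sum>n<k. rs (b n) (v (t n))) \<in> W" for k by (intro W_closed v_in t01)
    show "limitin (norm_topology W q) (\<lambda>k. \<Sum>n<k. rs (b n) (v (t n))) (vint \<alpha>) sequentially"
      unfolding limitin_norm_topology[OF normed_space_on_axioms SW]
    proof (intro conjI allI impI vint_hat(1)[OF \<alpha>])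
      fix e :: real assume "e > 0"
      then have "\<forall>\<^sub>F k in sequentially. 1 - e < measure \<alpha> (F k)" by (intro order_tendstoD(1)[OF limF]) simp
      then obtain K where K: "\<And>k. k \<ge> K \<Longrightarrow> 1 - e < measure \<alpha> (F k)" by (auto simp: eventually_sequentially)
      have "q ((\<Sum>n<k. rs (b n) (v (t n))) - vint \<alpha>) < e" if "k \<ge> K" for k
        using vint_atoms[OF \<alpha> finF order_trans[OF FA A(1)], of k] K[OF that] q_diff_commute[OF SW[of k] vint_hat(1)[OF \<alpha>]]
        by (simp add: sum_v)
      then show "\<exists>K. \<forall>k\<ge>K. q ((\<Sum>n<k. rs (b n) (v (t n))) - vint \<alpha>) < e" by blast
    qed
  qed
qed

end

section \<open>Integral norm attainment\<close>

lemma space_ball_borel: "space (ball_borel N M) = unit_ball N \<times> unit_ball M"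
  and sets_ball_borel: "sets (ball_borel N M) = sigma_sets (unit_ball N \<times> unit_ball M)
    {U. openin (subtopology (prod_topology (norm_topology UNIV N) (norm_topology UNIV M)) (unit_ball N \<times> unit_ball M)) U}"
proof -
  have "{U. openin (subtopology (prod_topology (norm_topology UNIV N) (norm_topology UNIV M)) (unit_ball N \<times> unit_ball M)) U}
      \<subseteq> Pow (unit_ball N \<times> unit_ball M)"
    using openin_subset by fastforce
  then show "space (ball_borel N M) = unit_ball N \<times> unit_ball M"
    "sets (ball_borel N M) = sigma_sets (unit_ball N \<times> unit_ball M)
      {U. openin (subtopology (prod_topology (norm_topology UNIV N) (norm_topology UNIV M)) (unit_ball N \<times> unit_ball M)) U}"
    by (simp_all add: ball_borel_def Let_def)
qed

lemma topspace_norm_topology: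
  assumes "normed_space_on scl V p"
  shows "topspace (norm_topology V p) = V"
proof -
  interpret Metric_space V "norm_dist V p" by (rule Metric_space_norm_dist[OF assms])
  show ?thesis by (simp add: norm_topology_def)
qed

lemma borel_measurable_ball_borel:
  fixes h :: "_ \<Rightarrow> real"
  assumes X: "normed_space_on sX UNIV N" and Y: "normed_space_on sY UNIV M"
    and h: "continuous_map (prod_topology (norm_topology UNIV N) (norm_topology UNIV M)) euclideanreal h"
  shows "h \<in> borel_measurable (ball_borel N M)"
proof (rule borel_measurableI)
  fix S :: "real set" assume S: "open S"
  let ?T = "prod_topology (norm_topology UNIV N) (norm_topology UNIV M)" and ?D = "unit_ball N \<times> unit_ball M"
  have "openin ?T {z \<in> topspace ?T. h z \<in> S}"
    using h S by (intro openin_continuous_map_preimage) auto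
  then have "openin (subtopology ?T ?D) ({z \<in> topspace ?T. h z \<in> S} \<inter> ?D)"
    by (auto simp: openin_subtopology)
  moreover have "{z \<in> topspace ?T. h z \<in> S} \<inter> ?D = h -` S \<inter> space (ball_borel N M)"
    by (auto simp: topspace_norm_topology[OF X] topspace_norm_topology[OF Y] space_ball_borel)
  ultimately show "h -` S \<inter> space (ball_borel N M) \<in> sets (ball_borel N M)"
    by (auto simp: sets_ball_borel)
qed

lemma continuous_map_lipschitz:
  assumes N: "normed_space_on scl UNIV N" and h: "\<And>x y. \<bar>h x - h y\<bar> \<le> K * N (x - y)"
  shows "continuous_map (norm_topology UNIV N) euclideanreal h"
proof -
  have "continuous_map (subtopology (norm_topology UNIV N) UNIV) euclideanreal h"
  proof (rule continuous_map_from_norm_topology[OF N])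
    fix x and e :: real assume e: "e > 0"
    have "\<bar>h x - h y\<bar> < e" if "N (x - y) < e / (\<bar>K\<bar> + 1)" for y
    proof -
      have nn: "0 \<le> N (x - y)" using norm_nonneg_on[OF N, of "x - y"] by simp
      have "\<bar>h x - h y\<bar> \<le> K * N (x - y)" by (rule h)
      also have "\<dots> \<le> (\<bar>K\<bar> + 1) * N (x - y)" using nn by (intro mult_right_mono) auto
      also have "\<dots> < (\<bar>K\<bar> + 1) * (e / (\<bar>K\<bar> + 1))" using that by (intro mult_strict_left_mono) auto
      also have "\<dots> = e" by (simp add: field_simps)
      finally show ?thesis .
    qed
    then show "\<exists>d>0. \<forall>y\<in>UNIV. N (x - y) < d \<longrightarrow> \<bar>h x - h y\<bar> < e"
      using e by (intro exI[of _ "e / (\<bar>K\<bar> + 1)"]) auto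
  qed simp
  then show ?thesis by simp
qed

text \<open>The functional \<open>G\<close> is a Lipschitz left inverse of the curve, defined on the
  whole space. It allows the parameter to be read off at every point of the ball, as is needed to
  define simple functions there.\<close>

locale lifted_curve = curve_in_banach sW W q v C
  for sW :: "'k::real_normed_field \<Rightarrow> 'w::ab_group_add \<Rightarrow> 'w" and W q v C +
  fixes scl :: "'k \<Rightarrow> 'a::ab_group_add \<Rightarrow> 'a" and N :: "'a \<Rightarrow> real" and \<gamma> :: "real \<Rightarrow> 'a"
    and \<tau> :: "'a \<Rightarrow> 'a \<Rightarrow> 'w" and G :: "'a \<Rightarrow> real" and K :: real
  assumes N: "normed_space_on scl UNIV N"
    and v_eq: "t \<in> {0..1} \<Longrightarrow> v t = \<tau> (\<gamma> t) (\<gamma> t)" and v_inj: "inj_on v {0..1}"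
    and \<tau>_in: "\<tau> x y \<in> W"
    and \<gamma>_ball: "t \<in> {0..1} \<Longrightarrow> N (\<gamma> t) \<le> 1"
    and \<gamma>_lipschitz: "s \<in> {0..1} \<Longrightarrow> t \<in> {0..1} \<Longrightarrow> N (\<gamma> s - \<gamma> t) \<le> K * \<bar>s - t\<bar>"
    and G_lipschitz: "\<bar>G x - G y\<bar> \<le> K * N (x - y)" and G_curve: "t \<in> {0..1} \<Longrightarrow> G (\<gamma> t) = t"
begin

interpretation X: normed_space_on scl UNIV N by (rule N)

lemma N_nonneg: "0 \<le> N x"
  using norm_nonneg_on[OF N, of x] by simp

text \<open>The target is generated by the open sets of the product topology, so the argument goes
  through continuity; measurability of the two coordinates would not suffice in general.\<close>

lemma diagonal_measurable: "(\<lambda>t. (\<gamma> t, \<gamma> t)) \<in> measurable (restrict_space borel {0..1}) (ball_borel N N)"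
proof -
  let ?T = "prod_topology (norm_topology UNIV N) (norm_topology UNIV N)" and ?D = "unit_ball N \<times> unit_ball N"
  let ?\<delta> = "\<lambda>t. (\<gamma> t, \<gamma> t)"
  have \<gamma>: "continuous_map (top_of_set {0..1}) (norm_topology UNIV N) \<gamma>"
  proof (rule continuous_map_to_norm_topology[OF N])
    fix t and e :: real assume t: "t \<in> topspace (top_of_set {0..1::real})" and e: "e > 0"
    let ?U = "{0..1} \<inter> ball t (e / (\<bar>K\<bar> + 1))"
    have "N (\<gamma> t - \<gamma> s) < e" if s: "s \<in> ?U" for s
    proof -
      have "N (\<gamma> t - \<gamma> s) \<le> K * \<bar>t - s\<bar>" using s t by (intro \<gamma>_lipschitz) auto
      also have "\<dots> \<le> (\<bar>K\<bar> + 1) * \<bar>t - s\<bar>" by (intro mult_right_mono) auto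
      also have "\<dots> < (\<bar>K\<bar> + 1) * (e / (\<bar>K\<bar> + 1))"
        using s by (intro mult_strict_left_mono) (auto simp: dist_real_def)
      also have "\<dots> = e" by (simp add: field_simps)
      finally show ?thesis .
    qed
    moreover have "openin (top_of_set {0..1}) ?U" by (auto simp: openin_open)
    ultimately show "\<exists>U. openin (top_of_set {0..1}) U \<and> t \<in> U \<and> (\<forall>s\<in>U. N (\<gamma> t - \<gamma> s) < e)"
      using t e by (intro exI[of _ ?U]) auto
  qed simp
  have "continuous_map (top_of_set {0..1}) (subtopology ?T ?D) ?\<delta>"
    using \<gamma> \<gamma>_ball by (auto simp: continuous_map_in_subtopology continuous_map_pairwise o_def unit_ball_def)
  then have pre: "openin (top_of_set {0..1}) {t \<in> {0..1}. ?\<delta> t \<in> U}" if "openin (subtopology ?T ?D) U" for U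
    using openin_continuous_map_preimage[OF _ that] by fastforce
  show ?thesis
    unfolding ball_borel_def Let_def
  proof (rule measurable_measure_of)
    show "{U. openin (subtopology ?T ?D) U} \<subseteq> Pow ?D" using openin_subset by fastforce
    show "?\<delta> \<in> space (restrict_space borel {0..1}) \<rightarrow> ?D"
      using \<gamma>_ball by (auto simp: space_restrict_space unit_ball_def)
    fix U assume "U \<in> {U. openin (subtopology ?T ?D) U}"
    then obtain S where S: "open S" "{t \<in> {0..1}. ?\<delta> t \<in> U} = {0..1} \<inter> S"
      using pre by (auto simp: openin_open)
    have "?\<delta> -` U \<inter> space (restrict_space borel {0..1}) = {t \<in> {0..1}. ?\<delta> t \<in> U}"
      by (auto simp: space_restrict_space)
    also have "\<dots> \<in> sets (restrict_space borel {0..1})"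
      unfolding S(2) using S(1) by (auto simp: sets_restrict_space)
    finally show "?\<delta> -` U \<inter> space (restrict_space borel {0..1}) \<in> sets (restrict_space borel {0..1})" .
  qed
qed

text \<open>Away from the curve \<open>G\<close> may leave the unit interval, where nothing is known
  about \<open>\<gamma>\<close>. This retraction is 1-Lipschitz, so \<open>off\<close> stays
  Lipschitz.\<close>

definition clip :: "real \<Rightarrow> real" where
  "clip t = max 0 (min 1 t)"

text \<open>The zero set of this function is the curve, so the diagonal over the curve is a Borel set.\<close>

definition off :: "'a \<Rightarrow> real" where
  "off x = N (x - \<gamma> (clip (G x)))"

lemma off_lipschitz: "\<bar>off x - off y\<bar> \<le> (1 + \<bar>K\<bar> * \<bar>K\<bar>) * N (x - y)"
proof -
  have c: "clip t \<in> {0..1}" "\<bar>clip s - clip t\<bar> \<le> \<bar>s - t\<bar>" for s t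
    by (auto simp: clip_def abs_if max_def min_def)
  have 1: "off x - off y \<le> (1 + \<bar>K\<bar> * \<bar>K\<bar>) * N (x - y)" for x y
  proof -
    have "N (x - \<gamma> (clip (G x))) \<le> N (x - y) + N (y - \<gamma> (clip (G x)))"
      by (rule norm_diff_triangle[OF N]) auto
    moreover have "N (y - \<gamma> (clip (G x))) \<le> N (y - \<gamma> (clip (G y))) + N (\<gamma> (clip (G y)) - \<gamma> (clip (G x)))"
      by (rule norm_diff_triangle[OF N]) auto
    moreover have "N (\<gamma> (clip (G y)) - \<gamma> (clip (G x))) \<le> \<bar>K\<bar> * (\<bar>K\<bar> * N (x - y))"
    proof -
      have "N (\<gamma> (clip (G y)) - \<gamma> (clip (G x))) \<le> K * \<bar>clip (G y) - clip (G x)\<bar>" by (intro \<gamma>_lipschitz c)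
      also have "\<dots> \<le> \<bar>K\<bar> * \<bar>clip (G y) - clip (G x)\<bar>" by (intro mult_right_mono) auto
      also have "\<dots> \<le> \<bar>K\<bar> * (\<bar>K\<bar> * N (x - y))"
      proof (intro mult_left_mono)
        have "\<bar>clip (G y) - clip (G x)\<bar> \<le> \<bar>G y - G x\<bar>" by (rule c)
        also have "\<dots> \<le> K * N (x - y)" using G_lipschitz[of x y] by (simp add: abs_minus_commute)
        also have "\<dots> \<le> \<bar>K\<bar> * N (x - y)" using N_nonneg by (intro mult_right_mono) auto
        finally show "\<bar>clip (G y) - clip (G x)\<bar> \<le> \<bar>K\<bar> * N (x - y)" .
      qed simp
      finally show ?thesis .
    qed
    ultimately show ?thesis by (simp add: off_def algebra_simps)
  qed
  have "N (y - x) = N (x - y)" by (rule norm_diff_commute[OF N]) auto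
  then show ?thesis using 1[of x y] 1[of y x] by (simp add: abs_le_iff)
qed

text \<open>The representing measure is the image of \<open>\<alpha>\<close> under \<open>t\<close>
  mapped to \<open>(\<gamma> t, \<gamma> t)\<close>. The simple functions read the parameter by
  \<open>G\<close> and round it down to a grid, so that their integrals are exactly the cell sums of
  \<open>\<alpha>\<close>.\<close>

lemma vint_INA:
  assumes \<alpha>: "\<alpha> \<in> prob01" and norm1: "q (vint \<alpha>) = 1"
  shows "vint \<alpha> \<in> INA_proj N N sW W q \<tau>"
proof -
  let ?B = "ball_borel N N" and ?\<delta> = "\<lambda>t. (\<gamma> t, \<gamma> t)"
  define \<mu> where "\<mu> = distr \<alpha> ?B ?\<delta>"
  note PD = prob01D[OF \<alpha>]
  have \<delta>: "?\<delta> \<in> measurable \<alpha> ?B" unfolding PD(4) by (rule diagonal_measurable)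
  have prob: "prob_space \<mu>" unfolding \<mu>_def by (rule prob_space.prob_space_distr[OF PD(1) \<delta>])
  interpret \<mu>: prob_space \<mu> by (rule prob)
  have sets_\<mu>: "sets \<mu> = sets ?B" and space_\<mu>: "space \<mu> = unit_ball N \<times> unit_ball N"
    by (simp_all add: \<mu>_def space_ball_borel)
  have G1: "(\<lambda>z. G (fst z)) \<in> borel_measurable ?B" and H: "(\<lambda>z. off (fst z) + off (snd z) + \<bar>G (fst z) - G (snd z)\<bar>) \<in> borel_measurable ?B"
  proof -
    have "continuous_map (prod_topology (norm_topology UNIV N) (norm_topology UNIV N)) euclideanreal (\<lambda>z. h (fst z))"
      "continuous_map (prod_topology (norm_topology UNIV N) (norm_topology UNIV N)) euclideanreal (\<lambda>z. h (snd z))"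
      if "continuous_map (norm_topology UNIV N) euclideanreal h" for h
      using continuous_map_compose[OF continuous_map_fst that] continuous_map_compose[OF continuous_map_snd that]
      by (simp_all add: o_def)
    then have m: "(\<lambda>z. h (fst z)) \<in> borel_measurable ?B" "(\<lambda>z. h (snd z)) \<in> borel_measurable ?B"
      if "\<And>x y. \<bar>h x - h y\<bar> \<le> c * N (x - y)" for h c
      using continuous_map_lipschitz[OF N that] by (auto intro: borel_measurable_ball_borel[OF N N])
    note mm = m[OF G_lipschitz] m[OF off_lipschitz]
    show "(\<lambda>z. G (fst z)) \<in> borel_measurable ?B" by (rule mm)
    show "(\<lambda>z. off (fst z) + off (snd z) + \<bar>G (fst z) - G (snd z)\<bar>) \<in> borel_measurable ?B"
      using mm by measurable
  qed
  \<comment> \<open>Transferring the statement to \<open>\<alpha>\<close> requires a measurable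
    condition, so the diagonal over the curve is described as a zero set: \<open>off\<close> puts
    both coordinates on the curve, and equality of \<open>G\<close> makes their parameters
    agree.\<close>
  have on_curve: "AE z in \<mu>. \<exists>t\<in>{0..1}. z = ?\<delta> t"
  proof -
    have "{z \<in> space ?B. off (fst z) + off (snd z) + \<bar>G (fst z) - G (snd z)\<bar> = 0} \<in> sets ?B"
      using H by measurable
    then have "(AE z in \<mu>. off (fst z) + off (snd z) + \<bar>G (fst z) - G (snd z)\<bar> = 0) \<longleftrightarrow>
        (AE t in \<alpha>. off (\<gamma> t) + off (\<gamma> t) + \<bar>G (\<gamma> t) - G (\<gamma> t)\<bar> = 0)"
      unfolding \<mu>_def by (subst AE_distr_iff[OF \<delta>]) auto
    moreover have "AE t in \<alpha>. off (\<gamma> t) + off (\<gamma> t) + \<bar>G (\<gamma> t) - G (\<gamma> t)\<bar> = 0"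
    proof (rule AE_I2)
      fix t assume "t \<in> space \<alpha>"
      then have t: "t \<in> {0..1}" by (simp add: PD)
      then have "clip (G (\<gamma> t)) = t" by (simp add: G_curve clip_def)
      then have "off (\<gamma> t) = 0" by (simp add: off_def X.norm_eq_0_iff)
      then show "off (\<gamma> t) + off (\<gamma> t) + \<bar>G (\<gamma> t) - G (\<gamma> t)\<bar> = 0" by simp
    qed
    ultimately have "AE z in \<mu>. off (fst z) + off (snd z) + \<bar>G (fst z) - G (snd z)\<bar> = 0" by simp
    then show ?thesis
    proof (rule eventually_mono)
      fix z :: "'a \<times> 'a" assume z: "off (fst z) + off (snd z) + \<bar>G (fst z) - G (snd z)\<bar> = 0"
      have nn: "off (fst z) \<ge> 0" "off (snd z) \<ge> 0" by (simp_all add: off_def N_nonneg)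
      then have 0: "off (fst z) = 0" "off (snd z) = 0" "G (fst z) = G (snd z)" using z by auto
      then have "fst z = \<gamma> (clip (G (fst z)))" "snd z = \<gamma> (clip (G (fst z)))"
        by (auto simp: off_def X.norm_eq_0_iff)
      moreover have "clip (G (fst z)) \<in> {0..1}" by (simp add: clip_def)
      ultimately show "\<exists>t\<in>{0..1}. z = ?\<delta> t" by (metis prod.collapse)
    qed
  qed
  \<comment> \<open>Rounding down is truncated to \<open>0..n\<close>, so that \<open>s n\<close> is
    defined on the whole ball with finitely many values; only for parameters in the unit interval
    does it have to match the cells.\<close>
  define k where "k n x = min n (nat \<lfloor>real n * x\<rfloor>)" for n :: nat and x :: real
  define s where "s n z = v (real (k (Suc n) (G (fst z))) / real (Suc n))" for n and z :: "'a \<times> 'a"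
  have k01: "real (k (Suc n) x) / real (Suc n) \<in> {0..1}" for n x by (simp add: k_def)
  have sW: "s n z \<in> W" for n z unfolding s_def by (intro v_in k01)
  have k_cell: "k n t = i \<longleftrightarrow> t \<in> cell n i" if "n > 0" "t \<in> {0..1}" for n i t
  proof -
    have "nat \<lfloor>real n * t\<rfloor> \<le> n" using cell_bound(1)[OF that] by (simp add: cell_def)
    then show ?thesis by (simp add: k_def cell_def)
  qed
  have simple: "simple_function \<mu> (s n)" for n
  proof -
    have "simple_function \<mu> (\<lambda>z. k (Suc n) (G (fst z)))"
      unfolding simple_function_eq_measurable
    proof
      show "finite ((\<lambda>z. k (Suc n) (G (fst z))) ` space \<mu>)"
        by (rule finite_subset[of _ "{..Suc n}"]) (auto simp: k_def)
      have "(\<lambda>x. k (Suc n) x) \<in> measurable borel (count_space UNIV)" unfolding k_def by measurable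
      then show "(\<lambda>z. k (Suc n) (G (fst z))) \<in> measurable \<mu> (count_space UNIV)"
        unfolding measurable_cong_sets[OF sets_\<mu> refl] using G1 by (rule measurable_compose[rotated])
    qed
    then show ?thesis unfolding s_def[abs_def] by (rule simple_function_compose1)
  qed
  have near: "AE z in \<mu>. q ((\<lambda>(x, y). \<tau> x y) z - s n z) \<le> C / real (Suc n)" for n
    using on_curve
  proof (rule eventually_mono)
    fix z assume "\<exists>t\<in>{0..1}. z = ?\<delta> t"
    then obtain t where t: "t \<in> {0..1}" "z = ?\<delta> t" by blast
    let ?i = "k (Suc n) t"
    have "t \<in> cell (Suc n) ?i" using k_cell[of "Suc n" t ?i] t by simp
    then have "\<bar>t - ?i / Suc n\<bar> \<le> 1 / Suc n" using t by (intro cell_bound(2)) auto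
    then have "q (v t - v (?i / Suc n)) \<le> C * (1 / Suc n)"
      using v_lipschitz[OF t(1) k01] mult_left_mono[OF _ C_nonneg] by (meson order_trans)
    then show "q ((\<lambda>(x, y). \<tau> x y) z - s n z) \<le> C / real (Suc n)"
      using t by (simp add: s_def G_curve v_eq)
  qed
  have integral: "simple_integral_on sW \<mu> (s n) = cell_sum \<alpha> (Suc n)" for n
  proof -
    let ?m = "Suc n"
    let ?g = "\<lambda>i. v (real i / real ?m)"
    \<comment> \<open>The integral of a simple function is a sum over values, the cell sum one over
      grid indices; injectivity of \<open>v\<close> identifies the two.\<close>
    have inj: "inj_on ?g {..?m}"
    proof (rule inj_onI)
      fix i j assume ij: "i \<in> {..?m}" "j \<in> {..?m}" "?g i = ?g j"
      then have "real i / real ?m = real j / real ?m" by (intro inj_onD[OF v_inj]) auto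
      then show "i = j" by (simp del: of_nat_Suc)
    qed
    have "simple_integral_on sW \<mu> (s n) = (\<Sum>w\<in>?g ` {..?m}. rs (measure \<mu> (s n -` {w} \<inter> space \<mu>)) w)"
      unfolding simple_integral_on_def
    proof (rule sum.mono_neutral_left)
      show "s n ` space \<mu> \<subseteq> ?g ` {..?m}" by (auto simp: s_def k_def)
      show "\<forall>w\<in>?g ` {..?m} - s n ` space \<mu>. rs (measure \<mu> (s n -` {w} \<inter> space \<mu>)) w = 0"
      proof
        fix w assume "w \<in> ?g ` {..?m} - s n ` space \<mu>"
        then have "w \<notin> s n ` space \<mu>" by blast
        then have "s n -` {w} \<inter> space \<mu> = {}" by blast
        then show "rs (measure \<mu> (s n -` {w} \<inter> space \<mu>)) w = 0" by simp
      qed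
    qed simp
    also have "\<dots> = (\<Sum>i\<le>?m. rs (measure \<mu> (s n -` {?g i} \<inter> space \<mu>)) (?g i))"
      by (subst sum.reindex[OF inj]) (simp only: o_def)
    also have "\<dots> = (\<Sum>i\<le>?m. rs (measure \<alpha> (cell ?m i \<inter> {0..1})) (?g i))"
    proof (intro sum.cong refl arg_cong2[where f = sW] arg_cong[where f = of_real])
      fix i assume i: "i \<in> {..?m}"
      have "s n -` {?g i} \<inter> space \<mu> \<in> sets \<mu>" using simple_functionD(2)[OF simple] .
      then have "measure \<mu> (s n -` {?g i} \<inter> space \<mu>) = measure \<alpha> (?\<delta> -` (s n -` {?g i} \<inter> space \<mu>) \<inter> space \<alpha>)"
        unfolding \<mu>_def by (subst measure_distr[OF \<delta>]) auto
      also have "?\<delta> -` (s n -` {?g i} \<inter> space \<mu>) \<inter> space \<alpha> = cell ?m i \<inter> {0..1}"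
      proof -
        have "s n (?\<delta> t) = ?g i \<longleftrightarrow> t \<in> cell ?m i" if t: "t \<in> {0..1}" for t
        proof -
          have "k ?m t \<in> {..?m}" by (simp add: k_def)
          then have "s n (?\<delta> t) = ?g i \<longleftrightarrow> k ?m t = i"
            using inj_on_eq_iff[OF inj _ i] by (simp add: s_def G_curve[OF t])
          then show ?thesis using k_cell[of ?m t i] t by simp
        qed
        moreover have "?\<delta> t \<in> space \<mu>" if "t \<in> {0..1}" for t
          using \<gamma>_ball[OF that] by (simp add: space_\<mu> unit_ball_def)
        ultimately show ?thesis by (auto simp: PD(3))
      qed
      finally show "measure \<mu> (s n -` {?g i} \<inter> space \<mu>) = measure \<alpha> (cell ?m i \<inter> {0..1})" .
    qed
    also have "\<dots> = cell_sum \<alpha> ?m" by (simp add: cell_sum_eq[OF \<alpha>])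
    finally show ?thesis .
  qed
  have C0: "(\<lambda>n. C / real (Suc n)) \<longlonglongrightarrow> 0"
    using tendsto_mult[OF tendsto_const[of C] LIMSEQ_Suc[OF lim_1_over_n]] by simp
  have small: "\<exists>M. \<forall>n\<ge>M. C / real (Suc n) < e" if "e > 0" for e
    using order_tendstoD(2)[OF C0 that] by (simp add: eventually_sequentially)
  have "has_bochner_integral_on sW W q \<mu> (\<lambda>(x, y). \<tau> x y) (vint \<alpha>)"
    unfolding has_bochner_integral_on_def
  proof (intro exI[of _ s] conjI allI)
    show "simple_function \<mu> (s n)" "s n ` space \<mu> \<subseteq> W" for n using simple sW by auto
    have "AE z in \<mu>. \<forall>n. q ((\<lambda>(x, y). \<tau> x y) z - s n z) \<le> C / real (Suc n)"
      using near by (simp add: AE_all_countable)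
    then show "AE z in \<mu>. limitin (norm_topology W q) (\<lambda>n. s n z) ((\<lambda>(x, y). \<tau> x y) z) sequentially"
    proof (rule eventually_mono)
      fix z assume z: "\<forall>n. q ((\<lambda>(x, y). \<tau> x y) z - s n z) \<le> C / real (Suc n)"
      let ?u = "(\<lambda>(x, y). \<tau> x y) z"
      have u: "?u \<in> W" using \<tau>_in by (simp add: case_prod_beta)
      have "q (s n z - ?u) \<le> C / real (Suc n)" for n
        using z q_diff_commute[OF sW u] by simp
      then show "limitin (norm_topology W q) (\<lambda>n. s n z) ?u sequentially"
        unfolding limitin_norm_topology[OF normed_space_on_axioms sW] using u small by (meson order_le_less_trans)
    qed
    show "(\<lambda>n. \<integral>\<^sup>+ z. ennreal (q ((\<lambda>(x, y). \<tau> x y) z - s n z)) \<partial>\<mu>) \<longlonglongrightarrow> 0"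
    proof (rule tendsto_sandwich[OF _ _ tendsto_const])
      show "(\<lambda>n. ennreal (C / real (Suc n))) \<longlonglongrightarrow> 0" using tendsto_ennrealI[OF C0] by simp
      have "(\<integral>\<^sup>+ z. ennreal (q ((\<lambda>(x, y). \<tau> x y) z - s n z)) \<partial>\<mu>) \<le> ennreal (C / real (Suc n))" for n
      proof -
        have "(\<integral>\<^sup>+ z. ennreal (q ((\<lambda>(x, y). \<tau> x y) z - s n z)) \<partial>\<mu>) \<le> (\<integral>\<^sup>+ z. ennreal (C / real (Suc n)) \<partial>\<mu>)"
          using near[of n] by (intro nn_integral_mono_AE) (auto intro: ennreal_leI elim: eventually_mono)
        then show ?thesis by (simp add: \<mu>.emeasure_space_1)
      qed
      then show "\<forall>\<^sub>F n in sequentially. (\<integral>\<^sup>+ z. ennreal (q ((\<lambda>(x, y). \<tau> x y) z - s n z)) \<partial>\<mu>) \<le> ennreal (C / real (Suc n))"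
        by simp
    qed simp
    have cW: "cell_sum \<alpha> (Suc n) \<in> W" for n unfolding cell_sum_def by (rule psum_in[OF cell_partition]) simp
    have "q (cell_sum \<alpha> (Suc n) - vint \<alpha>) \<le> C / real (Suc n)" for n
      using vint_psum[OF \<alpha> cell_partition[of "Suc n"]] q_diff_commute[OF cW[of n] vint_hat(1)[OF \<alpha>]]
      by (simp add: cell_sum_def)
    then show "limitin (norm_topology W q) (\<lambda>n. simple_integral_on sW \<mu> (s n)) (vint \<alpha>) sequentially"
      unfolding integral limitin_norm_topology[OF normed_space_on_axioms cW]
      using small vint_hat(1)[OF \<alpha>] by (meson order_le_less_trans)
  qed
  then show ?thesis
    unfolding INA_proj_def using sets_\<mu> \<mu>.finite_measure_axioms \<mu>.prob_space norm1 vint_hat(1)[OF \<alpha>] by auto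
qed

end

section \<open>The moment curve\<close>

text \<open>The curve is a norm-convergent power series in biorthogonal vectors. The functionals are
  bounded, so they pass through the series and pick out single coefficients.\<close>

lemma moment_curve_exists:
  fixes scl :: "'k::real_or_complex \<Rightarrow> 'a::banach \<Rightarrow> 'a"
  assumes X: "normed_space_on scl UNIV norm" and inf: "infinite_dimensional scl"
  obtains \<gamma> :: "real \<Rightarrow> 'a" and f :: "nat \<Rightarrow> 'a \<Rightarrow> 'k"
  where "\<And>n x y. f n (x + y) = f n x + f n y" "\<And>n c x. f n (scl c x) = c * f n x"
    "\<And>n. \<exists>c\<ge>0. \<forall>x. norm (f n x) \<le> c * norm x"
    "\<And>t. t \<in> {0..1} \<Longrightarrow> norm (\<gamma> t) \<le> 2"
    "\<And>s t. s \<in> {0..1} \<Longrightarrow> t \<in> {0..1} \<Longrightarrow> norm (\<gamma> s - \<gamma> t) \<le> 2 * \<bar>s - t\<bar>"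
    "\<And>n t. t \<in> {0..1} \<Longrightarrow> f n (\<gamma> t) = of_real (t ^ n)"
proof -
  interpret X: normed_space_on scl UNIV norm by (rule X)
  \<comment> \<open>The powers of 1/2 bound the series by 2, and \<open>1 / Suc n\<close> absorbs
    the Lipschitz constant \<open>n\<close> of the n-th power on the unit interval.\<close>
  define r where "r n = (1/2) ^ n / real (Suc n)" for n
  have r: "r n > 0" for n by (simp add: r_def)
  obtain e f where lin: "\<And>n. Vector_Spaces.linear scl (*) (f n)"
    and bd: "\<And>n. \<exists>c\<ge>0. \<forall>x. norm (f n x :: 'k) \<le> c * norm x" and e: "\<And>n. norm (e n) \<le> r n"
    and orth: "\<And>i j. f i (e j) = (if i = j then 1 else 0)"
    using infinite_dimensional_biorthogonal_sequence[OF X inf, of r] r by blast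
  have add: "f n (x + y) = f n x + f n y" and scale: "f n (scl c x) = c * f n x"
    and fsum: "f n (\<Sum>i\<in>I. h i) = (\<Sum>i\<in>I. f n (h i))" and diff: "f n (x - y) = f n x - f n y"
    for n c x y and I :: "nat set" and h
  proof -
    interpret f: Vector_Spaces.linear scl "(*)" "f n" by (rule lin)
    show "f n (x + y) = f n x + f n y" "f n (scl c x) = c * f n x"
      "f n (\<Sum>i\<in>I. h i) = (\<Sum>i\<in>I. f n (h i))" "f n (x - y) = f n x - f n y"
      by (simp_all add: f.add f.scale f.sum f.diff)
  qed
  define \<gamma> where "\<gamma> t = (\<Sum>n. scl (of_real (t ^ n)) (e n))" for t
  have half: "(\<lambda>n. (1/2 :: real) ^ n) sums 2" using geometric_sums[of "1/2 :: real"] by simp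
  have term_le: "norm (scl (of_real a) (e n)) \<le> b * (1/2) ^ n" if "\<bar>a\<bar> \<le> b * real (Suc n)" for a b n
  proof -
    have "norm (scl (of_real a) (e n)) = \<bar>a\<bar> * norm (e n)" by (simp add: X.norm_scale)
    also have "\<dots> \<le> (b * real (Suc n)) * r n" using that e by (intro mult_mono) auto
    also have "\<dots> = b * (1/2) ^ n" by (simp add: r_def del: of_nat_Suc)
    finally show ?thesis .
  qed
  have t1: "norm (scl (of_real (t ^ n)) (e n)) \<le> 1 * (1/2) ^ n" if "t \<in> {0..1}" for t n
  proof (rule term_le)
    have "t ^ n \<le> 1" "0 \<le> t ^ n" using that by (auto simp: power_le_one)
    then show "\<bar>t ^ n\<bar> \<le> 1 * real (Suc n)" by simp
  qed
  have summ: "summable (\<lambda>n. scl (of_real (t ^ n)) (e n))" if "t \<in> {0..1}" for t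
    by (rule summable_comparison_test'[of "\<lambda>n. 1 * (1/2) ^ n" 0]) (use t1[OF that] half in \<open>auto simp: sums_iff\<close>)
  have norm_suminf_le': "norm (suminf h) \<le> b * 2"
    if h: "\<And>n. norm (h n) \<le> b * (1/2) ^ n" for h :: "nat \<Rightarrow> 'a" and b
  proof -
    have s: "(\<lambda>n. b * (1/2) ^ n) sums (b * 2)" using half by (rule sums_mult)
    have sh: "summable (\<lambda>n. norm (h n))"
      by (rule summable_comparison_test'[OF sums_summable[OF s], of 0]) (use h in simp)
    have "norm (suminf h) \<le> (\<Sum>n. norm (h n))" by (rule summable_norm[OF sh])
    also have "\<dots> \<le> (\<Sum>n. b * (1/2) ^ n)" by (rule suminf_le[OF h sh sums_summable[OF s]])
    also have "\<dots> = b * 2" using s by (simp add: sums_iff)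
    finally show ?thesis .
  qed
  show thesis
  proof (rule that[OF add scale bd])
    show "norm (\<gamma> t) \<le> 2" if "t \<in> {0..1}" for t
      using norm_suminf_le'[OF t1[OF that]] by (simp add: \<gamma>_def)
  next
    fix s t :: real assume s: "s \<in> {0..1}" and t: "t \<in> {0..1}"
    have "\<gamma> s - \<gamma> t = (\<Sum>n. scl (of_real (s ^ n - t ^ n)) (e n))"
      unfolding \<gamma>_def suminf_diff[OF summ[OF s] summ[OF t]] by (simp add: X.scale_left_diff_distrib)
    also have "norm \<dots> \<le> \<bar>s - t\<bar> * 2"
    proof (intro norm_suminf_le' term_le)
      fix n
      have "\<bar>s ^ n - t ^ n\<bar> \<le> real n * \<bar>s - t\<bar>"
        using norm_power_diff[of s t n] s t by simp
      also have "\<dots> \<le> \<bar>s - t\<bar> * real (Suc n)" by (simp add: algebra_simps)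
      finally show "\<bar>s ^ n - t ^ n\<bar> \<le> \<bar>s - t\<bar> * real (Suc n)" .
    qed
    finally show "norm (\<gamma> s - \<gamma> t) \<le> 2 * \<bar>s - t\<bar>" by simp
  next
    fix n t assume t: "t \<in> {0..1::real}"
    obtain c where c: "c \<ge> 0" "\<And>x. norm (f n x) \<le> c * norm x" using bd by blast
    let ?S = "\<lambda>m. \<Sum>i<m. scl (of_real (t ^ i)) (e i)"
    have "?S \<longlonglongrightarrow> \<gamma> t" unfolding \<gamma>_def by (rule summable_LIMSEQ[OF summ[OF t]])
    then have "(\<lambda>m. c * norm (?S m - \<gamma> t)) \<longlonglongrightarrow> c * 0"
      by (intro tendsto_mult tendsto_const tendsto_norm_zero) (simp add: LIM_zero)
    then have lim0: "(\<lambda>m. c * norm (?S m - \<gamma> t)) \<longlonglongrightarrow> 0" by simp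
    have "(\<lambda>m. f n (?S m) - f n (\<gamma> t)) \<longlonglongrightarrow> 0"
    proof (rule Lim_null_comparison[OF always_eventually lim0], rule allI)
      show "norm (f n (?S m) - f n (\<gamma> t)) \<le> c * norm (?S m - \<gamma> t)" for m
        unfolding diff[symmetric] by (rule c(2))
    qed
    moreover have "\<forall>\<^sub>F m in sequentially. f n (?S m) - f n (\<gamma> t) = of_real (t ^ n) - f n (\<gamma> t)"
    proof -
      have "f n (?S m) = of_real (t ^ n)" if "m \<ge> Suc n" for m
      proof -
        have "f n (?S m) = (\<Sum>i<m. if i = n then of_real (t ^ i) else 0)"
          by (simp add: fsum scale orth if_distrib eq_commute cong: if_cong)
        then show ?thesis using that by simp
      qed
      then show ?thesis unfolding eventually_sequentially by (intro exI[of _ "Suc n"]) auto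
    qed
    ultimately have "(\<lambda>m::nat. of_real (t ^ n) - f n (\<gamma> t)) \<longlonglongrightarrow> 0" by (rule Lim_transform_eventually)
    then show "f n (\<gamma> t) = of_real (t ^ n)" by (simp add: LIMSEQ_const_iff)
  qed
qed

text \<open>The norm is fixed before the realization of the tensor product. That realization enters
  only through its completeness, its elementary tensors and the functionals induced by bounded
  bilinear forms.\<close>

theorem theorem1:
  fixes scl :: "'k::real_or_complex \<Rightarrow> 'a::banach \<Rightarrow> 'a"
  assumes "normed_space_on scl UNIV norm"
    and "infinite_dimensional scl"
  shows "\<exists>N. equivalent_norm scl N \<and>
    (\<forall>(sW :: 'k \<Rightarrow> 'w::ab_group_add \<Rightarrow> 'w) W q \<tau>.
      completed_projective_tensor scl N scl N sW W q \<tau> \<longrightarrow>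
      (\<exists>\<Psi>. \<Psi> ` prob01 \<subseteq> {u \<in> W. q u = 1} \<and>
        affine_on_prob01 sW \<Psi> \<and>
        embedding_map weak_star (norm_topology W q) \<Psi> \<and>
        \<Psi> ` prob01 \<subseteq> INA_proj N N sW W q \<tau> \<and>
        (\<forall>\<alpha>\<in>prob01. \<Psi> \<alpha> \<in> NA_proj N N sW W q \<tau> \<longleftrightarrow> countably_supported \<alpha>)))"
proof -
  obtain \<gamma> :: "real \<Rightarrow> 'a" and f :: "nat \<Rightarrow> 'a \<Rightarrow> 'k" where
    fadd: "\<And>n x y. f n (x + y) = f n x + f n y" and fscale: "\<And>n c x. f n (scl c x) = c * f n x"
    and fbd: "\<And>n. \<exists>c\<ge>0. \<forall>x. norm (f n x) \<le> c * norm x"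
    and \<gamma>bd: "\<And>t. t \<in> {0..1} \<Longrightarrow> norm (\<gamma> t) \<le> 2"
    and \<gamma>lip: "\<And>s t. s \<in> {0..1} \<Longrightarrow> t \<in> {0..1} \<Longrightarrow> norm (\<gamma> s - \<gamma> t) \<le> 2 * \<bar>s - t\<bar>"
    and f\<gamma>: "\<And>n t. t \<in> {0..1} \<Longrightarrow> f n (\<gamma> t) = of_real (t ^ n)"
    using moment_curve_exists[OF assms] by metis
  obtain c where c: "\<And>n. c n \<ge> 0" "\<And>n x. norm (f n x) \<le> c n * norm x" using fbd by metis
  have f2: "norm (f i x * f j y) \<le> c i * c j * (norm x * norm y)" for i j x y
  proof -
    have "norm (f i x * f j y) \<le> (c i * norm x) * (c j * norm y)"
      unfolding norm_mult using c by (intro mult_mono) auto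
    then show ?thesis by (simp add: mult_ac)
  qed
  define B where "B x y = f 0 x * f 0 y - f 2 x * f 0 y + 2 * (f 1 x * f 1 y) - f 0 x * f 2 y" for x y
  \<comment> \<open>The products bound the four terms of \<open>B\<close>, the two mixed ones
    together; the summand \<open>c 0\<close> makes \<open>M\<close> a bound for \<open>f 0\<close>
    as well, and 1 ensures \<open>M \<ge> 1\<close>.\<close>
  define M where "M = 1 + c 0 + c 0 * c 0 + 2 * (c 2 * c 0) + 2 * (c 1 * c 1)"
  have cc: "0 \<le> c i * c j" for i j using c(1) by simp
  interpret X: normed_space_on scl UNIV norm by (rule assms(1))
  interpret R: curve_renorming scl \<gamma> B "f 0" M
  proof
    show "norm (B x y) \<le> M * norm x * norm y" for x y
    proof -
      have "norm (B x y) \<le> norm (f 0 x * f 0 y) + norm (f 2 x * f 0 y) + norm (2 * (f 1 x * f 1 y)) + norm (f 0 x * f 2 y)"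
        unfolding B_def
        by (meson add_mono norm_triangle_ineq norm_triangle_ineq4 order_refl order_trans)
      also have "\<dots> \<le> (c 0 * c 0) * (norm x * norm y) + (c 2 * c 0) * (norm x * norm y)
          + 2 * ((c 1 * c 1) * (norm x * norm y)) + (c 0 * c 2) * (norm x * norm y)"
        using f2 by (intro add_mono) (auto simp: norm_mult[of 2])
      also have "\<dots> = (M - (1 + c 0)) * (norm x * norm y)" by (simp add: M_def algebra_simps)
      also have "\<dots> \<le> M * (norm x * norm y)" using c(1)[of 0] by (intro mult_right_mono) auto
      finally show ?thesis by (simp add: mult.assoc)
    qed
    show "1 \<le> M" using c(1)[of 0] cc by (simp add: M_def)
    show "norm (f 0 x) \<le> M * norm x" for x
      using c(2)[of 0 x] cc by (intro order_trans[OF c(2) mult_right_mono]) (simp_all add: M_def)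
    show "B (\<gamma> s) (\<gamma> t) = of_real (1 - (s - t)\<^sup>2)" if "s \<in> {0..1}" "t \<in> {0..1}" for s t
      using that by (simp add: B_def f\<gamma> power2_eq_square algebra_simps)
  qed (use assms(1) \<gamma>bd \<gamma>lip fadd fscale f\<gamma> in \<open>auto simp: B_def algebra_simps\<close>)
  let ?N = "R.curve_norm"
  have N: "normed_space_on scl UNIV ?N" using R.equivalent_curve_norm by (simp add: equivalent_norm_def)
  interpret N: normed_space_on scl UNIV ?N by (rule N)
  note N0 = R.curve_norm_nonneg
  have M1: "1 \<le> M" by (rule R.M_ge_1)
  have N\<gamma>lip: "?N (\<gamma> s - \<gamma> t) \<le> 8 * M * \<bar>s - t\<bar>" if "s \<in> {0..1}" "t \<in> {0..1}" for s t
  proof -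
    have "?N (\<gamma> s - \<gamma> t) \<le> 4 * M * norm (\<gamma> s - \<gamma> t)" by (rule R.curve_norm_le_norm)
    also have "\<dots> \<le> 4 * M * (2 * \<bar>s - t\<bar>)" using \<gamma>lip[OF that] M1 by (intro mult_left_mono) auto
    finally show ?thesis by simp
  qed
  obtain \<rho> :: "'k \<Rightarrow> real" where \<rho>: "\<And>a b. \<rho> (a + b) = \<rho> a + \<rho> b" "\<And>r a. \<rho> (of_real r * a) = r * \<rho> a"
    "\<And>a. \<bar>\<rho> a\<bar> \<le> norm a" "\<rho> 1 = 1" "\<And>a. norm a \<le> 1 \<Longrightarrow> \<rho> a = 1 \<Longrightarrow> a = 1"
    using real_part_functional[where 'k = 'k] by blast
  have \<rho>r: "\<rho> (of_real r) = r" for r using \<rho>(2)[of r 1] \<rho>(4) by simp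
  show ?thesis
  proof (intro exI[of _ ?N] conjI R.equivalent_curve_norm allI impI)
    fix sW :: "'k \<Rightarrow> 'w \<Rightarrow> 'w" and W q \<tau>
    assume T: "completed_projective_tensor scl ?N scl ?N sW W q \<tau>"
    then have "banach_space_on sW W q" by (auto simp: completed_projective_tensor_def completion_map_def)
    then interpret W: banach_space_on sW W q .
    note E = elementary_tensor[OF N N T]
    define v where "v t = \<tau> (\<gamma> t) (\<gamma> t)" for t
    have \<tau>diff: "\<tau> (x - x') y = \<tau> x y - \<tau> x' y" "\<tau> y (x - x') = \<tau> y x - \<tau> y x'" for x x' y
      using E(2)[of "x - x'" x' y] E(3)[of y "x - x'" x'] by (simp_all only: diff_add_cancel add_diff_cancel)
    \<comment> \<open>In the new norm the curve is Lipschitz with constant \<open>8 * M\<close>, and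
      changing one factor of the tensor at a time doubles it.\<close>
    interpret V: curve_in_banach sW W q v "16 * M"
    proof
      fix s t :: real assume s: "s \<in> {0..1}" and t: "t \<in> {0..1}"
      have "v s - v t = \<tau> (\<gamma> s - \<gamma> t) (\<gamma> s) + \<tau> (\<gamma> t) (\<gamma> s - \<gamma> t)" by (simp add: v_def \<tau>diff)
      then have "q (v s - v t) \<le> q (\<tau> (\<gamma> s - \<gamma> t) (\<gamma> s)) + q (\<tau> (\<gamma> t) (\<gamma> s - \<gamma> t))"
        using W.norm_triangle E(1) by simp
      also have "\<dots> \<le> ?N (\<gamma> s - \<gamma> t) * ?N (\<gamma> s) + ?N (\<gamma> t) * ?N (\<gamma> s - \<gamma> t)" by (intro add_mono E(6))
      also have "\<dots> \<le> ?N (\<gamma> s - \<gamma> t) * 1 + 1 * ?N (\<gamma> s - \<gamma> t)"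
        using R.curve_norm_curve s t N0 by (intro add_mono mult_left_mono mult_right_mono) auto
      also have "\<dots> \<le> 16 * M * \<bar>s - t\<bar>" using N\<gamma>lip[OF s t] by simp
      finally show "q (v s - v t) \<le> 16 * M * \<bar>s - t\<bar>" .
    next
      fix t :: real assume t: "t \<in> {0..1}"
      show "v t \<in> W" unfolding v_def by (rule E(1))
      have "q (v t) \<le> ?N (\<gamma> t) * ?N (\<gamma> t)" unfolding v_def by (rule E(6))
      also have "\<dots> \<le> 1 * 1" using R.curve_norm_curve[OF t] N0 by (intro mult_mono) auto
      finally show "q (v t) \<le> 1" by simp
    qed (use M1 in simp)
    \<comment> \<open>The factor 4 comes from estimating the old norm by twice the new one in both
      variables.\<close>
    have "\<exists>L. (\<forall>x\<in>W. \<forall>y\<in>W. L (x + y) = L x + L y) \<and> (\<forall>r. \<forall>x\<in>W. L (sW (of_real r) x) = r * L x) \<and>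
        (\<forall>x\<in>W. \<bar>L x\<bar> \<le> (4 * (c i * c 0)) * q x) \<and> (\<forall>x y. L (\<tau> x y) = \<rho> (f i x * f 0 y))" for i
    proof -
      have "bilinear_form scl scl (\<lambda>x y. f i x * f 0 y)"
        by (simp add: bilinear_form_iff[OF N N] fadd fscale algebra_simps)
      moreover have "norm (f i x * f 0 y) \<le> (4 * (c i * c 0)) * (?N x * ?N y)" for x y
      proof -
        have "norm x * norm y \<le> (2 * ?N x) * (2 * ?N y)"
          using R.norm_le_curve_norm N0 by (intro mult_mono) auto
        then have "c i * c 0 * (norm x * norm y) \<le> c i * c 0 * ((2 * ?N x) * (2 * ?N y))"
          using cc by (intro mult_left_mono)
        then show ?thesis using f2[of i x 0 y] by (simp add: mult_ac)
      qed
      moreover have "0 \<le> 4 * (c i * c 0)" using cc by simp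
      ultimately obtain L where "\<And>x y. x \<in> W \<Longrightarrow> y \<in> W \<Longrightarrow> L (x + y) = L x + L y"
        "\<And>r x. x \<in> W \<Longrightarrow> L (sW (of_real r) x) = r * L x"
        "\<And>x. x \<in> W \<Longrightarrow> \<bar>L x\<bar> \<le> (4 * (c i * c 0)) * q x" "\<And>x y. L (\<tau> x y) = \<rho> (f i x * f 0 y)"
        using bilinear_form_functional[OF N N T _ _ _ \<rho>(1-3), of "\<lambda>x y. f i x * f 0 y" "4 * (c i * c 0)"] by blast
      then show ?thesis by blast
    qed
    then obtain L where L: "\<And>i x y. x \<in> W \<Longrightarrow> y \<in> W \<Longrightarrow> L i (x + y) = L i x + L i y"
        "\<And>i r x. x \<in> W \<Longrightarrow> L i (sW (of_real r) x) = r * L i x"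
        "\<And>i x. x \<in> W \<Longrightarrow> \<bar>L i x\<bar> \<le> (4 * (c i * c 0)) * q x" "\<And>i x y. L i (\<tau> x y) = \<rho> (f i x * f 0 y)"
      by metis
    obtain l where l: "\<And>x y. x \<in> W \<Longrightarrow> y \<in> W \<Longrightarrow> l (x + y) = l x + l y"
        "\<And>r x. x \<in> W \<Longrightarrow> l (sW (of_real r) x) = r * l x"
        "\<And>x. x \<in> W \<Longrightarrow> \<bar>l x\<bar> \<le> 1 * q x" "\<And>x y. l (\<tau> x y) = \<rho> (B x y)"
    proof (rule bilinear_form_functional[OF N N T _ _ _ \<rho>(1-3), of B 1])
      show "bilinear_form scl scl B"
        by (simp add: bilinear_form_iff[OF N N] R.form_simps R.form_add R.form_scale)
      show "norm (B x y) \<le> 1 * (?N x * ?N y)" for x y using R.form_le_curve_norm by simp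
    qed auto
    interpret P: moment_curve sW W q v "16 * M" L "\<lambda>i. 4 * (c i * c 0)" l
    proof
      show "L i (v t) = t ^ i" if "t \<in> {0..1}" for i t
        using that by (simp add: v_def L(4) f\<gamma> \<rho>r del: of_real_power)
      show "l (v t) = 1" if "t \<in> {0..1}" for t
        using that R.form_curve[OF that that] by (simp add: v_def l(4) \<rho>(4))
    qed (use L l cc in auto)
    have v_inj: "inj_on v {0..1}"
      using P.L_curve[of _ 1] by (intro inj_onI) (metis power_one_right)
    \<comment> \<open>One constant serves both bounds: \<open>8 * M\<close> for the curve and
      \<open>2 * c 1\<close> for the real part of \<open>f 1\<close>.\<close>
    interpret I: lifted_curve sW W q v "16 * M" scl ?N \<gamma> \<tau> "\<lambda>x. \<rho> (f 1 x)" "8 * M + 2 * c 1"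
    proof
      show "?N (\<gamma> s - \<gamma> t) \<le> (8 * M + 2 * c 1) * \<bar>s - t\<bar>" if "s \<in> {0..1}" "t \<in> {0..1}" for s t
        using N\<gamma>lip[OF that] mult_right_mono[of "8 * M" "8 * M + 2 * c 1" "\<bar>s - t\<bar>"] c(1)[of 1] by simp
      show "\<bar>\<rho> (f 1 x) - \<rho> (f 1 y)\<bar> \<le> (8 * M + 2 * c 1) * ?N (x - y)" for x y
      proof -
        have "\<rho> (f 1 x) - \<rho> (f 1 y) = \<rho> (f 1 (x - y))"
          using \<rho>(1)[of "f 1 (x - y)" "f 1 y"] fadd[of 1 "x - y" y] by simp
        also have "\<bar>\<dots>\<bar> \<le> norm (f 1 (x - y))" by (rule \<rho>)
        also have "\<dots> \<le> c 1 * norm (x - y)" by (rule c)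
        also have "\<dots> \<le> c 1 * (2 * ?N (x - y))" by (intro mult_left_mono R.norm_le_curve_norm c)
        also have "\<dots> \<le> (8 * M + 2 * c 1) * ?N (x - y)" using M1 N0[of "x - y"] by (simp add: distrib_right)
        finally show ?thesis .
      qed
      show "\<rho> (f 1 (\<gamma> t)) = t" if "t \<in> {0..1}" for t using f\<gamma>[OF that, of 1] \<rho>r by simp
    qed (use N v_inj E(1) R.curve_norm_curve in \<open>auto simp: v_def\<close>)
    have NA: "V.vint \<alpha> \<in> NA_proj ?N ?N sW W q \<tau> \<longleftrightarrow> countably_supported \<alpha>" if \<alpha>: "\<alpha> \<in> prob01" for \<alpha>
    proof
      \<comment> \<open>The atoms give a series with \<open>x n = y n = \<gamma> (t n)\<close> in
        the ball and weights summing to 1, the norm of the integral.\<close>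
      assume "countably_supported \<alpha>"
      then obtain b t where b: "\<And>n. 0 \<le> b n" "b sums 1" "\<And>n. t n \<in> {0..1}"
        "limitin (norm_topology W q) (\<lambda>k. \<Sum>n<k. sW (of_real (b n)) (v (t n))) (V.vint \<alpha>) sequentially"
        using P.atomic_if_countably_supported[OF \<alpha>] by blast
      show "V.vint \<alpha> \<in> NA_proj ?N ?N sW W q \<tau>"
        unfolding NA_proj_def
        using b V.vint_hat(1)[OF \<alpha>] P.norm_vint[OF \<alpha>] R.curve_norm_curve
        by (auto simp: unit_ball_def v_def intro!: exI[of _ b] exI[of _ "\<lambda>n. \<gamma> (t n)"])
    next
      assume "V.vint \<alpha> \<in> NA_proj ?N ?N sW W q \<tau>"
      then obtain b x y where xy: "\<And>n. ?N (x n) \<le> 1" "\<And>n. ?N (y n) \<le> 1" and b: "\<And>n. 0 \<le> b n"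
        and lim: "limitin (norm_topology W q) (\<lambda>k. \<Sum>n<k. sW (of_real (b n)) (\<tau> (x n) (y n))) (V.vint \<alpha>) sequentially"
        and b1: "b sums 1"
        using P.norm_vint[OF \<alpha>] by (auto simp: NA_proj_def unit_ball_def)
      have B1: "norm (B (x n) (y n)) \<le> 1" for n
      proof -
        have "?N (x n) * ?N (y n) \<le> 1 * 1" using xy N0 by (intro mult_mono) auto
        then show ?thesis using R.form_le_curve_norm[of "x n" "y n"] by simp
      qed
      have SW: "(\<Sum>n<k. sW (of_real (b n)) (\<tau> (x n) (y n))) \<in> W" for k by (intro V.W_closed E(1))
      have lsum: "l (\<Sum>n<k. sW (of_real (b n)) (\<tau> (x n) (y n))) = (\<Sum>n<k. b n * \<rho> (B (x n) (y n)))" for k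
      proof (induction k)
        case 0
        then show ?case using l(1)[of 0 0] V.W_closed by simp
      next
        case (Suc k)
        then show ?case using l(1)[OF SW[of k], of "sW (of_real (b k)) (\<tau> (x k) (y k))"] E(1) V.W_closed
          by (simp add: l(2,4))
      qed
      have "(\<lambda>k. l (\<Sum>n<k. sW (of_real (b n)) (\<tau> (x n) (y n)))) \<longlonglongrightarrow> l (V.vint \<alpha>)"
        by (rule V.functional_tendsto[OF l(1) l(3) _ SW lim]) auto
      moreover have "l (V.vint \<alpha>) = 1"
      proof -
        have "l (V.vint \<alpha>) = (\<integral>t. l (v t) \<partial>\<alpha>)" by (rule V.functional_vint[OF \<alpha> l(1-3)]) auto
        also have "\<dots> = (\<integral>t. 1 \<partial>\<alpha>)"
          using prob01D(3)[OF \<alpha>] P.l_curve by (intro Bochner_Integration.integral_cong) auto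
        finally show ?thesis using integral_const_prob01[OF \<alpha>, of 1] by simp
      qed
      ultimately have "(\<lambda>n. b n * \<rho> (B (x n) (y n))) sums 1" by (simp add: sums_def lsum)
      \<comment> \<open>The weights and the values of \<open>l\<close> have the same sum, so the
        nonnegative deficits sum to 0 and each of them vanishes.\<close>
      then have d: "(\<lambda>n. b n - b n * \<rho> (B (x n) (y n))) sums 0" using sums_diff[OF b1] by fastforce
      have \<rho>B: "\<rho> (B (x n) (y n)) \<le> 1" for n using \<rho>(3)[of "B (x n) (y n)"] B1[of n] by linarith
      have nn: "0 \<le> b n - b n * \<rho> (B (x n) (y n))" for n
        using mult_left_mono[OF \<rho>B b, of n n] by simp
      have zero: "b n - b n * \<rho> (B (x n) (y n)) = 0" for n
        using d nn suminf_eq_zero_iff[of "\<lambda>n. b n - b n * \<rho> (B (x n) (y n))"] by (auto simp: sums_iff)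
      have "\<exists>t\<in>{0..1}. sW (of_real (b n)) (\<tau> (x n) (y n)) = sW (of_real (b n)) (v t)" for n
      proof (cases "b n = 0")
        case True
        \<comment> \<open>A term of weight 0 says nothing about \<open>x n\<close> and
          \<open>y n\<close>; any parameter will do.\<close>
        then show ?thesis by (intro bexI[of _ 0]) auto
      next
        case False
        then have "\<rho> (B (x n) (y n)) = 1" using zero[of n] by simp
        then have "B (x n) (y n) = 1" by (rule \<rho>(5)[OF B1])
        then obtain t a a' where t: "t \<in> {0..1}" "x n = scl a (\<gamma> t)" "y n = scl a' (\<gamma> t)" "a * a' = 1"
          using R.form_attains_only_on_curve[OF xy(1,2)] by metis
        \<comment> \<open>Bilinearity moves both scalars out of the tensor, where they cancel
          because \<open>a * a' = 1\<close>.\<close>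
        have "\<tau> (x n) (y n) = sW (a * a') (v t)" by (simp add: t(2,3) v_def E(4,5))
        then have "\<tau> (x n) (y n) = v t" by (simp add: t(4))
        then show ?thesis using t(1) by auto
      qed
      then obtain t where t: "\<And>n. t n \<in> {0..1}"
        "\<And>n. sW (of_real (b n)) (\<tau> (x n) (y n)) = sW (of_real (b n)) (v (t n))" by metis
      show "countably_supported \<alpha>"
        by (rule P.countably_supported_if_atomic[OF \<alpha> b b1 t(1)]) (use lim t(2) in simp)
    qed
    show "\<exists>\<Psi>. \<Psi> ` prob01 \<subseteq> {u \<in> W. q u = 1} \<and> affine_on_prob01 sW \<Psi> \<and>
        embedding_map weak_star (norm_topology W q) \<Psi> \<and> \<Psi> ` prob01 \<subseteq> INA_proj ?N ?N sW W q \<tau> \<and>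
        (\<forall>\<alpha>\<in>prob01. \<Psi> \<alpha> \<in> NA_proj ?N ?N sW W q \<tau> \<longleftrightarrow> countably_supported \<alpha>)"
      using V.vint_hat(1) P.norm_vint V.vint_affine P.embedding_map_vint I.vint_INA[OF _ P.norm_vint] NA
      by (intro exI[of _ V.vint]) auto
  qed
qed

end
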